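(* Let $m,n$ be natural numbers (positive integers). For a function $\psi:(-\infty,0)^n\to(-\infty,0]$ the following assertions are equivalent: (1) $\psi\in\mathcal T_n$; (2) for $s\in(-\infty,0)^n$, $$\psi(s)=c_0+c_1\cdot s+\int_{\mathbb R_+^n\setminus\{0\}}\left(e^{s\cdot u}-1\right)d\mu(u),$$ where $$c_0=\psi(-0):=\lim_{s\to-0}\psi(s),\qquad c_1=\nabla\psi(-\infty)\in\mathbb R_+^n,$$ and the positive measure $\mu$ on $\mathbb R_+^n\setminus\{0\}$ is uniquely determined and has the following properties: for sufficiently small $\delta>0$ the functions $u\mapsto u_j$, $j=1,\dots,n$, are $\mu$-integrable on $[0,\delta)^n\setminus\{0\}$, and $\mu(\mathbb R_+^n\setminus[0,\delta)^n)<\infty$; (3) for every function $f$ absolutely monotone on $(-\infty,0)^m$, the composite function $(s,r)\mapsto f(\psi(s),r)$ is absolutely monotone on $(-\infty,0)^{m+n-1}$ ($s\in(-\infty,0)^n$, $r\in(-\infty,0)^{m-1}$).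
   Context: $\mathbb R_+=[0,\infty)$. For vectors $a,b\in\mathbb C^n$, $a\cdot b=\sum_{i=1}^n a_ib_i$. All measures are Radon measures. For a positive integer $k$, a function in $C^\infty((-\infty,0)^k)$ is called absolutely monotone if it is nonnegative together with all its partial derivatives of all orders. The class $\mathcal T_n$ (negative Bernstein functions of $n$ variables) consists of all nonpositive functions in $C^\infty((-\infty,0)^n)$ all of whose first-order partial derivatives are absolutely monotone; the last condition is equivalent to $\partial^\alpha\psi\ge 0$ for every multi-index $\alpha\neq 0$. The notation $s\to-0$ means $s_1\to-0,\dots,s_n\to-0$ (each $s_i$ tends to $0$ from the left). $\nabla\psi(-\infty)$ denotes the limit of the gradient $\nabla\psi(s)$ as $s_1\to-\infty,\dots,s_n\to-\infty$. When $m=1$ the variable $r$ in (3) is absent.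
   Formalization: In (3), where ψ(s)=0 the value f(0,r) is undefined (e.g. ψ=0, f(x)=-1/x); it is read as the limit of f(t,r) for t→-0, and (3) ranges only over those absolutely monotone f for which these limits are finite. If ψ<0 everywhere, (3) is literal. *)

theory Defs
  imports "HOL-Analysis.Analysis"
begin

text \<open>A vector of dimension \<open>n\<close> is an element of the extensional product
  \<open>{..<n} \<rightarrow>\<^sub>E UNIV\<close>. On it, the product topology and the Borel sets of
  \<^typ>\<open>nat \<Rightarrow> real\<close> induce those of Euclidean \<open>n\<close>-space. Carriers are explicit because
  dimensions \<open>n\<close>, \<open>m\<close> and \<open>m + n - 1\<close> (with \<open>m - 1\<close> possibly \<open>0\<close>) occur together.\<close>

definition neg_orthant :: "nat \<Rightarrow> (nat \<Rightarrow> real) set" where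
  "neg_orthant n = {..<n} \<rightarrow>\<^sub>E {..<0}"

definition nonneg_orthant :: "nat \<Rightarrow> (nat \<Rightarrow> real) set" where
  "nonneg_orthant n = {..<n} \<rightarrow>\<^sub>E {0..}"

definition origin :: "nat \<Rightarrow> nat \<Rightarrow> real" where
  "origin n = (\<lambda>i\<in>{..<n}. 0)"

definition half_open_cube :: "nat \<Rightarrow> real \<Rightarrow> (nat \<Rightarrow> real) set" where
  "half_open_cube n \<delta> = {..<n} \<rightarrow>\<^sub>E {0..<\<delta>}"

definition dot :: "nat \<Rightarrow> (nat \<Rightarrow> real) \<Rightarrow> (nat \<Rightarrow> real) \<Rightarrow> real" where
  "dot n a b = (\<Sum>i<n. a i * b i)"

definition partial_deriv ::
    "nat \<Rightarrow> ((nat \<Rightarrow> real) \<Rightarrow> real) \<Rightarrow> (nat \<Rightarrow> real) \<Rightarrow> real" where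
  "partial_deriv i f s = deriv (\<lambda>t. f (s(i := t))) (s i)"

text \<open>Iterated partial derivatives are indexed by lists of coordinates, so that no order of
  differentiation is preferred in the definition of smoothness.\<close>

primrec partial_derivs ::
    "nat list \<Rightarrow> ((nat \<Rightarrow> real) \<Rightarrow> real) \<Rightarrow> (nat \<Rightarrow> real) \<Rightarrow> real" where
  "partial_derivs [] f = f"
| "partial_derivs (i # js) f = partial_deriv i (partial_derivs js f)"

definition smooth_on_neg_orthant :: "nat \<Rightarrow> ((nat \<Rightarrow> real) \<Rightarrow> real) \<Rightarrow> bool" where
  "smooth_on_neg_orthant n f \<longleftrightarrow>
     (\<forall>js\<in>lists {..<n}.
        continuous_on (neg_orthant n) (partial_derivs js f) \<and>
        (\<forall>s\<in>neg_orthant n. \<forall>i<n.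
           (\<lambda>t. partial_derivs js f (s(i := t))) differentiable (at (s i))))"

definition absolutely_monotone :: "nat \<Rightarrow> ((nat \<Rightarrow> real) \<Rightarrow> real) \<Rightarrow> bool" where
  "absolutely_monotone n f \<longleftrightarrow>
     smooth_on_neg_orthant n f \<and>
     (\<forall>js\<in>lists {..<n}. \<forall>s\<in>neg_orthant n. 0 \<le> partial_derivs js f s)"

definition negative_bernstein :: "nat \<Rightarrow> ((nat \<Rightarrow> real) \<Rightarrow> real) set" where
  "negative_bernstein n =
     {\<psi>. smooth_on_neg_orthant n \<psi> \<and>
          (\<forall>s\<in>neg_orthant n. \<psi> s \<le> 0) \<and>
          (\<forall>i<n. absolutely_monotone n (partial_deriv i \<psi>))}"

text \<open>The filter of all \<open>s\<close> in the negative orthant all of whose coordinates tend along \<open>F\<close>: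
  \<open>F = at_left 0\<close> gives \<open>s \<rightarrow> -0\<close>, and \<open>F = at_bot\<close> gives \<open>s\<^sub>1 \<rightarrow> -\<infinity>, \<dots>, s\<^sub>n \<rightarrow> -\<infinity>\<close>.\<close>

definition coordwise :: "nat \<Rightarrow> real filter \<Rightarrow> (nat \<Rightarrow> real) filter" where
  "coordwise n F =
     inf (INF i\<in>{..<n}. filtercomap (\<lambda>s. s i) F) (principal (neg_orthant n))"

definition radon_measure_on :: "'a::t2_space set \<Rightarrow> 'a measure \<Rightarrow> bool" where
  "radon_measure_on X M \<longleftrightarrow>
     sets M = sets (restrict_space borel X) \<and>
     (\<forall>K. compact K \<and> K \<subseteq> X \<longrightarrow> emeasure M K < \<infinity>) \<and>
     (\<forall>A\<in>sets M. emeasure M A = (SUP K\<in>{K. compact K \<and> K \<subseteq> A}. emeasure M K))"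

definition vec_cons :: "nat \<Rightarrow> real \<Rightarrow> (nat \<Rightarrow> real) \<Rightarrow> nat \<Rightarrow> real" where
  "vec_cons m x r = (\<lambda>i\<in>{..<m}. case i of 0 \<Rightarrow> x | Suc j \<Rightarrow> r j)"

text \<open>A function \<open>f\<close> on the open orthant has no value at \<open>(\<psi> s, r)\<close> when \<open>\<psi> s = 0\<close>. There
  \<open>f (0, r)\<close> is read as the limit of \<open>f (t, r)\<close> for \<open>t \<rightarrow> -0\<close>, and the composite is defined if
  these limits are finite. The convention is void if \<open>\<psi> < 0\<close>; a function of class
  \<^const>\<open>negative_bernstein\<close> that vanishes somewhere is identically \<open>0\<close>.\<close>

definition composable ::
    "nat \<Rightarrow> nat \<Rightarrow> ((nat \<Rightarrow> real) \<Rightarrow> real) \<Rightarrow> ((nat \<Rightarrow> real) \<Rightarrow> real) \<Rightarrow> bool" where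
  "composable m n f \<psi> \<longleftrightarrow>
     (\<forall>s\<in>neg_orthant n. \<psi> s = 0 \<longrightarrow>
        (\<forall>r\<in>neg_orthant (m - 1). \<exists>l. ((\<lambda>t. f (vec_cons m t r)) \<longlongrightarrow> l) (at_left 0)))"

text \<open>The first \<open>n\<close> coordinates of the argument \<open>v\<close> are \<open>s\<close>, the remaining \<open>m - 1\<close> are \<open>r\<close>.\<close>

definition composite ::
    "nat \<Rightarrow> nat \<Rightarrow> ((nat \<Rightarrow> real) \<Rightarrow> real) \<Rightarrow> ((nat \<Rightarrow> real) \<Rightarrow> real) \<Rightarrow> (nat \<Rightarrow> real) \<Rightarrow> real" where
  "composite m n f \<psi> v =
     (let s = restrict v {..<n}; r = (\<lambda>j\<in>{..<m - 1}. v (n + j)) in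
        if \<psi> s < 0 then f (vec_cons m (\<psi> s) r)
        else Lim (at_left 0) (\<lambda>t. f (vec_cons m t r)))"

end

theory Submission
  imports Defs "HOL-Probability.Helly_Selection"
begin

text \<open>Smoothness is traded for finite differences. Call a function on \<open>(-\<infinity>, 0)\<^sup>n\<close> difference monotone if all
its iterated backward differences \<open>f(s) - f(s - h e\<^sub>i)\<close> with \<open>h > 0\<close> are nonnegative. Going down never
leaves the orthant, so this needs no care about domains, and the notion is visibly closed under
sums, products, integrals and, what smooth notions are not, pointwise limits. By the mean value
theorem an absolutely monotone function is difference monotone. The converse is the
Bernstein-Hausdorff-Widder theorem in \<open>n\<close> variables (\<open>diff_monotone_laplace\<close>): a difference monotone
function is a Laplace transform \<open>\<integral> e\<^bsup>s\<cdot>u\<^esup> d\<nu>(u)\<close> over \<open>[0,\<infinity>)\<^sup>n\<close>, and Laplace transforms can be differentiated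
under the integral sign.

That theorem is proved by reading \<open>f\<close> on a fine grid as a multivariate Hausdorff moment problem. The
differences of \<open>f\<close> are the weights of a discrete measure on the cube \<open>[0,1]\<^sup>n\<close> (\<open>bernstein_moment\<close>), the
coordinates being \<open>e\<^bsup>-u\<^sub>i\<^esup>\<close>. To extract a limit of these measures they are pulled back along a
space-filling curve \<open>\<real> \<rightarrow> [0,1]\<^sup>n\<close>, which reduces the compactness argument to Helly's selection theorem
on the line (\<open>weighted_points_subsequence\<close>). Uniqueness of Laplace transforms comes from the
Stone-Weierstrass theorem (\<open>laplace_transform_unique\<close>).

Let now the differences of \<open>\<psi> \<le> 0\<close>, but not \<open>\<psi>\<close> itself, be difference monotone. The sum over \<open>j\<close> of the
differences \<open>\<psi>(s) - \<psi>(s - e\<^sub>j)\<close> is the Laplace transform of some \<open>\<nu>\<close>, and the Levy measure has to be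
\<open>\<mu> = \<nu> / \<Sum>\<^sub>j (1 - e\<^bsup>-u\<^sub>j\<^esup>)\<close> off the origin. By uniqueness the same \<open>\<mu>\<close> serves every other difference, up to
an atom at the origin, whose mass is additive in the step and so linear; these masses are the
coefficients \<open>c\<^sub>1\<close>. Summing up differences gives the integral representation, and the bound \<open>\<psi> \<le> 0\<close> makes
\<open>1 - e\<^bsup>s\<cdot>u\<^esup>\<close> integrable. Conversely the representation may be differentiated under the integral.

For the composition with \<open>f\<close>, write \<open>f\<close> as a Laplace transform. It then suffices that \<open>e\<^bsup>a\<psi>\<^esup>\<close> is difference monotone for
\<open>a \<ge> 0\<close>, which follows from \<open>e\<^bsup>\<psi>(s)\<^esup> - e\<^bsup>\<psi>(s-h)\<^esup> = e\<^bsup>\<psi>(s-h)\<^esup> (e\<^bsup>\<psi>(s)-\<psi>(s-h)\<^esup> - 1)\<close> by induction on the order of the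
differences (\<open>diff_monotone_exp_mult\<close>). To recover \<open>\<psi>\<close> from its composites, take \<open>f(x,r) = e\<^bsup>ax\<^esup>\<close>. The differences of
\<open>(e\<^bsup>a\<psi>\<^esup> - 1) / a\<close> are difference monotone, hence so are those of the limit \<open>\<psi>\<close> for \<open>a \<rightarrow> 0\<close>.\<close>

section \<open>Backward differences\<close>

lemma neg_orthant_upd: "s \<in> neg_orthant n \<Longrightarrow> i < n \<Longrightarrow> t < 0 \<Longrightarrow> s(i := t) \<in> neg_orthant n"
  unfolding neg_orthant_def by (auto simp: PiE_iff extensional_def)

lemma neg_orthant_less: "s \<in> neg_orthant n \<Longrightarrow> i < n \<Longrightarrow> s i < 0"
  unfolding neg_orthant_def by (auto simp: PiE_iff)

lemma neg_orthant_down: "s \<in> neg_orthant n \<Longrightarrow> i < n \<Longrightarrow> 0 \<le> h \<Longrightarrow> s(i := s i - h) \<in> neg_orthant n"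
  by (rule neg_orthant_upd) (auto dest: neg_orthant_less)

text \<open>Any point is reached from any other by changing one coordinate at a time; the induction carries a
property along this path.\<close>

lemma neg_orthant_path_induct:
  assumes s: "s \<in> neg_orthant n" and b: "b \<in> neg_orthant n" and "P b"
    and step: "\<And>z i. z \<in> neg_orthant n \<Longrightarrow> P z \<Longrightarrow> i < n \<Longrightarrow> z i = b i \<Longrightarrow> P (z(i := s i))"
  shows "P s"
proof -
  define z where "z k = (\<lambda>i. if i < k then s i else b i)" for k
  have z: "z k \<in> neg_orthant n" for k
    using s b unfolding neg_orthant_def z_def PiE_iff by (auto simp: extensional_def)
  have "k \<le> n \<Longrightarrow> P (z k)" for k
  proof (induction k)
    case 0
    then show ?case using \<open>P b\<close> by (simp add: z_def)
  next
    case (Suc k)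
    have "z (Suc k) = (z k)(k := s k)"
      by (auto simp: z_def fun_eq_iff)
    moreover have "z k k = b k" by (simp add: z_def)
    ultimately show ?case using step[OF z, of k k] Suc by (metis Suc_leD Suc_le_lessD)
  qed
  moreover have "z n = s"
    using s b unfolding neg_orthant_def z_def PiE_iff extensional_def fun_eq_iff by auto
  ultimately show ?thesis by force
qed

definition back_diff :: "nat \<Rightarrow> real \<Rightarrow> ((nat \<Rightarrow> real) \<Rightarrow> real) \<Rightarrow> (nat \<Rightarrow> real) \<Rightarrow> real" where
  "back_diff i h f s = f s - f (s(i := s i - h))"

primrec back_diffs :: "(nat \<times> real) list \<Rightarrow> ((nat \<Rightarrow> real) \<Rightarrow> real) \<Rightarrow> (nat \<Rightarrow> real) \<Rightarrow> real" where
  "back_diffs [] f = f"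
| "back_diffs (p # ps) f = back_diffs ps (back_diff (fst p) (snd p) f)"

definition diff_monotone :: "nat \<Rightarrow> ((nat \<Rightarrow> real) \<Rightarrow> real) \<Rightarrow> bool" where
  "diff_monotone n f \<longleftrightarrow>
     (\<forall>ps\<in>lists ({..<n} \<times> {0<..}). \<forall>s\<in>neg_orthant n. 0 \<le> back_diffs ps f s)"

text \<open>The counterpart of \<^const>\<open>negative_bernstein\<close> for differences, without the bound \<open>\<psi> \<le> 0\<close>.\<close>

definition diff_bernstein :: "nat \<Rightarrow> ((nat \<Rightarrow> real) \<Rightarrow> real) \<Rightarrow> bool" where
  "diff_bernstein n \<psi> \<longleftrightarrow> (\<forall>i<n. \<forall>h>0. diff_monotone n (back_diff i h \<psi>))"

lemma back_diffs_cong: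
  assumes "ps \<in> lists ({..<n} \<times> {0<..})" "\<And>s. s \<in> neg_orthant n \<Longrightarrow> f s = g s"
    "s \<in> neg_orthant n"
  shows "back_diffs ps f s = back_diffs ps g s"
  using assms
proof (induction ps arbitrary: f g rule: list.induct)
  case (Cons p ps)
  obtain i h where p: "p = (i, h)" by (cases p)
  have "back_diff (fst p) (snd p) f s = back_diff (fst p) (snd p) g s" if "s \<in> neg_orthant n" for s
  proof -
    have "s(i := s i - h) \<in> neg_orthant n"
      using Cons.prems(1) p neg_orthant_down[OF that, of i h] by auto
    then have "f s = g s" "f (s(i := s i - h)) = g (s(i := s i - h))"
      using Cons.prems(2) that by blast+
    then show ?thesis
      by (simp add: back_diff_def p)
  qed
  moreover have "ps \<in> lists ({..<n} \<times> {0<..})" using Cons.prems(1) by simp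
  ultimately show ?case unfolding back_diffs.simps using Cons.IH Cons.prems(3) by blast
qed simp

lemma diff_monotone_cong:
  assumes "diff_monotone n f" "\<And>s. s \<in> neg_orthant n \<Longrightarrow> f s = g s"
  shows "diff_monotone n g"
  using assms back_diffs_cong[of _ n f g] unfolding diff_monotone_def by metis

lemma diff_monotone_nonneg: "diff_monotone n f \<Longrightarrow> s \<in> neg_orthant n \<Longrightarrow> 0 \<le> f s"
  unfolding diff_monotone_def by (metis back_diffs.simps(1) lists.Nil)

lemma diff_monotone_back_diff:
  assumes "diff_monotone n f" "i < n" "0 < h"
  shows "diff_monotone n (back_diff i h f)"
  unfolding diff_monotone_def
proof (intro ballI)
  fix ps :: "(nat \<times> real) list" and s assume "ps \<in> lists ({..<n} \<times> {0<..})" "s \<in> neg_orthant n"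
  then have "0 \<le> back_diffs ((i, h) # ps) f s"
    using assms unfolding diff_monotone_def by (metis SigmaI greaterThan_iff lessThan_iff lists.Cons)
  then show "0 \<le> back_diffs ps (back_diff i h f) s" by simp
qed

text \<open>Difference monotonicity is the largest property that implies nonnegativity and is inherited by
differences. This spares an induction over lists of steps in most closure proofs.\<close>

lemma diff_monotone_coinduct:
  assumes Q: "Q f"
    and nonneg: "\<And>f s. Q f \<Longrightarrow> s \<in> neg_orthant n \<Longrightarrow> 0 \<le> f s"
    and step: "\<And>f i h. Q f \<Longrightarrow> i < n \<Longrightarrow> 0 < h \<Longrightarrow>
      \<exists>g. Q g \<and> (\<forall>s\<in>neg_orthant n. back_diff i h f s = g s)"
  shows "diff_monotone n f"
proof -
  have "0 \<le> back_diffs ps f s" if "ps \<in> lists ({..<n} \<times> {0<..})" "s \<in> neg_orthant n" for ps s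
    using that Q
  proof (induction ps arbitrary: f rule: list.induct)
    case (Cons p ps)
    obtain g where g: "Q g" "\<forall>s\<in>neg_orthant n. back_diff (fst p) (snd p) f s = g s"
      using step[of f "fst p" "snd p"] Cons.prems by auto
    have "back_diffs ps (back_diff (fst p) (snd p) f) s = back_diffs ps g s"
      using Cons.prems g(2) by (intro back_diffs_cong) auto
    then show ?case
      using Cons g(1) by auto
  qed (use nonneg in simp)
  then show ?thesis unfolding diff_monotone_def by blast
qed

lemma back_diff_add: "back_diff i h (\<lambda>s. f s + g s) = (\<lambda>s. back_diff i h f s + back_diff i h g s)"
  by (auto simp: back_diff_def fun_eq_iff)

lemma back_diffs_add: "back_diffs ps (\<lambda>s. f s + g s) s = back_diffs ps f s + back_diffs ps g s"
  by (induction ps arbitrary: f g) (auto simp: back_diff_add)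

lemma diff_monotone_add:
  "diff_monotone n f \<Longrightarrow> diff_monotone n g \<Longrightarrow> diff_monotone n (\<lambda>s. f s + g s)"
  unfolding diff_monotone_def by (simp add: back_diffs_add)

lemma diff_monotone_const: "0 \<le> c \<Longrightarrow> diff_monotone n (\<lambda>_. c)"
  by (rule diff_monotone_coinduct[where Q = "\<lambda>f. \<exists>c\<ge>0. f = (\<lambda>_. c)"])
     (auto simp: back_diff_def intro!: exI[of _ "\<lambda>_. 0"])

lemma diff_monotone_sum:
  "(\<And>i. i \<in> I \<Longrightarrow> diff_monotone n (f i)) \<Longrightarrow> diff_monotone n (\<lambda>s. \<Sum>i\<in>I. f i s)"
  by (induction I rule: infinite_finite_induct)
     (auto intro: diff_monotone_add diff_monotone_const)

lemma back_diff_shift: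
  "back_diff j k (\<lambda>s. f (s(i := s i - h))) = (\<lambda>s. back_diff j k f (s(i := s i - h)))"
proof
  fix s :: "nat \<Rightarrow> real"
  show "back_diff j k (\<lambda>s. f (s(i := s i - h))) s = back_diff j k f (s(i := s i - h))"
    by (cases "i = j") (auto simp: back_diff_def fun_upd_twist algebra_simps)
qed

lemma diff_monotone_shift:
  assumes "diff_monotone n f" "i < n" "0 \<le> h"
  shows "diff_monotone n (\<lambda>s. f (s(i := s i - h)))"
proof (rule diff_monotone_coinduct[where Q = "\<lambda>F. \<exists>f. diff_monotone n f \<and> F = (\<lambda>s. f (s(i := s i - h)))"])
  show "\<exists>f'. diff_monotone n f' \<and> (\<lambda>s. f (s(i := s i - h))) = (\<lambda>s. f' (s(i := s i - h)))"
    using assms by blast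
next
  fix F s assume "\<exists>f. diff_monotone n f \<and> F = (\<lambda>s. f (s(i := s i - h)))" "s \<in> neg_orthant n"
  then show "0 \<le> F s"
    using assms(2,3) diff_monotone_nonneg neg_orthant_down by blast
next
  fix F j k assume "\<exists>f. diff_monotone n f \<and> F = (\<lambda>s. f (s(i := s i - h)))" "j < n" "(0::real) < k"
  then obtain f where "diff_monotone n (back_diff j k f)" "F = (\<lambda>s. f (s(i := s i - h)))"
    using diff_monotone_back_diff by blast
  then show "\<exists>g. (\<exists>f. diff_monotone n f \<and> g = (\<lambda>s. f (s(i := s i - h)))) \<and>
      (\<forall>s\<in>neg_orthant n. back_diff j k F s = g s)"
    using back_diff_shift[of j k f i h] by blast
qed

text \<open>The Leibniz rule \<open>\<Delta>(f g) = \<Delta>f \<cdot> g + f(\<cdot> - h) \<cdot> \<Delta>g\<close> produces only products of functions of the same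
kind.\<close>

lemma diff_monotone_mult:
  assumes "diff_monotone n f" "diff_monotone n g"
  shows "diff_monotone n (\<lambda>s. f s * g s)"
proof -
  have "0 \<le> back_diffs ps (\<lambda>s. f s * g s) s"
    if "ps \<in> lists ({..<n} \<times> {0<..})" "s \<in> neg_orthant n" for ps s
    using that assms
  proof (induction ps arbitrary: f g rule: list.induct)
    case Nil
    then show ?case by (simp add: diff_monotone_nonneg)
  next
    case (Cons p ps)
    obtain i h where p: "p = (i, h)" by (cases p)
    have ih: "i < n" "0 < h" using Cons.prems p by auto
    have "back_diff i h (\<lambda>s. f s * g s) =
        (\<lambda>s. back_diff i h f s * g s + f (s(i := s i - h)) * back_diff i h g s)"
      by (auto simp: back_diff_def algebra_simps)
    moreover have "0 \<le> back_diffs ps (\<lambda>s. back_diff i h f s * g s) s"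
      using Cons ih by (intro Cons.IH diff_monotone_back_diff) auto
    moreover have "0 \<le> back_diffs ps (\<lambda>s. f (s(i := s i - h)) * back_diff i h g s) s"
      using Cons.prems ih
      by (intro Cons.IH diff_monotone_back_diff[of n g] diff_monotone_shift[of n f]) auto
    ultimately show ?case
      by (simp add: back_diffs_add p)
  qed
  then show ?thesis unfolding diff_monotone_def by blast
qed

lemma diff_monotone_power: "diff_monotone n f \<Longrightarrow> diff_monotone n (\<lambda>s. f s ^ k)"
  by (induction k) (auto intro: diff_monotone_mult diff_monotone_const)

lemma diff_monotone_LIMSEQ:
  assumes "\<And>k. diff_monotone n (F k)"
    and "\<And>s. s \<in> neg_orthant n \<Longrightarrow> (\<lambda>k. F k s) \<longlonglongrightarrow> f s"
  shows "diff_monotone n f"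
proof -
  have lim: "(\<lambda>k. back_diffs ps (F k) s) \<longlonglongrightarrow> back_diffs ps f s"
    if "ps \<in> lists ({..<n} \<times> {0<..})" "s \<in> neg_orthant n" for ps s
    using that assms(2)
  proof (induction ps arbitrary: f F rule: list.induct)
    case (Cons p ps)
    have "(\<lambda>k. back_diff (fst p) (snd p) (F k) s) \<longlonglongrightarrow> back_diff (fst p) (snd p) f s"
      if "s \<in> neg_orthant n" for s
      unfolding back_diff_def
      by (intro tendsto_diff Cons.prems(3) neg_orthant_down that) (use Cons.prems(1) in auto)
    with Cons show ?case by simp
  qed simp
  show ?thesis unfolding diff_monotone_def
  proof (intro ballI)
    fix ps :: "(nat \<times> real) list" and s
    assume *: "ps \<in> lists ({..<n} \<times> {0<..})" "s \<in> neg_orthant n"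
    show "0 \<le> back_diffs ps f s"
      by (rule LIMSEQ_le_const[OF lim[OF *]])
         (use assms(1) * in \<open>auto simp: diff_monotone_def\<close>)
  qed
qed

lemma diff_monotone_integral:
  assumes "\<And>\<omega>. \<omega> \<in> space M \<Longrightarrow> diff_monotone n (\<lambda>s. F s \<omega>)"
    and "\<And>s. s \<in> neg_orthant n \<Longrightarrow> integrable M (F s)"
  shows "diff_monotone n (\<lambda>s. \<integral>\<omega>. F s \<omega> \<partial>M)"
proof (rule diff_monotone_coinduct[where Q = "\<lambda>G. \<exists>F. (\<forall>\<omega>\<in>space M. diff_monotone n (\<lambda>s. F s \<omega>)) \<and>
      (\<forall>s\<in>neg_orthant n. integrable M (F s)) \<and> G = (\<lambda>s. \<integral>\<omega>. F s \<omega> \<partial>M)"])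
  show "\<exists>F'. (\<forall>\<omega>\<in>space M. diff_monotone n (\<lambda>s. F' s \<omega>)) \<and>
      (\<forall>s\<in>neg_orthant n. integrable M (F' s)) \<and> (\<lambda>s. \<integral>\<omega>. F s \<omega> \<partial>M) = (\<lambda>s. \<integral>\<omega>. F' s \<omega> \<partial>M)"
    using assms by blast
next
  fix G s assume "\<exists>F. (\<forall>\<omega>\<in>space M. diff_monotone n (\<lambda>s. F s \<omega>)) \<and>
      (\<forall>s\<in>neg_orthant n. integrable M (F s)) \<and> G = (\<lambda>s. \<integral>\<omega>. F s \<omega> \<partial>M)" "s \<in> neg_orthant n"
  then show "0 \<le> G s"
    by (auto intro!: integral_nonneg_AE AE_I2 dest: diff_monotone_nonneg)
next
  fix G i h assume "\<exists>F. (\<forall>\<omega>\<in>space M. diff_monotone n (\<lambda>s. F s \<omega>)) \<and>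
      (\<forall>s\<in>neg_orthant n. integrable M (F s)) \<and> G = (\<lambda>s. \<integral>\<omega>. F s \<omega> \<partial>M)" and ih: "i < n" "(0::real) < h"
  then obtain F where F: "\<And>\<omega>. \<omega> \<in> space M \<Longrightarrow> diff_monotone n (\<lambda>s. F s \<omega>)"
      "\<And>s. s \<in> neg_orthant n \<Longrightarrow> integrable M (F s)" "G = (\<lambda>s. \<integral>\<omega>. F s \<omega> \<partial>M)"
    by blast
  have "diff_monotone n (\<lambda>s. F s \<omega> - F (s(i := s i - h)) \<omega>)" if "\<omega> \<in> space M" for \<omega>
    using diff_monotone_back_diff[OF F(1)[OF that] ih] by (simp add: back_diff_def[abs_def])
  moreover have "integrable M (\<lambda>\<omega>. F s \<omega> - F (s(i := s i - h)) \<omega>)" if "s \<in> neg_orthant n" for s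
    using that ih by (intro Bochner_Integration.integrable_diff F(2)) (auto intro!: neg_orthant_down)
  moreover have "back_diff i h G s = (\<integral>\<omega>. F s \<omega> - F (s(i := s i - h)) \<omega> \<partial>M)" if "s \<in> neg_orthant n" for s
    unfolding back_diff_def F(3)
    using that ih by (subst Bochner_Integration.integral_diff) (auto intro!: F(2) neg_orthant_down)
  ultimately show "\<exists>g. (\<exists>F. (\<forall>\<omega>\<in>space M. diff_monotone n (\<lambda>s. F s \<omega>)) \<and>
      (\<forall>s\<in>neg_orthant n. integrable M (F s)) \<and> g = (\<lambda>s. \<integral>\<omega>. F s \<omega> \<partial>M)) \<and>
      (\<forall>s\<in>neg_orthant n. back_diff i h G s = g s)"
    by (intro exI[of _ "\<lambda>s. \<integral>\<omega>. F s \<omega> - F (s(i := s i - h)) \<omega> \<partial>M"] conjI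
        exI[of _ "\<lambda>s \<omega>. F s \<omega> - F (s(i := s i - h)) \<omega>"]) auto
qed

text \<open>The exponential series without its constant term has nonnegative coefficients.\<close>

lemma diff_monotone_exp_minus_one:
  assumes "diff_monotone n g"
  shows "diff_monotone n (\<lambda>s. exp (g s) - 1)"
proof (rule diff_monotone_LIMSEQ)
  fix K :: nat
  show "diff_monotone n (\<lambda>s. \<Sum>k<K. (1 / fact (Suc k)) * g s ^ Suc k)"
    by (intro diff_monotone_sum diff_monotone_mult diff_monotone_const diff_monotone_power assms) auto
next
  fix s
  have "(\<lambda>k. g s ^ k /\<^sub>R fact k) sums exp (g s)" by (rule exp_converges)
  then have "(\<lambda>k. g s ^ Suc k /\<^sub>R fact (Suc k)) sums (exp (g s) - 1)"
    by (subst sums_Suc_iff) simp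
  then show "(\<lambda>K. \<Sum>k<K. (1 / fact (Suc k)) * g s ^ Suc k) \<longlonglongrightarrow> exp (g s) - 1"
    unfolding sums_def by (simp add: divide_inverse mult.commute)
qed

text \<open>One difference of \<open>e\<^bsup>\<psi>\<^esup> g\<close> equals \<open>e\<^bsup>\<psi>(\<cdot> - h)\<^esup> ((e\<^bsup>\<Delta>\<psi>\<^esup> - 1) g + \<Delta>g)\<close>, which has the same form with a shifted
\<open>\<psi>\<close> and another difference monotone factor. Carrying the factor \<open>g\<close> along is what makes the induction
on the order work.\<close>

lemma diff_monotone_exp_mult:
  assumes "diff_bernstein n \<psi>" "diff_monotone n g"
  shows "diff_monotone n (\<lambda>s. exp (\<psi> s) * g s)"
proof -
  have "0 \<le> back_diffs ps (\<lambda>s. exp (\<psi> s) * g s) s"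
    if "ps \<in> lists ({..<n} \<times> {0<..})" "s \<in> neg_orthant n" for ps s
    using that assms
  proof (induction ps arbitrary: \<psi> g rule: list.induct)
    case Nil
    then show ?case by (simp add: diff_monotone_nonneg)
  next
    case (Cons p ps)
    obtain i h where p: "p = (i, h)" by (cases p)
    have ih: "i < n" "0 < h" using Cons.prems p by auto
    let ?\<psi> = "\<lambda>s. \<psi> (s(i := s i - h))"
    let ?g = "\<lambda>s. (exp (back_diff i h \<psi> s) - 1) * g s + back_diff i h g s"
    have "back_diff i h (\<lambda>s. exp (\<psi> s) * g s) = (\<lambda>s. exp (?\<psi> s) * ?g s)"
      by (auto simp: back_diff_def algebra_simps simp flip: exp_add)
    moreover have "diff_bernstein n ?\<psi>"
      using Cons.prems(3) ih unfolding diff_bernstein_def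
      by (simp add: back_diff_shift diff_monotone_shift)
    moreover have "diff_monotone n ?g"
      using Cons.prems(3,4) ih unfolding diff_bernstein_def
      by (intro diff_monotone_add diff_monotone_mult diff_monotone_exp_minus_one)
        (blast intro: diff_monotone_back_diff)+
    ultimately show ?case
      using Cons p by auto
  qed
  then show ?thesis unfolding diff_monotone_def by blast
qed

lemma dot_upd:
  assumes "i < n" shows "dot n (s(i := t)) u = dot n s u + (t - s i) * u i"
proof -
  have "dot n (s(i := t)) u = (\<Sum>k<n. s k * u k + (if k = i then (t - s i) * u i else 0))"
    unfolding dot_def by (rule sum.cong) (auto simp: algebra_simps)
  also have "\<dots> = dot n s u + (t - s i) * u i"
    using assms by (simp add: sum.distrib dot_def)
  finally show ?thesis .
qed

lemma back_diff_exp_dot: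
  "i < n \<Longrightarrow> back_diff i h (\<lambda>s. c * exp (dot n s u)) = (\<lambda>s. c * (1 - exp (- (h * u i))) * exp (dot n s u))"
  by (auto simp: back_diff_def dot_upd algebra_simps simp flip: exp_add)

lemma diff_monotone_exp_dot:
  assumes u: "\<And>i. i < n \<Longrightarrow> 0 \<le> u i"
  shows "diff_monotone n (\<lambda>s. exp (dot n s u))"
proof (rule diff_monotone_coinduct[where Q = "\<lambda>F. \<exists>c\<ge>0. F = (\<lambda>s. c * exp (dot n s u))"])
  show "\<exists>c\<ge>0. (\<lambda>s. exp (dot n s u)) = (\<lambda>s. c * exp (dot n s u))"
    by (rule exI[of _ 1]) simp
next
  fix F i h assume "\<exists>c\<ge>0. F = (\<lambda>s. c * exp (dot n s u))" and i: "i < n" and h: "(0::real) < h"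
  then obtain c where c: "c \<ge> 0" "F = (\<lambda>s. c * exp (dot n s u))" by blast
  have "0 \<le> c * (1 - exp (- (h * u i)))"
    using c(1) u[OF i] h by simp
  with c i show "\<exists>g. (\<exists>c\<ge>0. g = (\<lambda>s. c * exp (dot n s u))) \<and> (\<forall>s\<in>neg_orthant n. back_diff i h F s = g s)"
    by (metis back_diff_exp_dot)
qed auto

text \<open>Only first differences matter for monotonicity, so it holds for the larger class.\<close>

lemma diff_monotone_mono:
  assumes f: "diff_bernstein n f" and s: "s \<in> neg_orthant n" and s': "s' \<in> neg_orthant n"
    and le: "\<And>i. i < n \<Longrightarrow> s i \<le> s' i"
  shows "f s \<le> f s'"
  using s' s
proof (rule neg_orthant_path_induct[where P = "\<lambda>z. f s \<le> f z"])
  fix z i assume z: "z \<in> neg_orthant n" "f s \<le> f z" "i < n" "z i = s i"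
  show "f s \<le> f (z(i := s' i))"
  proof (cases "s i = s' i")
    case True
    then show ?thesis using z by (metis fun_upd_triv)
  next
    case False
    then have "0 < s' i - s i" using le[OF z(3)] by simp
    then have "0 \<le> back_diff i (s' i - s i) f (z(i := s' i))"
      using f z s' unfolding diff_bernstein_def
      by (metis diff_monotone_nonneg neg_orthant_upd neg_orthant_less)
    moreover have "z(i := s i) = z" using z(4) by auto
    ultimately show ?thesis using z(2) by (simp add: back_diff_def)
  qed
qed simp

lemma diff_monotone_imp_bernstein: "diff_monotone n f \<Longrightarrow> diff_bernstein n f"
  unfolding diff_bernstein_def by (simp add: diff_monotone_back_diff)

lemma partial_derivs_append: "partial_derivs (xs @ ys) f = partial_derivs xs (partial_derivs ys f)"
  by (induction xs) auto

lemma continuous_on_coordinate: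
  fixes S :: "(nat \<Rightarrow> real) set"
  shows "continuous_on S (\<lambda>x. x i)"
  by (rule continuous_on_subset[OF continuous_on_product_coordinates]) simp

text \<open>Differences commute with derivatives, and by the mean value theorem the difference of a derivative
is nonnegative as soon as derivatives of order at least one are. Negative Bernstein functions need
exactly this version, in which \<open>f\<close> may be negative.\<close>

lemma absolutely_monotone_back_diff_of_smooth:
  assumes f: "smooth_on_neg_orthant n f"
    and nonneg: "\<And>i js s. i < n \<Longrightarrow> js \<in> lists {..<n} \<Longrightarrow> s \<in> neg_orthant n \<Longrightarrow> 0 \<le> partial_derivs (i # js) f s"
    and i: "i < n" and h: "0 < h"
  shows "absolutely_monotone n (back_diff i h f)"
proof -
  let ?sh = "\<lambda>s::nat\<Rightarrow>real. s(i := s i - h)"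
  have sm: "(\<lambda>t. partial_derivs js f (s(j := t))) differentiable (at (s j))"
    if "js \<in> lists {..<n}" "s \<in> neg_orthant n" "j < n" for js s j
    using f that unfolding smooth_on_neg_orthant_def by blast
  have sh: "?sh s \<in> neg_orthant n" if "s \<in> neg_orthant n" for s
    using that i h by (intro neg_orthant_down) auto
  have upd: "?sh (s(j := t)) = (if j = i then (?sh s)(j := t - h) else (?sh s)(j := t))" for s j t
    by (auto simp: fun_eq_iff)
  have D1: "((\<lambda>t. partial_derivs js f (s(j := t))) has_field_derivative partial_derivs (j # js) f s) (at (s j))"
    if "js \<in> lists {..<n}" "s \<in> neg_orthant n" "j < n" for js s j
    using sm[OF that] by (simp add: DERIV_deriv_iff_real_differentiable partial_deriv_def)
  have D2: "((\<lambda>t. partial_derivs js f (?sh (s(j := t)))) has_field_derivative partial_derivs (j # js) f (?sh s)) (at (s j))"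
    if *: "js \<in> lists {..<n}" "s \<in> neg_orthant n" "j < n" for js s j
  proof (cases "j = i")
    case True
    have "((\<lambda>t. partial_derivs js f ((?sh s)(i := t))) has_field_derivative partial_derivs (i # js) f (?sh s)) (at (?sh s i))"
      using D1[OF *(1) sh[OF *(2)] i] .
    then have "((\<lambda>t. partial_derivs js f ((?sh s)(i := t))) has_field_derivative partial_derivs (i # js) f (?sh s)) (at (s i + - h))"
      by simp
    then have "((\<lambda>t. partial_derivs js f ((?sh s)(i := t + (- h)))) has_field_derivative partial_derivs (i # js) f (?sh s)) (at (s i))"
      by (rule iffD1[OF DERIV_shift])
    then show ?thesis using True by (simp add: upd)
  next
    case False
    then have "?sh s j = s j" by simp
    with False show ?thesis using D1[OF *(1) sh[OF *(2)] *(3)] by (simp only: upd if_False)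
  qed
  have D: "((\<lambda>t. partial_derivs js (back_diff i h f) (s(j := t))) has_field_derivative
        partial_derivs (j # js) f s - partial_derivs (j # js) f (?sh s)) (at (s j))"
    if eq: "\<And>s. s \<in> neg_orthant n \<Longrightarrow>
        partial_derivs js (back_diff i h f) s = partial_derivs js f s - partial_derivs js f (?sh s)"
      and *: "js \<in> lists {..<n}" "s \<in> neg_orthant n" "j < n" for js s j
  proof -
    have "eventually (\<lambda>t. t \<in> {..<0}) (nhds (s j))"
      using * by (intro eventually_nhds_in_open) (auto dest: neg_orthant_less)
    then have "eventually (\<lambda>t. partial_derivs js (back_diff i h f) (s(j := t)) =
       partial_derivs js f (s(j := t)) - partial_derivs js f (?sh (s(j := t)))) (nhds (s j))"
    proof eventually_elim
      case (elim t)
      show ?case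
        using * elim by (intro eq neg_orthant_upd) auto
    qed
    moreover have "((\<lambda>t. partial_derivs js f (s(j := t)) - partial_derivs js f (?sh (s(j := t)))) has_field_derivative
        partial_derivs (j # js) f s - partial_derivs (j # js) f (?sh s)) (at (s j))"
      by (intro DERIV_diff D1 D2 *)
    ultimately show ?thesis by (simp add: DERIV_cong_ev)
  qed
  have eq: "partial_derivs js (back_diff i h f) s = partial_derivs js f s - partial_derivs js f (?sh s)"
    if "js \<in> lists {..<n}" "s \<in> neg_orthant n" for js s
    using that
  proof (induction js arbitrary: s rule: list.induct)
    case (Cons j js)
    then have j: "j < n" "js \<in> lists {..<n}" by auto
    have "((\<lambda>t. partial_derivs js (back_diff i h f) (s(j := t))) has_field_derivative
        partial_derivs (j # js) f s - partial_derivs (j # js) f (?sh s)) (at (s j))"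
      by (rule D) (use Cons j in blast)+
    then show ?case
      by (simp only: partial_derivs.simps(2)[of j js "back_diff i h f"] partial_deriv_def[of j "partial_derivs js (back_diff i h f)"] DERIV_imp_deriv)
  qed (simp add: back_diff_def)
  have cont_sh: "continuous_on (neg_orthant n) ?sh"
  proof (rule continuous_on_coordinatewise_then_product)
    fix j show "continuous_on (neg_orthant n) (\<lambda>s. ?sh s j)"
      by (cases "j = i") (auto intro!: continuous_intros continuous_on_coordinate)
  qed
  show ?thesis
    unfolding absolutely_monotone_def smooth_on_neg_orthant_def
  proof (intro conjI ballI allI impI)
    fix js assume js: "js \<in> lists {..<n}"
    have c: "continuous_on (neg_orthant n) (partial_derivs js f)"
      using f js unfolding smooth_on_neg_orthant_def by blast
    have "continuous_on (neg_orthant n) (\<lambda>s. partial_derivs js f s - partial_derivs js f (?sh s))"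
      by (intro continuous_on_diff c continuous_on_compose2[OF c cont_sh]) (use sh in auto)
    then show "continuous_on (neg_orthant n) (partial_derivs js (back_diff i h f))"
      using eq[OF js] by (simp cong: continuous_on_cong)
  next
    fix js s j assume *: "js \<in> lists {..<n}" "s \<in> neg_orthant n" "j < n"
    have "((\<lambda>t. partial_derivs js (back_diff i h f) (s(j := t))) has_field_derivative
        partial_derivs (j # js) f s - partial_derivs (j # js) f (?sh s)) (at (s j))"
      by (rule D[OF eq]) (use * in blast)+
    then show "(\<lambda>t. partial_derivs js (back_diff i h f) (s(j := t))) differentiable at (s j)"
      using real_differentiable_def by blast
  next
    fix js s assume *: "js \<in> lists {..<n}" "s \<in> neg_orthant n"
    have "partial_derivs js f (s(i := s i - h)) \<le> partial_derivs js f (s(i := s i))"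
    proof (rule DERIV_nonneg_imp_nondecreasing[where f = "\<lambda>t. partial_derivs js f (s(i := t))"])
      fix x assume x: "s i - h \<le> x" "x \<le> s i"
      let ?z = "s(i := x)"
      have z: "?z \<in> neg_orthant n"
        using x neg_orthant_less[OF *(2) i] by (intro neg_orthant_upd * i) auto
      have "((\<lambda>t. partial_derivs js f (?z(i := t))) has_field_derivative partial_derivs (i # js) f ?z) (at (?z i))"
        by (rule D1[OF *(1) z i])
      moreover have "0 \<le> partial_derivs (i # js) f ?z"
        by (rule nonneg[OF i *(1) z])
      ultimately show "\<exists>y. ((\<lambda>t. partial_derivs js f (s(i := t))) has_real_derivative y) (at x) \<and> 0 \<le> y"
        by auto
    qed (use h in simp)
    then show "0 \<le> partial_derivs js (back_diff i h f) s"
      using eq[OF *] by simp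
  qed
qed

lemma absolutely_monotone_back_diff:
  assumes f: "absolutely_monotone n f" and i: "i < n" and h: "0 < h"
  shows "absolutely_monotone n (back_diff i h f)"
proof (rule absolutely_monotone_back_diff_of_smooth[OF _ _ i h])
  show "smooth_on_neg_orthant n f" using f by (simp add: absolutely_monotone_def)
  fix i js s assume "i < n" "js \<in> lists {..<n}" "s \<in> neg_orthant n"
  moreover from this have "i # js \<in> lists {..<n}" by simp
  ultimately show "0 \<le> partial_derivs (i # js) f s"
    using f unfolding absolutely_monotone_def by blast
qed

lemma absolutely_monotone_imp_diff_monotone:
  assumes "absolutely_monotone n f"
  shows "diff_monotone n f"
proof (rule diff_monotone_coinduct[where Q = "absolutely_monotone n"])
  fix f s assume "absolutely_monotone n f" "s \<in> neg_orthant n"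
  then show "0 \<le> f s"
    unfolding absolutely_monotone_def by (metis lists.Nil partial_derivs.simps(1))
next
  show "\<exists>g. absolutely_monotone n g \<and> (\<forall>s\<in>neg_orthant n. back_diff i h f s = g s)"
    if "absolutely_monotone n f" "i < n" "0 < h" for f i and h :: real
    using absolutely_monotone_back_diff[OF that] by blast
qed (rule assms)

section \<open>Differentiation under the integral sign\<close>

text \<open>This bounds a first moment by a difference of exponentials. It turns integrability of finite
differences into integrability of derivatives.\<close>

lemma mult_exp_neg_le:
  fixes x a :: real assumes "0 \<le> x" "0 < a"
  shows "x * exp (- (a * x)) \<le> (1 + 1 / a) * (1 - exp (- x))"
proof -
  have e: "x \<le> (1 + x) * (1 - exp (- x))"
  proof -
    have "(1 + x) * exp (- x) \<le> exp x * exp (- x)"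
      by (intro mult_right_mono) auto
    then show ?thesis by (simp add: algebra_simps flip: exp_add)
  qed
  have a: "(1 + x) * exp (- (a * x)) \<le> 1 + 1 / a"
  proof -
    have "a * (x * exp (- (a * x))) \<le> exp (a * x) * exp (- (a * x))"
    proof -
      have "a * x \<le> exp (a * x)" using exp_ge_add_one_self[of "a * x"] by linarith
      then have "a * x * exp (- (a * x)) \<le> exp (a * x) * exp (- (a * x))"
        by (rule mult_right_mono) simp
      then show ?thesis by (simp only: mult.assoc)
    qed
    then have "x * exp (- (a * x)) \<le> 1 / a"
      using assms by (simp add: field_simps flip: exp_add)
    moreover have "exp (- (a * x)) \<le> 1" using assms by simp
    ultimately have "exp (- (a * x)) + x * exp (- (a * x)) \<le> 1 + 1 / a" by linarith
    then show ?thesis by (simp add: algebra_simps)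
  qed
  have "x * exp (- (a * x)) \<le> ((1 + x) * (1 - exp (- x))) * exp (- (a * x))"
    by (intro mult_right_mono e) auto
  also have "\<dots> = ((1 + x) * exp (- (a * x))) * (1 - exp (- x))" by simp
  also have "\<dots> \<le> (1 + 1 / a) * (1 - exp (- x))"
    using assms by (intro mult_right_mono a) auto
  finally show ?thesis .
qed

lemma dot_mono:
  "(\<And>i. i < n \<Longrightarrow> a i \<le> b i) \<Longrightarrow> (\<And>i. i < n \<Longrightarrow> 0 \<le> u i) \<Longrightarrow> dot n a u \<le> dot n b u"
  unfolding dot_def by (intro sum_mono mult_right_mono) auto

lemma borel_measurable_dot [measurable]:
  "(\<And>i. i < n \<Longrightarrow> (\<lambda>u. u i) \<in> borel_measurable M) \<Longrightarrow> (\<lambda>u. dot n s u) \<in> borel_measurable M"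
  unfolding dot_def by (intro borel_measurable_sum borel_measurable_times) auto

text \<open>With \<open>r = 0\<close> the integral is a Laplace transform. With \<open>q = r = 1\<close> it is the integral of \<open>e\<^bsup>s\<cdot>u\<^esup> - 1\<close>,
for a measure that may be infinite near the origin. Powers of the coordinates in \<open>q\<close> make the
locale stable under differentiation.\<close>

locale laplace_integrand =
  fixes n :: nat and M :: "(nat \<Rightarrow> real) measure" and q r :: "(nat \<Rightarrow> real) \<Rightarrow> real"
  assumes coord_measurable: "i < n \<Longrightarrow> (\<lambda>u. u i) \<in> borel_measurable M"
    and coord_nonneg: "u \<in> space M \<Longrightarrow> i < n \<Longrightarrow> 0 \<le> u i"
    and weight_measurable [measurable]: "q \<in> borel_measurable M" "r \<in> borel_measurable M"
    and weight_nonneg: "u \<in> space M \<Longrightarrow> 0 \<le> q u"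
    and integrable: "s \<in> neg_orthant n \<Longrightarrow> integrable M (\<lambda>u. q u * exp (dot n s u) - r u)"
begin

definition G :: "(nat \<Rightarrow> real) \<Rightarrow> real" where
  "G s = (\<integral>u. (q u * exp (dot n s u) - r u) \<partial>M)"

lemma dot_measurable [measurable]: "(\<lambda>u. dot n s u) \<in> borel_measurable M"
  by (rule borel_measurable_dot) (rule coord_measurable)

text \<open>Half of the decay in the \<open>i\<close>-th variable is spent on absorbing the factor \<open>u i\<close>. Only the integrability
of a difference is used, so that \<open>r\<close> cancels.\<close>

lemma integrable_moment:
  assumes s: "s \<in> neg_orthant n" and i: "i < n"
  shows "integrable M (\<lambda>u. q u * u i * exp (dot n s u))"
proof -
  note [measurable] = coord_measurable[OF i]
  define a where "a = - s i / 2"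
  have a: "0 < a" using neg_orthant_less[OF s i] by (simp add: a_def)
  let ?s = "s(i := - a)"
  have s': "?s \<in> neg_orthant n" "?s(i := - a - 1) \<in> neg_orthant n"
    using a by (intro neg_orthant_upd s i; simp)+
  have "integrable M (\<lambda>u. (1 + 1 / a) * ((q u * exp (dot n ?s u) - r u) - (q u * exp (dot n (?s(i := - a - 1)) u) - r u)))"
    by (intro Bochner_Integration.integrable_mult_right Bochner_Integration.integrable_diff integrable s')
  then show ?thesis
  proof (rule Bochner_Integration.integrable_bound)
    show "AE u in M. norm (q u * u i * exp (dot n s u)) \<le> norm ((1 + 1 / a) * ((q u * exp (dot n ?s u) - r u) - (q u * exp (dot n (?s(i := - a - 1)) u) - r u)))"
    proof (rule AE_I2)
      fix u assume u: "u \<in> space M"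
      have q: "0 \<le> q u" and ui: "0 \<le> u i" using weight_nonneg[OF u] coord_nonneg[OF u i] by auto
      have s_a: "s i = - 2 * a" by (simp add: a_def)
      have 1: "exp (dot n s u) = exp (dot n ?s u) * exp (- (a * u i))"
        using i by (simp add: dot_upd s_a algebra_simps flip: exp_add)
      have 2: "exp (dot n (?s(i := - a - 1)) u) = exp (dot n ?s u) * exp (- u i)"
        using i by (simp add: dot_upd s_a algebra_simps flip: exp_add)
      have "q u * u i * exp (dot n s u) = q u * exp (dot n ?s u) * (u i * exp (- (a * u i)))"
        unfolding 1 by simp
      also have "\<dots> \<le> q u * exp (dot n ?s u) * ((1 + 1 / a) * (1 - exp (- u i)))"
        using q by (intro mult_left_mono mult_exp_neg_le ui a) auto
      also have "\<dots> = (1 + 1 / a) * ((q u * exp (dot n ?s u) - r u) - (q u * exp (dot n (?s(i := - a - 1)) u) - r u))"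
        unfolding 2 by (simp only: algebra_simps)
      finally show "norm (q u * u i * exp (dot n s u)) \<le> norm ((1 + 1 / a) * ((q u * exp (dot n ?s u) - r u) - (q u * exp (dot n (?s(i := - a - 1)) u) - r u)))"
        using q ui by simp
    qed
  qed measurable
qed

lemma continuous_on_G: "continuous_on (neg_orthant n) G"
  unfolding continuous_on_sequentially
proof (intro allI ballI impI, unfold comp_def)
  fix x a assume a: "a \<in> neg_orthant n" and "(\<forall>k. x k \<in> neg_orthant n) \<and> x \<longlonglongrightarrow> a"
  then have x: "\<And>k. x k \<in> neg_orthant n" "x \<longlonglongrightarrow> a" by auto
  have coord: "(\<lambda>k. x k i) \<longlonglongrightarrow> a i" for i
    using continuous_on_tendsto_compose[OF continuous_on_coordinate[of UNIV i] x(2)] by simp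
  define l where "l = (\<lambda>i\<in>{..<n}. 2 * a i)"
  define h where "h = (\<lambda>i\<in>{..<n}. a i / 2)"
  have lh: "l \<in> neg_orthant n" "h \<in> neg_orthant n"
    using a unfolding neg_orthant_def l_def h_def by (auto simp: PiE_iff)
  have ev: "\<forall>\<^sub>F k in sequentially. \<forall>i\<in>{..<n}. l i \<le> x k i \<and> x k i \<le> h i"
  proof (rule eventually_ball_finite)
    show "\<forall>i\<in>{..<n}. \<forall>\<^sub>F k in sequentially. l i \<le> x k i \<and> x k i \<le> h i"
    proof
      fix i assume "i \<in> {..<n}"
      then have "l i < a i" "a i < h i" using neg_orthant_less[OF a, of i] by (auto simp: l_def h_def)
      then show "\<forall>\<^sub>F k in sequentially. l i \<le> x k i \<and> x k i \<le> h i"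
        using order_tendstoD[OF coord[of i]] by (fastforce elim: eventually_elim2)
    qed
  qed simp
  then obtain k0 where k0: "\<And>k i. k \<ge> k0 \<Longrightarrow> i < n \<Longrightarrow> l i \<le> x k i \<and> x k i \<le> h i"
    unfolding eventually_sequentially by auto
  have "(\<lambda>k. G (x (k + k0))) \<longlonglongrightarrow> G a"
    unfolding G_def
  proof (rule integral_dominated_convergence[where w = "\<lambda>u. \<bar>q u * exp (dot n l u) - r u\<bar> + \<bar>q u * exp (dot n h u) - r u\<bar>"])
    show "integrable M (\<lambda>u. \<bar>q u * exp (dot n l u) - r u\<bar> + \<bar>q u * exp (dot n h u) - r u\<bar>)"
      by (intro Bochner_Integration.integrable_add integrable_abs integrable lh)
    show "AE u in M. (\<lambda>k. q u * exp (dot n (x (k + k0)) u) - r u) \<longlonglongrightarrow> q u * exp (dot n a u) - r u"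
      unfolding dot_def
      by (intro AE_I2 tendsto_intros LIMSEQ_ignore_initial_segment coord)
    show "AE u in M. norm (q u * exp (dot n (x (k + k0)) u) - r u)
        \<le> \<bar>q u * exp (dot n l u) - r u\<bar> + \<bar>q u * exp (dot n h u) - r u\<bar>" for k
    proof (rule AE_I2)
      fix u assume u: "u \<in> space M"
      have "dot n l u \<le> dot n (x (k + k0)) u" "dot n (x (k + k0)) u \<le> dot n h u"
        using k0[of "k + k0"] coord_nonneg[OF u] by (intro dot_mono; simp)+
      then have "q u * exp (dot n l u) \<le> q u * exp (dot n (x (k + k0)) u)"
        "q u * exp (dot n (x (k + k0)) u) \<le> q u * exp (dot n h u)"
        using weight_nonneg[OF u] by (auto intro: mult_left_mono)
      then show "norm (q u * exp (dot n (x (k + k0)) u) - r u)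
        \<le> \<bar>q u * exp (dot n l u) - r u\<bar> + \<bar>q u * exp (dot n h u) - r u\<bar>"
        by auto
    qed
  qed measurable
  then show "(\<lambda>k. G (x k)) \<longlonglongrightarrow> G a"
    by (rule LIMSEQ_offset)
qed

lemma abs_exp_diff_le:
  fixes d u :: real assumes "0 \<le> u"
  shows "\<bar>exp (d * u) - 1\<bar> \<le> \<bar>d\<bar> * u * exp (\<bar>d\<bar> * u)"
proof -
  have *: "exp x - 1 \<le> x * exp x" for x :: real
  proof -
    have "(1 - x) * exp x \<le> exp (- x) * exp x"
      using exp_ge_add_one_self[of "- x"] by (intro mult_right_mono) auto
    then show ?thesis by (simp add: algebra_simps flip: exp_add)
  qed
  show ?thesis
  proof (cases "0 \<le> d")
    case True
    then show ?thesis using *[of "d * u"] assms by simp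
  next
    case False
    have "1 - exp (d * u) \<le> \<bar>d\<bar> * u * 1"
    proof -
      have "\<bar>d\<bar> * u = - (d * u)" using False by simp
      then show ?thesis using exp_ge_add_one_self[of "d * u"] by linarith
    qed
    also have "\<dots> \<le> \<bar>d\<bar> * u * exp (\<bar>d\<bar> * u)"
      using assms by (intro mult_left_mono) auto
    finally show ?thesis using False assms by (simp add: mult_nonpos_nonneg)
  qed
qed

lemma G_has_derivative:
  assumes s: "s \<in> neg_orthant n" and i: "i < n"
  shows "((\<lambda>t. G (s(i := t))) has_field_derivative (\<integral>u. q u * u i * exp (dot n s u) \<partial>M)) (at (s i))"
  unfolding has_field_derivative_iff tendsto_at_iff_sequentially
proof (intro allI impI, unfold comp_def)
  note [measurable] = coord_measurable[OF i]
  fix X assume "\<forall>k. X k \<in> UNIV - {s i}" and X: "X \<longlonglongrightarrow> s i"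
  then have Xne: "X k \<noteq> s i" for k by auto
  define a where "a = - s i / 2"
  have a: "0 < a" using neg_orthant_less[OF s i] by (simp add: a_def)
  have s_a: "s i = - 2 * a" by (simp add: a_def)
  let ?s = "s(i := - a)"
  have s': "?s \<in> neg_orthant n" using a by (intro neg_orthant_upd s i) simp
  have "\<forall>\<^sub>F k in sequentially. dist (X k) (s i) < a"
    by (rule tendstoD[OF X a])
  then obtain k0 where k0: "\<And>k. k \<ge> k0 \<Longrightarrow> \<bar>X k - s i\<bar> < a"
    unfolding eventually_sequentially dist_real_def by auto
  have "(\<lambda>k. (\<integral>u. q u * exp (dot n s u) * ((exp ((X (k + k0) - s i) * u i) - 1) / (X (k + k0) - s i)) \<partial>M))
     \<longlonglongrightarrow> (\<integral>u. q u * u i * exp (dot n s u) \<partial>M)"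
  proof (rule integral_dominated_convergence[where w = "\<lambda>u. q u * u i * exp (dot n ?s u)"])
    show "integrable M (\<lambda>u. q u * u i * exp (dot n ?s u))"
      by (rule integrable_moment[OF s' i])
    show "AE u in M. (\<lambda>k. q u * exp (dot n s u) * ((exp ((X (k + k0) - s i) * u i) - 1) / (X (k + k0) - s i)))
       \<longlonglongrightarrow> q u * u i * exp (dot n s u)"
    proof (rule AE_I2)
      fix u
      have "((\<lambda>t. exp ((t - s i) * u i)) has_field_derivative u i) (at (s i))"
        by (auto intro!: derivative_eq_intros)
      then have "(\<lambda>k. (exp ((X (k + k0) - s i) * u i) - 1) / (X (k + k0) - s i)) \<longlonglongrightarrow> u i"
        unfolding has_field_derivative_iff tendsto_at_iff_sequentially comp_def
        using LIMSEQ_ignore_initial_segment[OF X, of k0] Xne by simp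
      then have "(\<lambda>k. q u * exp (dot n s u) * ((exp ((X (k + k0) - s i) * u i) - 1) / (X (k + k0) - s i)))
         \<longlonglongrightarrow> q u * exp (dot n s u) * u i"
        by (intro tendsto_intros)
      then show "(\<lambda>k. q u * exp (dot n s u) * ((exp ((X (k + k0) - s i) * u i) - 1) / (X (k + k0) - s i)))
         \<longlonglongrightarrow> q u * u i * exp (dot n s u)"
        by (simp add: mult_ac)
    qed
    show "AE u in M. norm (q u * exp (dot n s u) * ((exp ((X (k + k0) - s i) * u i) - 1) / (X (k + k0) - s i)))
       \<le> q u * u i * exp (dot n ?s u)" for k
    proof (rule AE_I2)
      fix u assume u: "u \<in> space M"
      define d where "d = X (k + k0) - s i"
      have d: "d \<noteq> 0" "\<bar>d\<bar> \<le> a" using Xne[of "k + k0"] k0[of "k + k0"] by (auto simp: d_def)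
      have q: "0 \<le> q u" and ui: "0 \<le> u i" using weight_nonneg[OF u] coord_nonneg[OF u i] by auto
      have "\<bar>(exp (d * u i) - 1) / d\<bar> \<le> u i * exp (\<bar>d\<bar> * u i)"
        using abs_exp_diff_le[OF ui, of d] d by (simp add: abs_divide field_simps)
      also have "\<dots> \<le> u i * exp (a * u i)"
        using d ui by (intro mult_left_mono) (auto intro: mult_right_mono)
      finally have "q u * exp (dot n s u) * \<bar>(exp (d * u i) - 1) / d\<bar> \<le> q u * exp (dot n s u) * (u i * exp (a * u i))"
        using q by (intro mult_left_mono) auto
      also have "\<dots> = q u * u i * exp (dot n ?s u)"
        using i by (simp add: dot_upd s_a algebra_simps flip: exp_add)
      finally show "norm (q u * exp (dot n s u) * ((exp ((X (k + k0) - s i) * u i) - 1) / (X (k + k0) - s i)))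
       \<le> q u * u i * exp (dot n ?s u)"
        using q by (simp add: abs_mult d_def)
    qed
  qed measurable
  moreover have "(\<integral>u. q u * exp (dot n s u) * ((exp ((X (k + k0) - s i) * u i) - 1) / (X (k + k0) - s i)) \<partial>M)
      = (G (s(i := X (k + k0))) - G (s(i := s i))) / (X (k + k0) - s i)" for k
  proof -
    have "X (k + k0) < 0" using k0[of "k + k0"] s_a a by auto
    then have sX: "s(i := X (k + k0)) \<in> neg_orthant n" by (intro neg_orthant_upd s i)
    have "(G (s(i := X (k + k0))) - G (s(i := s i))) / (X (k + k0) - s i) =
       (\<integral>u. ((q u * exp (dot n (s(i := X (k + k0))) u) - r u) - (q u * exp (dot n s u) - r u)) / (X (k + k0) - s i) \<partial>M)"
      unfolding G_def fun_upd_triv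
      by (subst Bochner_Integration.integral_diff[OF integrable[OF sX] integrable[OF s], symmetric]) simp
    also have "\<dots> = (\<integral>u. q u * exp (dot n s u) * ((exp ((X (k + k0) - s i) * u i) - 1) / (X (k + k0) - s i)) \<partial>M)"
      using i by (intro Bochner_Integration.integral_cong refl)
        (simp add: dot_upd algebra_simps, simp add: algebra_simps flip: exp_add)
    finally show ?thesis by (rule sym)
  qed
  ultimately have "(\<lambda>k. (G (s(i := X (k + k0))) - G (s(i := s i))) / (X (k + k0) - s i))
     \<longlonglongrightarrow> (\<integral>u. q u * u i * exp (dot n s u) \<partial>M)"
    by (simp only:)
  then show "(\<lambda>k. (G (s(i := X k)) - G (s(i := s i))) / (X k - s i)) \<longlonglongrightarrow> (\<integral>u. q u * u i * exp (dot n s u) \<partial>M)"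
    by (rule LIMSEQ_offset[of "\<lambda>k. (G (s(i := X k)) - G (s(i := s i))) / (X k - s i)"])
qed

end

text \<open>Functions on the orthant are specified only there, so derivatives have to be compared locally.\<close>

lemma has_field_derivative_orthant_cong:
  assumes s: "s \<in> neg_orthant n" and i: "i < n"
    and eq: "\<And>s. s \<in> neg_orthant n \<Longrightarrow> f s = g s"
  shows "((\<lambda>t. f (s(i := t))) has_field_derivative D) (at (s i)) \<longleftrightarrow>
         ((\<lambda>t. g (s(i := t))) has_field_derivative D) (at (s i))"
proof (rule DERIV_cong_ev)
  have "eventually (\<lambda>t. t \<in> {..<0}) (nhds (s i))"
    using neg_orthant_less[OF s i] by (intro eventually_nhds_in_open) auto
  then show "\<forall>\<^sub>F t in nhds (s i). f (s(i := t)) = g (s(i := t))"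
    by eventually_elim (use s i in \<open>auto intro!: eq neg_orthant_upd\<close>)
qed auto

text \<open>Each differentiation multiplies the integrand by a nonnegative coordinate.\<close>

lemma laplace_transform_absolutely_monotone:
  assumes coord: "\<And>i. i < n \<Longrightarrow> (\<lambda>u. u i) \<in> borel_measurable M"
    and nonneg: "\<And>u i. u \<in> space M \<Longrightarrow> i < n \<Longrightarrow> 0 \<le> u i"
    and int: "\<And>s. s \<in> neg_orthant n \<Longrightarrow> integrable M (\<lambda>u. exp (dot n s u))"
    and f: "\<And>s. s \<in> neg_orthant n \<Longrightarrow> f s = (\<integral>u. exp (dot n s u) \<partial>M)"
  shows "absolutely_monotone n f"
proof -
  define q :: "nat list \<Rightarrow> (nat \<Rightarrow> real) \<Rightarrow> real" where "q js u = (\<Prod>j\<leftarrow>js. u j)" for js u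
  have main: "laplace_integrand n M (q js) (\<lambda>_. 0) \<and>
     (\<forall>s\<in>neg_orthant n. partial_derivs js f s = laplace_integrand.G n M (q js) (\<lambda>_. 0) s)"
    if "js \<in> lists {..<n}" for js
    using that
  proof (induction js rule: list.induct)
    case Nil
    have L: "laplace_integrand n M (q []) (\<lambda>_. 0)"
      by unfold_locales (use coord nonneg int in \<open>auto simp: q_def[abs_def]\<close>)
    then show ?case
      by (simp add: laplace_integrand.G_def[OF L] f) (simp add: q_def)
  next
    case (Cons i js)
    then have i: "i < n" "js \<in> lists {..<n}" by auto
    interpret L: laplace_integrand n M "q js" "\<lambda>_. 0" using Cons i by auto
    have eq: "partial_derivs js f s = L.G s" if "s \<in> neg_orthant n" for s
      using Cons i that by auto
    have qi: "q (i # js) = (\<lambda>u. q js u * u i)" by (auto simp: q_def)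
    note [measurable] = coord[OF i(1)]
    interpret L': laplace_integrand n M "q (i # js)" "\<lambda>_. 0"
      by unfold_locales
        (use coord nonneg i L.weight_nonneg L.integrable_moment in \<open>auto simp: qi\<close>)
    have "partial_derivs (i # js) f s = L'.G s" if s: "s \<in> neg_orthant n" for s
    proof -
      have "((\<lambda>t. partial_derivs js f (s(i := t))) has_field_derivative L'.G s) (at (s i))"
        using L.G_has_derivative[OF s i(1)]
          has_field_derivative_orthant_cong[OF s i(1), of "partial_derivs js f" L.G] eq
        unfolding L'.G_def by (simp add: qi)
      then show ?thesis by (simp add: partial_deriv_def DERIV_imp_deriv)
    qed
    then show ?case using L'.laplace_integrand_axioms by blast
  qed
  show ?thesis
    unfolding absolutely_monotone_def smooth_on_neg_orthant_def
  proof (intro conjI ballI allI impI)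
    fix js assume js: "js \<in> lists {..<n}"
    interpret L: laplace_integrand n M "q js" "\<lambda>_. 0" using main[OF js] by auto
    have eq: "partial_derivs js f s = L.G s" if "s \<in> neg_orthant n" for s
      using main[OF js] that by auto
    show "continuous_on (neg_orthant n) (partial_derivs js f)"
      using L.continuous_on_G eq by (simp cong: continuous_on_cong)
    fix s assume s: "s \<in> neg_orthant n"
    show "0 \<le> partial_derivs js f s"
      unfolding eq[OF s] L.G_def using L.weight_nonneg by (auto intro!: integral_nonneg_AE)
    fix i assume i: "i < n"
    show "(\<lambda>t. partial_derivs js f (s(i := t))) differentiable at (s i)"
      unfolding real_differentiable_def
      using iffD2[OF has_field_derivative_orthant_cong[OF s i, where f = "partial_derivs js f" and g = L.G, OF eq]
          L.G_has_derivative[OF s i]] by blast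
  qed
qed

section \<open>Uniqueness of Laplace transforms\<close>

lemma PiE_lessThan_eq_PiE_UNIV:
  fixes S :: "nat \<Rightarrow> real set"
  shows "PiE {..<n} S = PiE UNIV (\<lambda>i. if i < n then S i else {undefined})"
proof (intro set_eqI iffI)
  fix x assume x: "x \<in> PiE {..<n} S"
  have "x i \<in> (if i < n then S i else {undefined})" for i
    using x by (cases "i < n") (auto dest: PiE_mem PiE_arb)
  then show "x \<in> PiE UNIV (\<lambda>i. if i < n then S i else {undefined})" by (simp only: PiE_UNIV_domain) (rule Pi_I)
next
  fix x assume "x \<in> PiE UNIV (\<lambda>i. if i < n then S i else {undefined})"
  then have x: "x i \<in> (if i < n then S i else {undefined})" for i by (rule PiE_mem) simp
  show "x \<in> PiE {..<n} S"
  proof (rule PiE_I)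
    show "x i \<in> S i" if "i \<in> {..<n}" for i using x[of i] that by simp
    show "x i = undefined" if "i \<notin> {..<n}" for i using x[of i] that by simp
  qed
qed

lemma closed_PiE_orthant:
  fixes S :: "nat \<Rightarrow> real set"
  assumes "\<And>i. i < n \<Longrightarrow> closed (S i)"
  shows "closed (PiE {..<n} S)"
proof -
  have "closedin (product_topology (\<lambda>_::nat. euclidean :: real topology) UNIV)
      (PiE UNIV (\<lambda>i. if i < n then S i else {undefined}))"
    using assms by (subst closedin_product_topology) auto
  then show ?thesis
    by (simp add: PiE_lessThan_eq_PiE_UNIV euclidean_product_topology)
qed

lemma nonneg_orthant_borel [measurable]: "nonneg_orthant n \<in> sets borel"
  unfolding nonneg_orthant_def by (intro borel_closed closed_PiE_orthant) auto

abbreviation borel_orthant :: "nat \<Rightarrow> (nat \<Rightarrow> real) measure" where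
  "borel_orthant n \<equiv> restrict_space borel (nonneg_orthant n)"

lemma coordinate_borel_measurable [measurable]: "(\<lambda>u::nat \<Rightarrow> real. u i) \<in> borel_measurable borel"
  by (rule borel_measurable_continuous_onI) (rule continuous_on_coordinate)

lemma orthant_coord_measurable:
  "sets M = sets (restrict_space borel X) \<Longrightarrow> (\<lambda>u::nat\<Rightarrow>real. u i) \<in> borel_measurable M"
  by (subst measurable_cong_sets[of M "restrict_space borel X"]) (auto intro!: measurable_restrict_space1)

text \<open>Closed sets generate the Borel sets, and the indicator of a closed set is a decreasing limit of
continuous functions of the distance.\<close>

lemma finite_measure_eqI_continuous:
  fixes M N :: "'a::metric_space measure"
  assumes M: "finite_measure M" "sets M = sets borel" and N: "finite_measure N" "sets N = sets borel"
    and eq: "\<And>g :: 'a \<Rightarrow> real. continuous_on UNIV g \<Longrightarrow> (\<And>x. 0 \<le> g x \<and> g x \<le> 1) \<Longrightarrow> (\<integral>x. g x \<partial>M) = (\<integral>x. g x \<partial>N)"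
  shows "M = N"
proof (rule measure_eqI_generator_eq[where E = "{C. closed C}" and \<Omega> = UNIV and A = "\<lambda>_. UNIV"])
  interpret M: finite_measure M by fact
  interpret N: finite_measure N by fact
  show "Int_stable {C::'a set. closed C}" by (auto simp: Int_stable_def)
  show "sets M = sigma_sets UNIV {C. closed C}" "sets N = sigma_sets UNIV {C. closed C}"
    using M N by (auto simp: borel_eq_closed)
  show "emeasure M UNIV \<noteq> \<infinity>" by simp
  fix C :: "'a set" assume "C \<in> {C. closed C}"
  then have C: "closed C" by simp
  show "emeasure M C = emeasure N C"
  proof (cases "C = {}")
    case False
    define g where "g k x = max 0 (1 - real k * infdist x C)" for k :: nat and x
    have g: "continuous_on UNIV (g k)" "0 \<le> g k x" "g k x \<le> 1" for k x
      unfolding g_def by (auto intro!: continuous_intros simp: infdist_nonneg)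
    have lim: "(\<lambda>k. g k x) \<longlonglongrightarrow> indicator C x" for x
    proof (cases "x \<in> C")
      case True
      then show ?thesis by (simp add: g_def)
    next
      case False
      then have "infdist x C > 0"
        using C \<open>C \<noteq> {}\<close> by (metis in_closed_iff_infdist_zero infdist_nonneg less_eq_real_def)
      then obtain k0 where k0: "real k0 * infdist x C > 1" using reals_Archimedean3 by blast
      have "\<forall>\<^sub>F k in sequentially. g k x = 0"
        using eventually_ge_at_top[of k0]
      proof eventually_elim
        case (elim k)
        then have "real k0 * infdist x C \<le> real k * infdist x C"
          by (intro mult_right_mono) (auto simp: infdist_nonneg)
        then show ?case using k0 by (simp add: g_def)
      qed
      then show ?thesis using False by (simp add: tendsto_eventually)
    qed
    have int: "(\<lambda>k. \<integral>x. g k x \<partial>L) \<longlonglongrightarrow> measure L C" if "finite_measure L" "sets L = sets borel" for L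
    proof -
      interpret L: finite_measure L by fact
      note [measurable_cong] = that(2)
      have [measurable]: "g k \<in> borel_measurable L" for k
        using borel_measurable_continuous_onI[OF g(1)] by (simp add: measurable_cong_sets[OF that(2) refl])
      have [measurable]: "C \<in> sets L" using C that(2) by auto
      have "(\<lambda>k. \<integral>x. g k x \<partial>L) \<longlonglongrightarrow> (\<integral>x. indicator C x \<partial>L)"
        by (rule integral_dominated_convergence[where w = "\<lambda>_. 1"])
          (use g lim in \<open>auto simp: abs_le_iff intro: order_trans[OF _ g(2)]\<close>)
      then show ?thesis
        using that by (simp add: sets_eq_imp_space_eq[OF that(2)])
    qed
    have "(\<lambda>k. \<integral>x. g k x \<partial>M) = (\<lambda>k. \<integral>x. g k x \<partial>N)"
    proof
      fix k
      show "(\<integral>x. g k x \<partial>M) = (\<integral>x. g k x \<partial>N)"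
        by (rule eq) (simp_all add: g)
    qed
    then have "measure M C = measure N C"
      using int[OF M] int[OF N] LIMSEQ_unique by metis
    then show ?thesis by (simp add: M.emeasure_eq_measure N.emeasure_eq_measure)
  qed simp
qed auto

inductive_set coord_polys :: "nat \<Rightarrow> ((nat \<Rightarrow> real) \<Rightarrow> real) set" for n where
  const: "(\<lambda>_. c) \<in> coord_polys n"
| coord: "i < n \<Longrightarrow> (\<lambda>x. x i) \<in> coord_polys n"
| add: "f \<in> coord_polys n \<Longrightarrow> g \<in> coord_polys n \<Longrightarrow> (\<lambda>x. f x + g x) \<in> coord_polys n"
| mult: "f \<in> coord_polys n \<Longrightarrow> g \<in> coord_polys n \<Longrightarrow> (\<lambda>x. f x * g x) \<in> coord_polys n"

lemma coord_polys_continuous: "f \<in> coord_polys n \<Longrightarrow> continuous_on S f"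
  by (induction rule: coord_polys.induct) (auto intro!: continuous_intros continuous_on_coordinate)

lemma compact_unit_cube: "compact (PiE {..<n} (\<lambda>_. {0..1}) :: (nat \<Rightarrow> real) set)"
proof -
  have "compactin (product_topology (\<lambda>_::nat. euclidean :: real topology) UNIV)
      (PiE UNIV (\<lambda>i. if i < n then {0..1} else {undefined}))"
    by (subst compactin_PiE) auto
  then show ?thesis
    by (simp add: PiE_lessThan_eq_PiE_UNIV euclidean_product_topology)
qed

text \<open>Stone-Weierstrass needs an algebra of functions with equal integrals, while the hypothesis only
speaks of monomials. The set \<open>H\<close> of all polynomials whose product with every monomial has equal
integrals is closed under multiplication by coordinates, hence by polynomials; as it contains \<open>1\<close>, it
contains all polynomials.\<close>

lemma finite_measures_eq_moments:
  fixes M N :: "(nat \<Rightarrow> real) measure"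
  assumes M: "finite_measure M" "sets M = sets borel" "AE x in M. x \<in> PiE {..<n} (\<lambda>_. {0..1})"
    and N: "finite_measure N" "sets N = sets borel" "AE x in N. x \<in> PiE {..<n} (\<lambda>_. {0..1})"
    and eq: "\<And>k. (\<integral>x. (\<Prod>i<n. x i ^ k i) \<partial>M) = (\<integral>x. (\<Prod>i<n. x i ^ k i) \<partial>N)"
  shows "M = N"
proof -
  let ?K = "PiE {..<n} (\<lambda>_. {0..1::real})"
  let ?m = "\<lambda>k x. \<Prod>i<n. x i ^ k i"
  have [simp, measurable]: "f \<in> borel_measurable borel" if "f \<in> coord_polys n" for f
    by (rule borel_measurable_continuous_onI) (rule coord_polys_continuous[OF that])
  have bdd: "\<exists>B. \<forall>x\<in>?K. \<bar>f x\<bar> \<le> B" if "f \<in> coord_polys n" for f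
    using compact_imp_bounded[OF compact_continuous_image[OF coord_polys_continuous[OF that] compact_unit_cube]]
    by (auto simp: bounded_iff)
  have int: "integrable L f" if L: "finite_measure L" "sets L = sets borel" "AE x in L. x \<in> ?K"
     and f: "f \<in> borel_measurable borel" "\<exists>B. \<forall>x\<in>?K. \<bar>f x\<bar> \<le> B" for L and f :: "(nat \<Rightarrow> real) \<Rightarrow> real"
  proof -
    interpret finite_measure L by fact
    note [measurable_cong] = L(2)
    obtain B where "\<forall>x\<in>?K. \<bar>f x\<bar> \<le> B" using f by blast
    then show ?thesis
      using L(3) f(1) by (intro integrable_const_bound[where B = B]) auto
  qed
  have mono: "?m k \<in> coord_polys n" for k
  proof -
    have p: "i < n \<Longrightarrow> (\<lambda>x. x i ^ j) \<in> coord_polys n" for i j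
      by (induction j) (auto intro: coord_polys.intros)
    have "I \<subseteq> {..<n} \<Longrightarrow> (\<lambda>x. \<Prod>i\<in>I. x i ^ k i) \<in> coord_polys n" for I
      by (induction I rule: infinite_finite_induct) (auto intro: coord_polys.intros p)
    then show ?thesis by simp
  qed
  define H where "H = {h \<in> coord_polys n. \<forall>k. (\<integral>x. ?m k x * h x \<partial>M) = (\<integral>x. ?m k x * h x \<partial>N)}"
  have intM: "integrable M f" and intN: "integrable N f" if "f \<in> coord_polys n" for f
    by (rule int[OF M], use that bdd in auto) (rule int[OF N], use that bdd in auto)
  have ring: "(\<lambda>x. f x * h x) \<in> H" if "f \<in> coord_polys n" "h \<in> H" for f h
    using that
  proof (induction arbitrary: h rule: coord_polys.induct)
    case (const c)
    then show ?case
      by (auto simp: H_def mult.left_commute intro: coord_polys.intros)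
  next
    case (coord i)
    have shift: "?m k x * (x i * h x) = ?m (k(i := Suc (k i))) x * h x" for k x
    proof -
      have "?m (k(i := Suc (k i))) x = (x i ^ Suc (k i)) * (\<Prod>j\<in>{..<n} - {i}. x j ^ k j)"
        using coord(1) by (subst prod.remove[of _ i]) (auto intro!: prod.cong)
      also have "\<dots> = x i * ?m k x"
        using coord(1) by (subst prod.remove[of "{..<n}" i]) auto
      finally show ?thesis by simp
    qed
    have hk: "(\<integral>x. ?m k x * h x \<partial>M) = (\<integral>x. ?m k x * h x \<partial>N)" for k
      using coord(2) by (simp add: H_def)
    show ?case
      unfolding H_def mem_Collect_eq shift
      using coord by (intro conjI allI hk coord_polys.intros) (auto simp: H_def)
  next
    case (add f g)
    have 1: "(\<lambda>x. f x * h x) \<in> H" "(\<lambda>x. g x * h x) \<in> H" using add by auto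
    then have 2: "(\<lambda>x. ?m k x * (f x * h x)) \<in> coord_polys n" "(\<lambda>x. ?m k x * (g x * h x)) \<in> coord_polys n" for k
      by (auto simp: H_def intro: coord_polys.mult[OF mono])
    have "(\<lambda>x. f x * h x + g x * h x) \<in> H"
      using 1 unfolding H_def
      by (auto simp: distrib_left Bochner_Integration.integral_add[OF intM[OF 2(1)] intM[OF 2(2)]]
           Bochner_Integration.integral_add[OF intN[OF 2(1)] intN[OF 2(2)]] intro: coord_polys.add)
    then show ?case by (simp add: distrib_right)
  next
    case (mult f g)
    then have "(\<lambda>x. f x * (g x * h x)) \<in> H" by blast
    then show ?case by (simp add: mult.assoc)
  qed
  have "(\<lambda>_. 1) \<in> H" using eq by (auto simp: H_def intro: coord_polys.intros)
  then have poly_eq: "(\<integral>x. f x \<partial>M) = (\<integral>x. f x \<partial>N)" if "f \<in> coord_polys n" for f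
  proof -
    have "(\<lambda>x. f x * 1) \<in> H" by (rule ring[OF that]) fact
    then have "\<And>k. (\<integral>x. ?m k x * (f x * 1) \<partial>M) = (\<integral>x. ?m k x * (f x * 1) \<partial>N)"
      unfolding H_def by simp
    from this[of "\<lambda>_. 0"] show ?thesis by simp
  qed
  interpret SW: function_ring_on "coord_polys n" ?K
  proof
    show "\<exists>f\<in>coord_polys n. f x \<noteq> f y" if xy: "x \<in> ?K" "y \<in> ?K" "x \<noteq> y" for x y
    proof -
      obtain i where "i < n" "x i \<noteq> y i"
        using xy by (metis PiE_ext lessThan_iff)
      then show ?thesis by (intro bexI[of _ "\<lambda>x. x i"] coord_polys.coord)
    qed
  qed (auto intro: coord_polys.intros coord_polys_continuous compact_unit_cube)
  interpret M: finite_measure M by fact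
  interpret N: finite_measure N by fact
  show ?thesis
  proof (rule finite_measure_eqI_continuous[OF M(1,2) N(1,2)])
    fix g :: "(nat \<Rightarrow> real) \<Rightarrow> real" assume g: "continuous_on UNIV g" "\<And>x. 0 \<le> g x \<and> g x \<le> 1"
    have gm: "g \<in> borel_measurable borel" using g by (simp add: borel_measurable_continuous_onI)
    have gb: "\<exists>B. \<forall>x\<in>?K. \<bar>g x\<bar> \<le> B" using g(2) by (intro exI[of _ 1]) auto
    have gint: "integrable M g" "integrable N g"
      by (rule int[OF M gm gb], rule int[OF N gm gb])
    have close: "\<bar>(\<integral>x. g x \<partial>M) - (\<integral>x. g x \<partial>N)\<bar> \<le> e * (measure M (space M) + measure N (space N))" if e: "e > 0" for e
    proof -
      obtain p where p: "p \<in> coord_polys n" "\<And>x. x \<in> ?K \<Longrightarrow> \<bar>g x - p x\<bar> < e"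
        using SW.Stone_Weierstrass_basic[OF continuous_on_subset[OF g(1)] e] by auto
      have *: "\<bar>(\<integral>x. g x \<partial>L) - (\<integral>x. p x \<partial>L)\<bar> \<le> e * measure L (space L)"
        if L: "finite_measure L" "sets L = sets borel" "AE x in L. x \<in> ?K" "integrable L g" "integrable L p" for L
      proof -
        interpret L: finite_measure L by fact
        have "\<bar>(\<integral>x. g x \<partial>L) - (\<integral>x. p x \<partial>L)\<bar> = \<bar>\<integral>x. g x - p x \<partial>L\<bar>"
          using L by simp
        also have "\<dots> \<le> (\<integral>x. \<bar>g x - p x\<bar> \<partial>L)" by (rule integral_abs_bound)
        also have "\<dots> \<le> (\<integral>x. e \<partial>L)"
        proof (rule integral_mono_AE)
          show "AE x in L. \<bar>g x - p x\<bar> \<le> e"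
            using L(3) by eventually_elim (auto intro: less_imp_le p(2))
        qed (use L in auto)
        finally show ?thesis by (simp add: mult.commute)
      qed
      show ?thesis
        using *[OF M gint(1) intM[OF p(1)]] *[OF N gint(2) intN[OF p(1)]] poly_eq[OF p(1)]
        by (simp add: algebra_simps abs_le_iff)
    qed
    show "(\<integral>x. g x \<partial>M) = (\<integral>x. g x \<partial>N)"
    proof (rule ccontr)
      define d where "d = \<bar>(\<integral>x. g x \<partial>M) - (\<integral>x. g x \<partial>N)\<bar>"
      define K where "K = measure M (space M) + measure N (space N)"
      assume "(\<integral>x. g x \<partial>M) \<noteq> (\<integral>x. g x \<partial>N)"
      then have d: "d > 0" by (simp add: d_def)
      have K: "0 \<le> K" by (simp add: K_def)
      have "d \<le> d / (2 * (K + 1)) * K"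
      proof -
        have "0 < d / (2 * (K + 1))" using d K by simp
        from close[OF this] show ?thesis by (simp only: d_def K_def)
      qed
      also have "\<dots> \<le> d / 2"
        using d K by (simp add: field_simps)
      finally show False using d by simp
    qed
  qed
qed

text \<open>In the coordinates \<open>x\<^sub>i = e\<^bsup>-u\<^sub>i\<^esup>\<close> the Laplace transform at negative integers becomes the moments of a
measure on the compact cube. The factor \<open>w\<close>, that is one extra power of each \<open>x\<^sub>i\<close>, keeps the points
\<open>-k\<^sub>i - 1\<close> strictly negative.\<close>

lemma laplace_transform_unique:
  assumes M: "finite_measure M" "sets M = sets (borel_orthant n)"
    and N: "finite_measure N" "sets N = sets (borel_orthant n)"
    and eq: "\<And>s. s \<in> neg_orthant n \<Longrightarrow> (\<integral>u. exp (dot n s u) \<partial>M) = (\<integral>u. exp (dot n s u) \<partial>N)"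
  shows "M = N"
proof -
  define w where "w u = exp (- (\<Sum>i<n. u i))" for u :: "nat \<Rightarrow> real"
  define T where "T u = (\<lambda>i. if i < n then exp (- u i) else undefined)" for u :: "nat \<Rightarrow> real"
  define T' where "T' x = (\<lambda>i. if i < n then - ln (x i) else undefined)" for x :: "nat \<Rightarrow> real"
  have [measurable]: "(\<lambda>u. u i) \<in> borel_measurable (borel_orthant n)" for i
    by (rule orthant_coord_measurable) simp
  have wm [measurable]: "w \<in> borel_measurable (borel_orthant n)"
    unfolding w_def by measurable
  have Tm [measurable]: "T \<in> measurable (borel_orthant n) borel"
    unfolding T_def by (rule measurable_coordinatewise_then_product) (auto)
  have T'm [measurable]: "T' \<in> measurable borel borel"
    unfolding T'_def by (rule measurable_coordinatewise_then_product) auto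
  define D where "D L = distr (density L (\<lambda>u. ennreal (w u))) borel T" for L
  have inD: "space L = nonneg_orthant n" if "sets L = sets (borel_orthant n)" for L
    using sets_eq_imp_space_eq[OF that] by (simp add: space_restrict_space)
  have T'T: "T' (T u) = u" if "u \<in> nonneg_orthant n" for u
    using that unfolding T_def T'_def nonneg_orthant_def by (auto simp: PiE_iff extensional_def fun_eq_iff)
  have D: "finite_measure (D L)" "sets (D L) = sets borel" "AE x in D L. x \<in> PiE {..<n} (\<lambda>_. {0..1})"
     "(\<integral>x. (\<Prod>i<n. x i ^ k i) \<partial>D L) = (\<integral>u. exp (dot n (\<lambda>i\<in>{..<n}. - real (k i) - 1) u) \<partial>L)"
    if L: "finite_measure L" "sets L = sets (borel_orthant n)" for L k
  proof -
    interpret L: finite_measure L by fact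
    note [measurable_cong] = L(2)
    have w1: "0 \<le> w u" "w u \<le> 1" if "u \<in> space L" for u
      using that unfolding inD[OF L(2)] w_def nonneg_orthant_def by (auto intro!: sum_nonneg simp: PiE_iff)
    have "finite_measure (density L (\<lambda>u. ennreal (w u)))"
    proof (rule finite_measureI)
      have "(\<integral>\<^sup>+ u. ennreal (w u) \<partial>L) \<le> (\<integral>\<^sup>+ u. 1 \<partial>L)"
        using w1 by (intro nn_integral_mono) (auto intro: order_trans[OF ennreal_leI])
      also have "\<dots> < \<infinity>" by (simp add: L.emeasure_finite less_top[symmetric])
      finally show "emeasure (density L (\<lambda>u. ennreal (w u))) (space (density L (\<lambda>u. ennreal (w u)))) \<noteq> \<infinity>"
        by (simp add: emeasure_density cong: nn_integral_cong)
    qed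
    then show "finite_measure (D L)"
      unfolding D_def by (rule finite_measure.finite_measure_distr) measurable
    show "sets (D L) = sets borel" by (simp add: D_def)
    have [measurable]: "PiE {..<n} (\<lambda>_. {0..1::real}) \<in> sets borel"
      by (intro borel_closed closed_PiE_orthant) auto
    show "AE x in D L. x \<in> PiE {..<n} (\<lambda>_. {0..1})"
      unfolding D_def
    proof (subst AE_distr_iff)
      show "AE x in density L (\<lambda>u. ennreal (w u)). T x \<in> PiE {..<n} (\<lambda>_. {0..1})"
        by (rule AE_I2) (auto simp: inD[OF L(2)] T_def nonneg_orthant_def PiE_iff extensional_def)
    qed auto
    have "(\<integral>x. (\<Prod>i<n. x i ^ k i) \<partial>D L) = (\<integral>u. w u * (\<Prod>i<n. T u i ^ k i) \<partial>L)"
      unfolding D_def using w1 by (subst integral_distr) (auto simp: integral_density w_def)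
    also have "\<dots> = (\<integral>u. exp (dot n (\<lambda>i\<in>{..<n}. - real (k i) - 1) u) \<partial>L)"
    proof (rule Bochner_Integration.integral_cong[OF refl])
      fix u
      have "w u * (\<Prod>i<n. T u i ^ k i) = (\<Prod>i<n. exp (- u i)) * (\<Prod>i<n. exp (- (real (k i) * u i)))"
        by (auto simp: w_def T_def exp_sum sum_negf[symmetric] exp_of_nat_mult[symmetric] intro!: prod.cong)
      also have "\<dots> = exp (dot n (\<lambda>i\<in>{..<n}. - real (k i) - 1) u)"
        unfolding prod.distrib[symmetric] dot_def exp_sum[OF finite_lessThan]
        by (intro prod.cong) (auto simp: algebra_simps simp flip: exp_add)
      finally show "w u * (\<Prod>i<n. T u i ^ k i) = exp (dot n (\<lambda>i\<in>{..<n}. - real (k i) - 1) u)" .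
    qed
    finally show "(\<integral>x. (\<Prod>i<n. x i ^ k i) \<partial>D L) = (\<integral>u. exp (dot n (\<lambda>i\<in>{..<n}. - real (k i) - 1) u) \<partial>L)" .
  qed
  have DMN: "D M = D N"
  proof (rule finite_measures_eq_moments[OF D(1-3)[OF M] D(1-3)[OF N]])
    fix k :: "nat \<Rightarrow> nat"
    have "(\<lambda>i\<in>{..<n}. - real (k i) - 1) \<in> neg_orthant n" by (auto simp: neg_orthant_def)
    then show "(\<integral>x. (\<Prod>i<n. x i ^ k i) \<partial>D M) = (\<integral>x. (\<Prod>i<n. x i ^ k i) \<partial>D N)"
      by (simp add: D(4)[OF M] D(4)[OF N] eq)
  qed
  have recover: "emeasure L A = (\<integral>\<^sup>+ x. indicator A (T' x) * ennreal (exp (\<Sum>i<n. T' x i)) \<partial>D L)"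
    if L: "sets L = sets (borel_orthant n)" and A: "A \<in> sets L" for L A
  proof -
    note [measurable_cong] = L
    have "A \<in> sets borel" using A L nonneg_orthant_borel[of n] by (auto simp: sets_restrict_space)
    note [measurable] = this A
    have "(\<integral>\<^sup>+ x. indicator A (T' x) * ennreal (exp (\<Sum>i<n. T' x i)) \<partial>D L) =
      (\<integral>\<^sup>+ u. ennreal (w u) * (indicator A (T' (T u)) * ennreal (exp (\<Sum>i<n. T' (T u) i))) \<partial>L)"
      unfolding D_def by (simp add: nn_integral_distr nn_integral_density)
    also have "\<dots> = (\<integral>\<^sup>+ u. indicator A u \<partial>L)"
    proof (rule nn_integral_cong)
      fix u assume "u \<in> space L"
      then have u: "T' (T u) = u" by (simp add: T'T inD[OF L])
      show "ennreal (w u) * (indicator A (T' (T u)) * ennreal (exp (\<Sum>i<n. T' (T u) i))) = indicator A u"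
        unfolding u w_def by (simp add: indicator_def exp_minus flip: ennreal_mult')
    qed
    finally show ?thesis by simp
  qed
  show "M = N"
  proof (rule measure_eqI)
    show "sets M = sets N" using M N by simp
    fix A assume "A \<in> sets M"
    then show "emeasure M A = emeasure N A"
      using recover[of M A] recover[of N A] M N DMN by simp
  qed
qed

section \<open>A space-filling curve and limits of discrete measures\<close>

text \<open>On \<open>[0,1/3]\<close> modulo 2 this is \<open>0\<close> and on \<open>[2/3,1]\<close> modulo 2 it is \<open>1\<close>. Applied to \<open>3\<^sup>k t\<close>, it reads
off half of the \<open>k\<close>-th ternary digit of a point \<open>t\<close> of the Cantor set, and it is continuous.\<close>

definition ternary_digit :: "real \<Rightarrow> real" where
  "ternary_digit x = max 0 (min 1 (1 / 2 - cos (pi * x)))"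

text \<open>Schoenberg's curve: for \<open>t\<close> in the Cantor set, the binary digits of the \<open>i\<close>-th coordinate are the
halved ternary digits of \<open>t\<close> at the positions congruent to \<open>i\<close> modulo \<open>n\<close>.\<close>

definition filling_curve :: "nat \<Rightarrow> nat \<Rightarrow> real \<Rightarrow> real" where
  "filling_curve n i t = (\<Sum>k. ternary_digit (3 ^ (k * n + i) * t) / 2 ^ Suc k)"

lemma ternary_digit_bounds: "0 \<le> ternary_digit x" "ternary_digit x \<le> 1"
  by (auto simp: ternary_digit_def)

lemma summable_halves: "summable (\<lambda>k. 1 / 2 ^ Suc k :: real)"
  using sums_summable[OF power_half_series] by (simp add: power_divide)

lemma filling_curve_summable: "summable (\<lambda>k. ternary_digit (3 ^ (k * n + i) * t) / 2 ^ Suc k)"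
  by (rule summable_comparison_test'[OF summable_halves, where N = 0])
     (use ternary_digit_bounds in \<open>auto intro!: divide_right_mono\<close>)

lemma filling_curve_bounds: "0 \<le> filling_curve n i t" "filling_curve n i t \<le> 1"
proof -
  show "0 \<le> filling_curve n i t"
    unfolding filling_curve_def by (intro suminf_nonneg filling_curve_summable) (simp add: ternary_digit_bounds)
  have "filling_curve n i t \<le> (\<Sum>k. 1 / 2 ^ Suc k)"
    unfolding filling_curve_def
    by (intro suminf_le filling_curve_summable summable_halves divide_right_mono ternary_digit_bounds) simp
  also have "\<dots> = 1"
    using sums_unique[OF power_half_series] by (simp add: power_divide)
  finally show "filling_curve n i t \<le> 1" .
qed

lemma continuous_filling_curve: "continuous_on UNIV (filling_curve n i)"
proof -
  have "uniform_limit UNIV (\<lambda>K t. \<Sum>k<K. ternary_digit (3 ^ (k * n + i) * t) / 2 ^ Suc k)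
      (\<lambda>t. \<Sum>k. ternary_digit (3 ^ (k * n + i) * t) / 2 ^ Suc k) sequentially"
    by (rule Weierstrass_m_test[OF _ summable_halves])
       (use ternary_digit_bounds in \<open>auto intro!: divide_right_mono\<close>)
  then have "continuous_on UNIV (\<lambda>t. \<Sum>k. ternary_digit (3 ^ (k * n + i) * t) / 2 ^ Suc k)"
    by (rule uniform_limit_theorem[rotated])
       (auto simp: ternary_digit_def intro!: always_eventually continuous_intros)
  then show ?thesis by (simp add: filling_curve_def[abs_def])
qed

lemma binary_expansion:
  fixes y :: real assumes "0 \<le> y" "y \<le> 1"
  obtains a :: "nat \<Rightarrow> nat" where "\<And>k. a k \<le> 1" "(\<lambda>k. real (a k) / 2 ^ Suc k) sums y"
proof -
  \<comment> \<open>Greedy digits: \<open>r k\<close> is the remainder after \<open>k\<close> digits, rescaled to \<open>[0,1]\<close>. A remainder equal to \<open>1\<close> is allowed, so \<open>y = 1\<close> needs no separate treatment.\<close>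
  define r where "r = rec_nat y (\<lambda>_ x. 2 * x - (if 1 / 2 \<le> x then 1 else 0))"
  have r0: "r 0 = y" and rS: "r (Suc k) = 2 * r k - (if 1 / 2 \<le> r k then 1 else 0)" for k
    by (simp_all add: r_def)
  have r: "0 \<le> r k \<and> r k \<le> 1" for k
    by (induction k) (use assms in \<open>auto simp: r0 rS\<close>)
  define a where "a k = (if 1 / 2 \<le> r k then 1 else 0 :: nat)" for k
  have part: "(\<Sum>k<K. real (a k) / 2 ^ Suc k) = y - r K / 2 ^ K" for K
    by (induction K) (auto simp: r0 rS a_def field_simps)
  have "(\<lambda>K. (1 / 2) ^ K :: real) \<longlonglongrightarrow> 0" by (rule LIMSEQ_realpow_zero) auto
  then have "(\<lambda>K. r K / 2 ^ K) \<longlonglongrightarrow> 0"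
    by (rule tendsto_sandwich[OF _ _ tendsto_const, rotated 2])
       (use r in \<open>auto simp: power_divide intro!: always_eventually divide_right_mono\<close>)
  then have "(\<lambda>K. y - r K / 2 ^ K) \<longlonglongrightarrow> y - 0" by (intro tendsto_intros)
  then have "(\<lambda>k. real (a k) / 2 ^ Suc k) sums y" unfolding sums_def part by simp
  then show ?thesis using that[of a] by (simp add: a_def)
qed

text \<open>Multiplication by \<open>3\<^sup>K\<close> moves the first \<open>K\<close> digits into an even integer, which the cosine ignores. What
remains is the tail \<open>T K\<close>, which lies in \<open>[0,1/3]\<close> or \<open>[2/3,1]\<close> according to the digit \<open>A K\<close>.\<close>

lemma ternary_digit_expansion:
  fixes A :: "nat \<Rightarrow> nat"
  assumes A: "\<And>m. A m \<le> 1"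
  defines "t \<equiv> (\<Sum>m. 2 * real (A m) / 3 ^ Suc m)"
  shows "0 \<le> t" "t \<le> 1" "ternary_digit (3 ^ K * t) = real (A K)"
proof -
  define T where "T K = (\<Sum>m. 2 * real (A (K + m)) / 3 ^ Suc m)" for K
  have geo: "(\<lambda>m. 2 / 3 ^ Suc m :: real) sums 1"
    using sums_mult[OF geometric_sums[of "1 / 3 :: real"], of "2 / 3"] by (simp add: power_divide)
  have A': "real (A m) \<le> 1" for m using A[of m] by simp
  have le: "2 * real (A (K + m)) / 3 ^ Suc m \<le> 2 / 3 ^ Suc m" for K m
    using A'[of "K + m"] by (intro divide_right_mono) auto
  have sm: "summable (\<lambda>m. 2 * real (A (K + m)) / 3 ^ Suc m)" for K
    by (rule summable_comparison_test'[OF sums_summable[OF geo], where N = 0]) (use le in auto)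
  have T01: "0 \<le> T K" "T K \<le> 1" for K
  proof -
    show "0 \<le> T K" unfolding T_def by (intro suminf_nonneg sm) auto
    have "T K \<le> (\<Sum>m. 2 / 3 ^ Suc m)" unfolding T_def by (intro suminf_le sm sums_summable[OF geo] le)
    then show "T K \<le> 1" using sums_unique[OF geo] by simp
  qed
  have Trec: "T K = 2 * real (A K) / 3 + T (Suc K) / 3" for K
  proof -
    have "T K = (\<Sum>m. 2 * real (A (K + Suc m)) / 3 ^ Suc (Suc m)) + 2 * real (A K) / 3"
      unfolding T_def by (subst suminf_split_head[OF sm]) simp
    also have "(\<Sum>m. 2 * real (A (K + Suc m)) / 3 ^ Suc (Suc m)) = (\<Sum>m. 2 * real (A (Suc K + m)) / 3 ^ Suc m / 3)"
      by (intro suminf_cong) (simp add: field_simps)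
    also have "\<dots> = T (Suc K) / 3"
      unfolding T_def by (rule suminf_divide[OF sm])
    finally show ?thesis by simp
  qed
  have t: "t = T 0" by (simp add: t_def T_def)
  show "0 \<le> t" "t \<le> 1" using T01[of 0] by (auto simp: t)
  have "\<exists>N::int. 3 ^ K * t = 2 * of_int N + T K"
  proof (induction K)
    case 0
    show ?case by (rule exI[of _ 0]) (simp add: t)
  next
    case (Suc K)
    then obtain N :: int where "3 ^ K * t = 2 * of_int N + T K" by blast
    then have "3 ^ Suc K * t = 2 * of_int (3 * N + int (A K)) + T (Suc K)"
      using Trec[of K] by (simp add: algebra_simps)
    then show ?case by blast
  qed
  then obtain N :: int where N: "3 ^ K * t = 2 * of_int N + T K" by blast
  have "pi * (3 ^ K * t) = 2 * pi * of_int N + pi * T K"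
    unfolding N by (simp add: algebra_simps)
  then have cos: "cos (pi * (3 ^ K * t)) = cos (pi * T K)"
    by (simp only: cos_add cos_int_2pin sin_int_2pin mult_1 mult_zero_left diff_0_right)
  show "ternary_digit (3 ^ K * t) = real (A K)"
  proof (cases "A K = 0")
    case True
    then have "T K \<le> 1 / 3" using Trec[of K] T01[of "Suc K"] by simp
    then have "cos (pi / 3) \<le> cos (pi * T K)"
      using T01[of K] by (intro cos_monotone_0_pi_le) (auto simp: field_simps)
    then show ?thesis using True by (simp add: ternary_digit_def cos cos_60)
  next
    case False
    then have AK: "A K = 1" using A[of K] by simp
    then have "2 / 3 \<le> T K" using Trec[of K] T01[of "Suc K"] by simp
    then have "cos (pi / 3) \<le> cos (pi - pi * T K)"
      using T01[of K] by (intro cos_monotone_0_pi_le) (auto simp: field_simps)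
    then have "cos (pi * T K) \<le> - (1 / 2)" by (simp add: cos_60)
    then show ?thesis using AK by (simp add: ternary_digit_def cos)
  qed
qed

lemma filling_curve_surj:
  assumes n: "1 \<le> n" and y: "\<And>i. i < n \<Longrightarrow> 0 \<le> y i \<and> y i \<le> 1"
  obtains t where "0 \<le> t" "t \<le> 1" "\<And>i. i < n \<Longrightarrow> filling_curve n i t = y i"
proof -
  have "\<forall>i. \<exists>a :: nat \<Rightarrow> nat. i < n \<longrightarrow> (\<forall>k. a k \<le> 1) \<and> (\<lambda>k. real (a k) / 2 ^ Suc k) sums y i"
    using y binary_expansion by metis
  then obtain a where a: "\<And>i k. i < n \<Longrightarrow> a i k \<le> (1::nat)" "\<And>i. i < n \<Longrightarrow> (\<lambda>k. real (a i k) / 2 ^ Suc k) sums y i"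
    by metis
  define A where "A m = a (m mod n) (m div n)" for m
  have A: "A m \<le> 1" for m unfolding A_def by (rule a(1)) (use n in simp)
  define t where "t = (\<Sum>m. 2 * real (A m) / 3 ^ Suc m)"
  have T: "0 \<le> t" "t \<le> 1" "ternary_digit (3 ^ K * t) = real (A K)" for K
    unfolding t_def by (rule ternary_digit_expansion[OF A])+
  have "filling_curve n i t = y i" if "i < n" for i
  proof -
    have "ternary_digit (3 ^ (k * n + i) * t) = real (a i k)" for k
      using that by (simp only: T(3)) (simp add: A_def)
    then show ?thesis
      using sums_unique[OF a(2)[OF that]] by (simp add: filling_curve_def)
  qed
  then show ?thesis using that T by blast
qed

lemma finite_point_masses:
  assumes I: "finite I" and w: "\<And>l. l \<in> I \<Longrightarrow> 0 \<le> w l" "(\<Sum>l\<in>I. w l) = 1"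
  shows "\<exists>M. real_distribution M \<and>
    (\<forall>h :: real \<Rightarrow> real. h \<in> borel_measurable borel \<longrightarrow> (\<integral>x. h x \<partial>M) = (\<Sum>l\<in>I. w l * h (\<tau> l)))"
proof -
  define P where "P = point_measure I (\<lambda>l. ennreal (w l))"
  have sP: "space P = I" by (simp add: P_def space_point_measure)
  have "prob_space P"
  proof
    have "emeasure P (space P) = (\<Sum>l\<in>I. ennreal (w l))"
      unfolding sP unfolding P_def by (rule emeasure_point_measure_finite) (use I in auto)
    also have "\<dots> = 1" using w by (simp add: sum_ennreal)
    finally show "emeasure P (space P) = 1" .
  qed
  then interpret P: prob_space P .
  have m: "\<tau> \<in> measurable P borel"
    unfolding P_def by simp
  define M where "M = distr P borel \<tau>"
  have "prob_space M" unfolding M_def by (rule P.prob_space_distr[OF m])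
  then have "real_distribution M"
    by (simp add: real_distribution_def real_distribution_axioms_def M_def)
  moreover have "(\<integral>x. h x \<partial>M) = (\<Sum>l\<in>I. w l * h (\<tau> l))" if "h \<in> borel_measurable borel" for h :: "real \<Rightarrow> real"
    unfolding M_def integral_distr[OF m that] unfolding P_def
    by (subst lebesgue_integral_point_measure_finite) (use I w in \<open>auto simp: mult.commute\<close>)
  ultimately show ?thesis by blast
qed

text \<open>Compactness of the probability measures on the cube, for discrete measures: lifting the points to
preimages in \<open>[0,1]\<close> under the filling curve gives a tight sequence on the line, and Helly's theorem
applies there. The limit measure is left on the line, together with the curve.\<close>

lemma weighted_points_subsequence:
  fixes I :: "nat \<Rightarrow> 'a set" and x :: "nat \<Rightarrow> 'a \<Rightarrow> nat \<Rightarrow> real" and w :: "nat \<Rightarrow> 'a \<Rightarrow> real"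
  assumes n: "1 \<le> n" and I: "\<And>k. finite (I k)"
    and w: "\<And>k l. l \<in> I k \<Longrightarrow> 0 \<le> w k l" "\<And>k. (\<Sum>l\<in>I k. w k l) = 1"
    and x: "\<And>k l i. l \<in> I k \<Longrightarrow> i < n \<Longrightarrow> 0 \<le> x k l i \<and> x k l i \<le> 1"
  obtains r M X where "strict_mono (r :: nat \<Rightarrow> nat)" "real_distribution M"
    "\<And>i. continuous_on UNIV (X i :: real \<Rightarrow> real)" "\<And>i t. 0 \<le> X i t \<and> X i t \<le> 1"
    "\<And>(h :: (nat \<Rightarrow> real) \<Rightarrow> real) B. continuous_on UNIV (\<lambda>t. h (\<lambda>i. X i t)) \<Longrightarrow> \<forall>y. \<bar>h y\<bar> \<le> B \<Longrightarrow>
       \<forall>y z. (\<forall>i<n. y i = z i) \<longrightarrow> h y = h z \<Longrightarrow>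
       (\<lambda>k. \<Sum>l\<in>I (r k). w (r k) l * h (x (r k) l)) \<longlonglongrightarrow> (\<integral>t. h (\<lambda>i. X i t) \<partial>M)"
proof -
  have "\<forall>k l. \<exists>t. l \<in> I k \<longrightarrow> 0 \<le> t \<and> t \<le> 1 \<and> (\<forall>i<n. filling_curve n i t = x k l i)"
  proof (intro allI)
    fix k l
    show "\<exists>t. l \<in> I k \<longrightarrow> 0 \<le> t \<and> t \<le> 1 \<and> (\<forall>i<n. filling_curve n i t = x k l i)"
    proof (cases "l \<in> I k")
      case True
      show ?thesis by (rule filling_curve_surj[OF n x[OF True]]) blast+
    qed blast
  qed
  then obtain \<tau> where \<tau>: "\<And>k l. l \<in> I k \<Longrightarrow> 0 \<le> \<tau> k l \<and> \<tau> k l \<le> 1 \<and> (\<forall>i<n. filling_curve n i (\<tau> k l) = x k l i)"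
    by metis
  have "\<forall>k. \<exists>M. real_distribution M \<and>
    (\<forall>h :: real \<Rightarrow> real. h \<in> borel_measurable borel \<longrightarrow> (\<integral>x. h x \<partial>M) = (\<Sum>l\<in>I k. w k l * h (\<tau> k l)))"
    by (intro allI finite_point_masses I w)
  then obtain \<mu> where \<mu>: "\<And>k. real_distribution (\<mu> k)"
    "\<And>k (h :: real \<Rightarrow> real). h \<in> borel_measurable borel \<Longrightarrow> (\<integral>x. h x \<partial>\<mu> k) = (\<Sum>l\<in>I k. w k l * h (\<tau> k l))"
    by metis
  \<comment> \<open>The left end \<open>-1\<close> makes the half-open interval contain \<open>0\<close>.\<close>
  have one: "measure (\<mu> k) {-1<..1} = 1" for k
  proof -
    interpret real_distribution "\<mu> k" by (rule \<mu>)
    have "measure (\<mu> k) {-1<..1} = (\<integral>x. indicator {-1<..1} x \<partial>\<mu> k)" by simp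
    also have "\<dots> = (\<Sum>l\<in>I k. w k l * indicator {-1<..1} (\<tau> k l))" by (rule \<mu>) simp
    also have "\<dots> = (\<Sum>l\<in>I k. w k l)"
      using \<tau> by (intro sum.cong) (auto simp: indicator_def less_le_trans[of "-1" 0])
    finally show ?thesis using w by simp
  qed
  have "tight \<mu>"
    unfolding tight_def
  proof (intro conjI allI impI \<mu>)
    fix \<epsilon> :: real assume "\<epsilon> > 0"
    then show "\<exists>a b. a < b \<and> (\<forall>k. 1 - \<epsilon> < measure (\<mu> k) {a<..b})"
      by (intro exI[of _ "-1"] exI[of _ 1]) (simp add: one)
  qed
  then have "\<exists>r M. strict_mono (r :: nat \<Rightarrow> nat) \<and> real_distribution M \<and> weak_conv_m (\<mu> \<circ> id \<circ> r) M"
    by (rule tight_imp_convergent_subsubsequence) (simp add: strict_mono_def)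
  then obtain r M where rM: "strict_mono (r :: nat \<Rightarrow> nat)" "real_distribution M" "weak_conv_m (\<mu> \<circ> id \<circ> r) M"
    by (elim exE conjE)
  show ?thesis
  proof (rule that[OF rM(1,2), of "filling_curve n"])
    fix h :: "(nat \<Rightarrow> real) \<Rightarrow> real" and B
    assume h: "continuous_on UNIV (\<lambda>t. h (\<lambda>i. filling_curve n i t))" "\<forall>y. \<bar>h y\<bar> \<le> B"
      "\<forall>y z. (\<forall>i<n. y i = z i) \<longrightarrow> h y = h z"
    let ?h = "\<lambda>t. h (\<lambda>i. filling_curve n i t)"
    have "(\<lambda>k. \<integral>t. ?h t \<partial>(\<mu> \<circ> id \<circ> r) k) \<longlonglongrightarrow> (\<integral>t. ?h t \<partial>M)"
    proof (rule weak_conv_imp_integral_bdd_continuous_conv[where B = B])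
      show "real_distribution ((\<mu> \<circ> id \<circ> r) k)" for k by (simp add: \<mu>(1))
      show "isCont ?h t" for t using h(1) by (simp add: continuous_on_eq_continuous_at)
      show "norm (?h t) \<le> B" for t using h(2) by simp
    qed (rule rM)+
    moreover have "(\<integral>t. ?h t \<partial>(\<mu> \<circ> id \<circ> r) k) = (\<Sum>l\<in>I (r k). w (r k) l * h (x (r k) l))" for k
    proof -
      have "(\<integral>t. ?h t \<partial>(\<mu> \<circ> id \<circ> r) k) = (\<Sum>l\<in>I (r k). w (r k) l * ?h (\<tau> (r k) l))"
        unfolding comp_def id_def by (rule \<mu>(2)) (rule borel_measurable_continuous_onI[OF h(1)])
      also have "\<dots> = (\<Sum>l\<in>I (r k). w (r k) l * h (x (r k) l))"
      proof (rule sum.cong[OF refl])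
        fix l assume l: "l \<in> I (r k)"
        have "?h (\<tau> (r k) l) = h (x (r k) l)" by (rule h(3)[rule_format]) (use \<tau>[OF l] in blast)
        then show "w (r k) l * ?h (\<tau> (r k) l) = w (r k) l * h (x (r k) l)" by simp
      qed
      finally show ?thesis .
    qed
    ultimately show "(\<lambda>k. \<Sum>l\<in>I (r k). w (r k) l * h (x (r k) l)) \<longlonglongrightarrow> (\<integral>t. ?h t \<partial>M)" by simp
  qed (use filling_curve_bounds continuous_filling_curve in auto)
qed

section \<open>Bernstein weights of a difference monotone function\<close>

definition coord_shift :: "nat \<Rightarrow> real \<Rightarrow> ((nat \<Rightarrow> real) \<Rightarrow> real) \<Rightarrow> (nat \<Rightarrow> real) \<Rightarrow> real" where
  "coord_shift i h f s = f (s(i := s i - h))"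

lemma coord_shift_funpow: "(coord_shift i h ^^ a) f = (\<lambda>s. f (s(i := s i - real a * h)))"
proof (induction a)
  case (Suc a)
  show ?case
  proof
    fix s :: "nat \<Rightarrow> real"
    show "(coord_shift i h ^^ Suc a) f s = f (s(i := s i - real (Suc a) * h))"
      by (simp only: funpow.simps(2) comp_apply Suc.IH coord_shift_def[of i h "\<lambda>s. f (s(i := s i - real a * h))"])
        (simp add: algebra_simps)
  qed
qed simp

lemma coord_shift_funpow_back_diff:
  "(coord_shift i h ^^ a) (back_diff j k f) = back_diff j k ((coord_shift i h ^^ a) f)"
  by (simp add: coord_shift_funpow back_diff_shift)

text \<open>The binomial expansion of \<open>(\<Delta> + E)\<^sup>M\<close>, where the shift \<open>E\<close> and the difference \<open>\<Delta>\<close> commute and add up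
to the identity.\<close>

lemma binomial_partition_of_identity:
  "(\<Sum>a\<le>M. real (M choose a) * (back_diff i h ^^ (M - a)) ((coord_shift i h ^^ a) f) s) = f s"
proof (induction M arbitrary: f)
  case (Suc M)
  define F where "F f b a = (back_diff i h ^^ b) ((coord_shift i h ^^ a) f) s" for f b a
  have IH: "(\<Sum>a\<le>M. real (M choose a) * F f (M - a) a) = f s" for f
    unfolding F_def by (rule Suc)
  have Fd: "F f (Suc b) a = F (back_diff i h f) b a" for f b a
    by (simp add: F_def coord_shift_funpow_back_diff funpow_swap1)
  have Fe: "F f b (Suc a) = F (coord_shift i h f) b a" for f b a
    by (simp add: F_def funpow_swap1)
  have "(\<Sum>a\<le>Suc M. real (Suc M choose a) * F f (Suc M - a) a)
     = F f (Suc M) 0 + (\<Sum>a\<le>M. real (Suc M choose Suc a) * F f (M - a) (Suc a))"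
    by (subst sum.atMost_Suc_shift) simp
  also have "\<dots> = (F f (Suc M) 0 + (\<Sum>a\<le>M. real (M choose Suc a) * F f (M - a) (Suc a)))
      + (\<Sum>a\<le>M. real (M choose a) * F f (M - a) (Suc a))"
    by (simp add: distrib_right sum.distrib)
  also have "F f (Suc M) 0 + (\<Sum>a\<le>M. real (M choose Suc a) * F f (M - a) (Suc a))
      = (\<Sum>a\<le>Suc M. real (M choose a) * F f (Suc M - a) a)"
    by (subst sum.atMost_Suc_shift) simp
  also have "\<dots> = (\<Sum>a\<le>M. real (M choose a) * F f (Suc (M - a)) a)"
    by (simp add: Suc_diff_le)
  also have "\<dots> + (\<Sum>a\<le>M. real (M choose a) * F f (M - a) (Suc a)) = back_diff i h f s + coord_shift i h f s"
    by (simp only: Fd Fe IH)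
  also have "\<dots> = f s" by (simp add: back_diff_def coord_shift_def)
  finally show ?case by (simp add: F_def)
qed simp

lemma bernstein_moment_one_coordinate:
  assumes "j \<le> N"
  shows "(\<Sum>l\<le>N. real (N choose l) * (real (l choose j) / real (N choose j)) *
            (back_diff i h ^^ (N - l)) ((coord_shift i h ^^ l) f) s) = f (s(i := s i - real j * h))"
proof -
  have "(\<Sum>l\<le>N. real (N choose l) * (real (l choose j) / real (N choose j)) *
            (back_diff i h ^^ (N - l)) ((coord_shift i h ^^ l) f) s)
     = (\<Sum>l=j..N. real (N choose l) * (real (l choose j) / real (N choose j)) *
            (back_diff i h ^^ (N - l)) ((coord_shift i h ^^ l) f) s)"
    by (rule sum.mono_neutral_right) auto
  also have "\<dots> = (\<Sum>a\<le>N - j. real (N - j choose a) *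
      (back_diff i h ^^ (N - j - a)) ((coord_shift i h ^^ a) ((coord_shift i h ^^ j) f)) s)"
  proof (rule sum.reindex_bij_witness[of _ "\<lambda>a. j + a" "\<lambda>l. l - j"])
    fix l assume l: "l \<in> {j..N}"
    have "(N choose l) * (l choose j) = (N choose j) * (N - j choose (l - j))"
      using l by (intro choose_mult) auto
    then have "real (N choose l) * real (l choose j) = real (N choose j) * real (N - j choose (l - j))"
      by (metis of_nat_mult)
    moreover have "real (N choose j) \<noteq> 0" using assms by simp
    ultimately have "real (N choose l) * (real (l choose j) / real (N choose j)) = real (N - j choose (l - j))"
      by (simp add: field_simps)
    moreover have "(coord_shift i h ^^ (l - j)) ((coord_shift i h ^^ j) f) = (coord_shift i h ^^ l) f"
      using l by (metis atLeastAtMost_iff comp_apply funpow_add le_add_diff_inverse2)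
    moreover have "N - j - (l - j) = N - l" using l by auto
    ultimately show "real (N - j choose (l - j)) *
      (back_diff i h ^^ (N - j - (l - j))) ((coord_shift i h ^^ (l - j)) ((coord_shift i h ^^ j) f)) s =
      real (N choose l) * (real (l choose j) / real (N choose j)) *
            (back_diff i h ^^ (N - l)) ((coord_shift i h ^^ l) f) s" by simp
  qed (use assms in auto)
  also have "\<dots> = (coord_shift i h ^^ j) f s" by (rule binomial_partition_of_identity)
  finally show ?thesis by (simp add: coord_shift_funpow)
qed

primrec bernstein_diff :: "nat \<Rightarrow> real \<Rightarrow> nat \<Rightarrow> (nat \<Rightarrow> nat) \<Rightarrow> ((nat \<Rightarrow> real) \<Rightarrow> real) \<Rightarrow> (nat \<Rightarrow> real) \<Rightarrow> real" where
  "bernstein_diff N h 0 l f = f"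
| "bernstein_diff N h (Suc k) l f =
     bernstein_diff N h k l ((back_diff k h ^^ (N - l k)) ((coord_shift k h ^^ l k) f))"

lemma bernstein_diff_cong:
  "(\<And>i. i < k \<Longrightarrow> l i = l' i) \<Longrightarrow> bernstein_diff N h k l f = bernstein_diff N h k l' f"
  by (induction k arbitrary: f) auto

lemma diff_monotone_bernstein_diff:
  assumes h: "0 < h"
  shows "diff_monotone n f \<Longrightarrow> k \<le> n \<Longrightarrow> diff_monotone n (bernstein_diff N h k l f)"
proof (induction k arbitrary: f)
  case (Suc k)
  have 1: "diff_monotone n ((coord_shift k h ^^ a) f)" for a
    unfolding coord_shift_funpow using Suc.prems h by (intro diff_monotone_shift) auto
  have 2: "diff_monotone n ((back_diff k h ^^ b) ((coord_shift k h ^^ a) f))" for a b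
    by (induction b) (use 1 Suc.prems h in \<open>auto intro: diff_monotone_back_diff\<close>)
  show ?case using Suc 2 by simp
qed simp

text \<open>The numbers \<open>(\<Prod>i<k. N choose l i) * bernstein_diff N h k l f s\<close> are weights on the grid points \<open>l\<close> whose
factorial moments are the values of \<open>f\<close> on the grid. Each coordinate contributes one application of
the one-dimensional identity to a function of the remaining ones.\<close>

lemma bernstein_moment:
  "(\<And>i. i < k \<Longrightarrow> j i \<le> N) \<Longrightarrow>
   (\<Sum>l\<in>PiE {..<k} (\<lambda>_. {..N}). (\<Prod>i<k. real (N choose l i) * (real (l i choose j i) / real (N choose j i))) *
      bernstein_diff N h k l f s) = f (\<lambda>i. if i < k then s i - real (j i) * h else s i)"
proof (induction k arbitrary: f)
  case (Suc k)
  let ?c = "\<lambda>i l. real (N choose l) * (real (l choose j i) / real (N choose j i))"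
  let ?T = "\<lambda>y. (back_diff k h ^^ (N - y)) ((coord_shift k h ^^ y) f)"
  let ?s = "\<lambda>i. if i < k then s i - real (j i) * h else s i"
  have "(\<Sum>l\<in>PiE {..<Suc k} (\<lambda>_. {..N}). (\<Prod>i<Suc k. ?c i (l i)) * bernstein_diff N h (Suc k) l f s)
    = (\<Sum>(y, l)\<in>{..N} \<times> PiE {..<k} (\<lambda>_. {..N}).
        (\<Prod>i<Suc k. ?c i ((l(k := y)) i)) * bernstein_diff N h (Suc k) (l(k := y)) f s)"
  proof -
    have "PiE {..<Suc k} (\<lambda>_. {..N}) = (\<lambda>(y, l). l(k := y)) ` ({..N} \<times> PiE {..<k} (\<lambda>_. {..N}))"
      unfolding lessThan_Suc PiE_insert_eq by simp
    moreover have "inj_on (\<lambda>(y, l). l(k := y)) ({..N} \<times> PiE {..<k} (\<lambda>_. {..N}))"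
      using inj_combinator[of k "{..<k}" "\<lambda>_. {..N}"] by simp
    ultimately show ?thesis
      by (simp only: sum.reindex) (simp add: case_prod_unfold comp_def)
  qed
  also have "\<dots> = (\<Sum>(y, l)\<in>{..N} \<times> PiE {..<k} (\<lambda>_. {..N}).
        ?c k y * ((\<Prod>i<k. ?c i (l i)) * bernstein_diff N h k l (?T y) s))"
  proof (intro sum.cong refl, clarify)
    fix y l
    have "bernstein_diff N h k (l(k := y)) (?T y) = bernstein_diff N h k l (?T y)"
      by (rule bernstein_diff_cong) simp
    then show "(\<Prod>i<Suc k. ?c i ((l(k := y)) i)) * bernstein_diff N h (Suc k) (l(k := y)) f s
      = ?c k y * ((\<Prod>i<k. ?c i (l i)) * bernstein_diff N h k l (?T y) s)"
      by simp
  qed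
  also have "\<dots> = (\<Sum>y\<le>N. ?c k y * (\<Sum>l\<in>PiE {..<k} (\<lambda>_. {..N}). (\<Prod>i<k. ?c i (l i)) * bernstein_diff N h k l (?T y) s))"
    by (simp add: sum.cartesian_product[symmetric] sum_distrib_left)
  also have "\<dots> = (\<Sum>y\<le>N. ?c k y * ?T y ?s)"
    using Suc by simp
  also have "\<dots> = f (?s(k := ?s k - real (j k) * h))"
    by (rule bernstein_moment_one_coordinate) (use Suc in auto)
  also have "?s(k := ?s k - real (j k) * h) = (\<lambda>i. if i < Suc k then s i - real (j i) * h else s i)"
    by (auto simp: fun_eq_iff)
  finally show ?case .
qed simp

text \<open>Factorial moments approximate ordinary moments: for \<open>j \<le> l\<close> both terms are products of \<open>j\<close> factors that
differ by at most \<open>j / N\<close>, and for \<open>l < j\<close> both are small.\<close>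

lemma binomial_ratio_approx:
  assumes "l \<le> N" "j \<le> N" "0 < N"
  shows "\<bar>real (l choose j) / real (N choose j) - (real l / real N) ^ j\<bar> \<le> real j ^ 2 / real N"
proof (cases "j \<le> l")
  case True
  have "real (l choose j) / real (N choose j) = (\<Prod>i<j. (real l - real i) / (real N - real i))"
    by (simp add: binomial_gbinomial gbinomial_prod_rev prod_dividef atLeast0LessThan)
  moreover have "(real l / real N) ^ j = (\<Prod>i<j. real l / real N)" by simp
  ultimately have "\<bar>real (l choose j) / real (N choose j) - (real l / real N) ^ j\<bar>
     = norm ((\<Prod>i<j. (real l - real i) / (real N - real i)) - (\<Prod>i<j. real l / real N))" by simp
  also have "\<dots> \<le> (\<Sum>i<j. norm ((real l - real i) / (real N - real i) - real l / real N))"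
    by (rule norm_prod_diff) (use True assms in \<open>auto simp: divide_simps\<close>)
  also have "\<dots> \<le> (\<Sum>i<j. real j / real N)"
  proof (rule sum_mono)
    fix i assume i: "i \<in> {..<j}"
    then have p: "0 < real N - real i" "0 < real N" using True assms by auto
    have "(real l - real i) / (real N - real i) - real l / real N = - (real i / real N * ((real N - real l) / (real N - real i)))"
      using p by (simp add: field_simps)
    then have "norm ((real l - real i) / (real N - real i) - real l / real N) = real i / real N * ((real N - real l) / (real N - real i))"
      using p assms by simp
    also have "\<dots> \<le> real j / real N * 1"
      using p i True assms by (intro mult_mono divide_right_mono) auto
    finally show "norm ((real l - real i) / (real N - real i) - real l / real N) \<le> real j / real N" by simp
  qed
  also have "\<dots> = real j ^ 2 / real N" by (simp add: power2_eq_square)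
  finally show ?thesis .
next
  case False
  then have j: "1 \<le> j" "l \<le> j" by auto
  have "(real l / real N) ^ j \<le> (real l / real N) ^ 1"
    using assms j by (intro power_decreasing) auto
  also have "\<dots> \<le> real j / real N" using j by (simp add: divide_right_mono)
  also have "\<dots> \<le> real j ^ 2 / real N"
    using j by (intro divide_right_mono) (auto simp: power2_eq_square)
  finally show ?thesis using False by (simp add: binomial_eq_0)
qed

section \<open>The Bernstein-Hausdorff-Widder theorem in several variables\<close>

lemma space_borel_orthant: "sets \<nu> = sets (borel_orthant n) \<Longrightarrow> space \<nu> = nonneg_orthant n"
  by (drule sets_eq_imp_space_eq) (simp add: space_restrict_space)

lemma powr_dyadic_root:
  fixes y :: real
  assumes "0 \<le> y" "p \<le> k" "1 \<le> q"
  shows "(y ^ (2 ^ k)) powr (real q / 2 ^ p) = y ^ (q * 2 ^ (k - p))"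
proof (cases "y = 0")
  case False
  then have y: "0 < y" using assms by simp
  have "(y ^ (2 ^ k)) powr (real q / 2 ^ p) = (y powr real (2 ^ k)) powr (real q / 2 ^ p)"
    by (simp only: powr_realpow[OF y])
  also have "\<dots> = y powr real (q * 2 ^ (k - p))"
  proof -
    have "(2 :: real) ^ k = 2 ^ (k - p) * 2 ^ p" using assms(2) by (simp flip: power_add)
    then show ?thesis by (simp add: powr_powr mult.commute)
  qed
  also have "\<dots> = y ^ (q * 2 ^ (k - p))" by (simp only: powr_realpow[OF y])
  finally show ?thesis .
next
  case True
  have "0 < q * 2 ^ (k - p)" using assms by simp
  then show ?thesis using True by (simp add: power_0_left)
qed

text \<open>The step of the grid is \<open>2\<^bsup>-k\<^esup>\<close> and the degree is \<open>N = 8\<^sup>k\<close>. A dyadic point \<open>t\<close> is then a grid point with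
index \<open>j = 2\<^sup>k t\<close>, and the error \<open>j\<^sup>2 / N\<close> of replacing factorial moments by powers tends to \<open>0\<close>. Raising
\<open>l / N\<close> to the power \<open>2\<^sup>k\<close> turns \<open>(l / N)\<^sup>j\<close> into \<open>x\<^sup>t\<close>, which does not depend on \<open>k\<close>, so that one limit
measure serves all dyadic \<open>t\<close>. Mass of the limit at points with a vanishing coordinate corresponds to
\<open>u = \<infinity>\<close>; the powers \<open>x\<^sup>t\<close> with \<open>t > 0\<close> do not see it. The shift by \<open>\<delta>\<close> keeps the total mass \<open>f(-\<delta>,\<dots>,-\<delta>)\<close>
finite.\<close>

lemma laplace_representation_dyadic:
  assumes n: "1 \<le> n" and f: "diff_monotone n f" and \<delta>: "0 < \<delta>"
  shows "\<exists>\<nu>. finite_measure \<nu> \<and> sets \<nu> = sets (borel_orthant n) \<and>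
    (\<forall>p q. (\<forall>i<n. 1 \<le> q i) \<longrightarrow>
       f (\<lambda>i\<in>{..<n}. - real (q i) / 2 ^ p - \<delta>) =
       (\<integral>u. exp (dot n (\<lambda>i\<in>{..<n}. - real (q i) / 2 ^ p) u) \<partial>\<nu>))"
proof -
  define b where "b = (\<lambda>i\<in>{..<n}. - \<delta>)"
  define c where "c = f b"
  have b: "b \<in> neg_orthant n" using \<delta> by (auto simp: b_def neg_orthant_def)
  have c0: "0 \<le> c" unfolding c_def by (rule diff_monotone_nonneg[OF f b])
  show ?thesis
  proof (cases "c = 0")
    case True
    have "f (\<lambda>i\<in>{..<n}. - real (q i) / 2 ^ p - \<delta>) = 0" for q p
    proof -
      let ?z = "\<lambda>i\<in>{..<n}. - real (q i) / 2 ^ p - \<delta>"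
      have "0 \<le> real (q i) / 2 ^ p" for i by simp
      then have "- (real (q i) / 2 ^ p) < \<delta>" for i using \<delta> by (smt (verit))
      then have z: "?z \<in> neg_orthant n" by (auto simp: neg_orthant_def)
      have "f ?z \<le> f b"
        by (rule diff_monotone_mono[OF diff_monotone_imp_bernstein[OF f] z b]) (simp add: b_def)
      then show ?thesis using True diff_monotone_nonneg[OF f z] by (simp add: c_def)
    qed
    then show ?thesis
      by (intro exI[of _ "null_measure (borel_orthant n)"] conjI finite_measureI) auto
  next
    case False
    with c0 have c: "0 < c" by simp
    define N where "N k = (8 :: nat) ^ k" for k :: nat
    define h where "h k = (1 :: real) / 2 ^ k" for k :: nat
    define I where "I k = PiE {..<n} (\<lambda>_. {..N k})" for k
    define W where "W k l = (\<Prod>i<n. real (N k choose l i)) * bernstein_diff (N k) (h k) n l f b / c" for k l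
    define x where "x k l i = (real (l i) / real (N k)) ^ (2 ^ k)" for k and l :: "nat \<Rightarrow> nat" and i
    have Npos: "0 < N k" for k by (simp add: N_def)
    have hpos: "0 < h k" for k by (simp add: h_def)
    have finI: "finite (I k)" for k unfolding I_def by (intro finite_PiE) auto
    have lN: "l i \<le> N k" if "l \<in> I k" "i < n" for l i k using that by (auto simp: I_def PiE_iff)
    have moment: "(\<Sum>l\<in>I k. W k l * (\<Prod>i<n. real (l i choose j i) / real (N k choose j i)))
        = f (\<lambda>i. if i < n then b i - real (j i) * h k else b i) / c"
      if "\<And>i. i < n \<Longrightarrow> j i \<le> N k" for j k
    proof -
      have "(\<Sum>l\<in>I k. W k l * (\<Prod>i<n. real (l i choose j i) / real (N k choose j i)))
        = (\<Sum>l\<in>I k. (\<Prod>i<n. real (N k choose l i) * (real (l i choose j i) / real (N k choose j i))) *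
            bernstein_diff (N k) (h k) n l f b) / c"
        unfolding sum_divide_distrib W_def prod.distrib by (intro sum.cong) (auto simp: mult_ac)
      then show ?thesis unfolding I_def using bernstein_moment[of n j "N k" "h k" f b] that by simp
    qed
    have W0: "0 \<le> W k l" for k l
      unfolding W_def using c diff_monotone_nonneg[OF diff_monotone_bernstein_diff[OF hpos f order_refl] b]
      by (intro divide_nonneg_pos mult_nonneg_nonneg prod_nonneg) auto
    have W1: "(\<Sum>l\<in>I k. W k l) = 1" for k
    proof -
      have "(\<lambda>i. if i < n then b i - real 0 * h k else b i) = b" by auto
      then show ?thesis using moment[of "\<lambda>_. 0" k] c by (simp add: c_def)
    qed
    have x01: "0 \<le> x k l i \<and> x k l i \<le> 1" if "l \<in> I k" "i < n" for k l i
      using lN[OF that] Npos[of k] by (auto simp: x_def intro!: power_le_one)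
    obtain r M X where rMX: "strict_mono (r :: nat \<Rightarrow> nat)" "real_distribution M"
      "\<And>i. continuous_on UNIV (X i :: real \<Rightarrow> real)" "\<And>i t. 0 \<le> X i t \<and> X i t \<le> 1"
      "\<And>(h :: (nat \<Rightarrow> real) \<Rightarrow> real) B. continuous_on UNIV (\<lambda>t. h (\<lambda>i. X i t)) \<Longrightarrow> \<forall>y. \<bar>h y\<bar> \<le> B \<Longrightarrow>
       \<forall>y z. (\<forall>i<n. y i = z i) \<longrightarrow> h y = h z \<Longrightarrow>
       (\<lambda>k. \<Sum>l\<in>I (r k). W (r k) l * h (x (r k) l)) \<longlonglongrightarrow> (\<integral>t. h (\<lambda>i. X i t) \<partial>M)"
      apply (rule weighted_points_subsequence[OF n, where I = I and w = W and x = x, OF finI W0 W1 x01])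
        apply assumption
       apply assumption
      subgoal premises p for r M X by (rule p(1)[OF p(2-)])
      done
    interpret M: real_distribution M by (rule rMX)
    have lim: "f (\<lambda>i\<in>{..<n}. - real (q i) / 2 ^ p - \<delta>) = c * (\<integral>t. (\<Prod>i<n. X i t powr (real (q i) / 2 ^ p)) \<partial>M)"
      if q: "\<And>i. i < n \<Longrightarrow> 1 \<le> q i" for p and q :: "nat \<Rightarrow> nat"
    proof -
      define z where "z = (\<lambda>i\<in>{..<n}. - real (q i) / 2 ^ p - \<delta>)"
      \<comment> \<open>Truncation to the cube makes \<open>H\<close> bounded everywhere; it is invisible at the points that occur.\<close>
      define H where "H y = (\<Prod>i<n. max 0 (min 1 (y i)) powr (real (q i) / 2 ^ p))" for y :: "nat \<Rightarrow> real"
      define E where "E k = (\<Sum>i<n. real (q i) ^ 2) * (1 / 2) ^ k" for k :: nat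
      have HX: "H (\<lambda>i. X i t) = (\<Prod>i<n. X i t powr (real (q i) / 2 ^ p))" for t
        unfolding H_def using rMX(4) by (intro prod.cong) auto
      have "(\<lambda>k. \<Sum>l\<in>I (r k). W (r k) l * H (x (r k) l)) \<longlonglongrightarrow> (\<integral>t. H (\<lambda>i. X i t) \<partial>M)"
      proof (rule rMX(5)[where B = 1])
        have "continuous_on UNIV (\<lambda>t. X i t powr (real (q i) / 2 ^ p))" if "i < n" for i
          using q[OF that] rMX(4) by (intro continuous_on_powr' rMX(3) continuous_on_const) auto
        then show "continuous_on UNIV (\<lambda>t. H (\<lambda>i. X i t))"
          unfolding HX by (intro continuous_on_prod) auto
        show "\<forall>y. \<bar>H y\<bar> \<le> 1"
          unfolding H_def abs_prod by (intro allI prod_le_1) (auto intro!: powr_le1)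
        show "\<forall>y y'. (\<forall>i<n. y i = y' i) \<longrightarrow> H y = H y'"
          unfolding H_def by (intro allI impI prod.cong) auto
      qed
      moreover have "(\<lambda>k. \<Sum>l\<in>I k. W k l * H (x k l)) \<longlonglongrightarrow> f z / c"
      proof (rule LIM_zero_cancel, rule tendsto_0_le[where K = 1])
        have "(\<lambda>k. (1 / 2) ^ k :: real) \<longlonglongrightarrow> 0" by (rule LIMSEQ_realpow_zero) auto
        then show "E \<longlonglongrightarrow> 0" unfolding E_def by (rule tendsto_mult_right_zero)
        show "\<forall>\<^sub>F k in sequentially. norm ((\<Sum>l\<in>I k. W k l * H (x k l)) - f z / c) \<le> norm (E k) * 1"
          using eventually_ge_at_top[of "p + (\<Sum>i<n. q i)"]
        proof eventually_elim
          case (elim k)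
          define j where "j i = q i * 2 ^ (k - p)" for i
          have pk: "p \<le> k" using elim by simp
          have jN: "j i \<le> N k" if "i < n" for i
          proof -
            have "q i \<le> (\<Sum>i<n. q i)" using that by (intro member_le_sum) auto
            then have "q i \<le> k" using elim by linarith
            also have "k < 2 ^ k" by (rule less_exp)
            finally have "q i * 2 ^ (k - p) \<le> 2 ^ k * 2 ^ k" by (intro mult_le_mono) auto
            also have "\<dots> = (4::nat) ^ k" by (simp flip: power_mult_distrib)
            also have "\<dots> \<le> N k" unfolding N_def by (rule power_mono) auto
            finally show ?thesis by (simp add: j_def)
          qed
          have jh: "real (j i) * h k = real (q i) / 2 ^ p" for i
          proof -
            have "(2 :: real) ^ k = 2 ^ (k - p) * 2 ^ p" using pk by (simp flip: power_add)
            then show ?thesis by (simp add: j_def h_def)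
          qed
          have fz: "f z / c = (\<Sum>l\<in>I k. W k l * (\<Prod>i<n. real (l i choose j i) / real (N k choose j i)))"
          proof -
            have "(\<lambda>i. if i < n then b i - real (j i) * h k else b i) = z"
              unfolding jh by (auto simp: z_def b_def fun_eq_iff)
            then show ?thesis using moment[of j k, OF jN] by simp
          qed
          have close: "\<bar>H (x k l) - (\<Prod>i<n. real (l i choose j i) / real (N k choose j i))\<bar> \<le> E k" if l: "l \<in> I k" for l
          proof -
            have Hx: "H (x k l) = (\<Prod>i<n. (real (l i) / real (N k)) ^ j i)"
              unfolding H_def
            proof (intro prod.cong refl)
              fix i assume i: "i \<in> {..<n}"
              have "max 0 (min 1 (x k l i)) = x k l i" using x01[OF l] i by auto
              then show "max 0 (min 1 (x k l i)) powr (real (q i) / 2 ^ p) = (real (l i) / real (N k)) ^ j i"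
                unfolding x_def j_def using i q by (simp only: lessThan_iff) (intro powr_dyadic_root pk; simp)
            qed
            have "\<bar>H (x k l) - (\<Prod>i<n. real (l i choose j i) / real (N k choose j i))\<bar>
              \<le> (\<Sum>i<n. norm ((real (l i) / real (N k)) ^ j i - real (l i choose j i) / real (N k choose j i)))"
              unfolding Hx real_norm_def[symmetric]
            proof (rule norm_prod_diff)
              fix i assume i: "i \<in> {..<n}"
              show "norm ((real (l i) / real (N k)) ^ j i) \<le> 1"
                using lN[OF l, of i] i Npos[of k] by (auto simp: norm_power intro!: power_le_one)
              show "norm (real (l i choose j i) / real (N k choose j i)) \<le> 1"
                using binomial_right_mono[OF lN[OF l, of i], of "j i"] i jN[of i] by (simp add: divide_le_eq_1)
            qed
            also have "\<dots> \<le> (\<Sum>i<n. real (q i) ^ 2 * (1 / 2) ^ k)"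
            proof (rule sum_mono)
              fix i assume i: "i \<in> {..<n}"
              have "norm ((real (l i) / real (N k)) ^ j i - real (l i choose j i) / real (N k choose j i)) \<le> real (j i) ^ 2 / real (N k)"
                using binomial_ratio_approx[OF lN[OF l] jN Npos, of i i] i by (simp add: abs_minus_commute)
              also have "\<dots> \<le> (real (q i) * 2 ^ k) ^ 2 / real (N k)"
                unfolding j_def by (intro divide_right_mono power_mono) (auto intro!: mult_left_mono power_increasing)
              also have "\<dots> = real (q i) ^ 2 * (4 ^ k / 8 ^ k)"
                by (simp add: N_def power_mult_distrib power2_eq_square flip: power_mult_distrib)
              also have "4 ^ k / 8 ^ k = ((1 / 2) ^ k :: real)"
                by (simp flip: power_divide)
              finally show "norm ((real (l i) / real (N k)) ^ j i - real (l i choose j i) / real (N k choose j i))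
                 \<le> real (q i) ^ 2 * (1 / 2) ^ k" .
            qed
            also have "\<dots> = E k" by (simp add: E_def sum_distrib_right)
            finally show ?thesis .
          qed
          have "norm ((\<Sum>l\<in>I k. W k l * H (x k l)) - f z / c)
             = \<bar>\<Sum>l\<in>I k. W k l * (H (x k l) - (\<Prod>i<n. real (l i choose j i) / real (N k choose j i)))\<bar>"
            by (simp add: fz right_diff_distrib sum_subtractf)
          also have "\<dots> \<le> (\<Sum>l\<in>I k. \<bar>W k l * (H (x k l) - (\<Prod>i<n. real (l i choose j i) / real (N k choose j i)))\<bar>)"
            by (rule sum_abs)
          also have "\<dots> \<le> (\<Sum>l\<in>I k. W k l * E k)"
            using close W0 by (intro sum_mono) (auto simp: abs_mult intro!: mult_left_mono)
          also have "\<dots> = E k" by (simp add: W1 flip: sum_distrib_right)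
          finally show ?case by simp
        qed
      qed
      then have "(\<lambda>k. \<Sum>l\<in>I (r k). W (r k) l * H (x (r k) l)) \<longlonglongrightarrow> f z / c"
        using LIMSEQ_subseq_LIMSEQ[OF _ rMX(1)] by (force simp: comp_def)
      ultimately have "(\<integral>t. H (\<lambda>i. X i t) \<partial>M) = f z / c" by (rule LIMSEQ_unique)
      then show ?thesis using c by (simp add: HX z_def)
    qed
    define A where "A = {t. \<forall>i<n. 0 < X i t}"
    \<comment> \<open>Where a coordinate vanishes, \<open>ln 0 = 0\<close> makes \<open>U\<close> well defined; the density is zero there.\<close>
    define U where "U t = (\<lambda>i. if i < n then - ln (X i t) else undefined)" for t
    define \<nu> where "\<nu> = distr (density M (\<lambda>t. ennreal (c * indicator A t))) (borel_orthant n) U"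
    have Xm [measurable]: "X i \<in> borel_measurable M" for i
      using borel_measurable_continuous_onI[OF rMX(3)] by simp
    have [measurable]: "A \<in> sets M"
    proof -
      have "A = {t \<in> space M. \<forall>i\<in>{..<n}. 0 < X i t}" by (auto simp: A_def)
      also have "\<dots> \<in> sets M" by measurable
      finally show ?thesis .
    qed
    have Um [measurable]: "U \<in> measurable M (borel_orthant n)"
    proof (rule measurable_restrict_space2)
      show "U \<in> space M \<rightarrow> nonneg_orthant n"
      proof
        fix t
        have "ln (X i t) \<le> 0" for i
          using rMX(4)[of i t] by (cases "X i t = 0") auto
        then show "U t \<in> nonneg_orthant n"
          unfolding U_def nonneg_orthant_def by (intro PiE_I) auto
      qed
      show "U \<in> borel_measurable M"
        unfolding U_def by (rule measurable_coordinatewise_then_product) auto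
    qed
    have "finite_measure (density M (\<lambda>t. ennreal (c * indicator A t)))"
    proof (rule finite_measureI)
      have "(\<integral>\<^sup>+ t. ennreal (c * indicator A t) \<partial>M) \<le> (\<integral>\<^sup>+ t. ennreal c \<partial>M)"
        using c by (intro nn_integral_mono ennreal_leI) (auto simp: indicator_def)
      also have "\<dots> < \<infinity>" by (simp add: ennreal_mult_eq_top_iff less_top[symmetric])
      finally show "emeasure (density M (\<lambda>t. ennreal (c * indicator A t))) (space (density M (\<lambda>t. ennreal (c * indicator A t)))) \<noteq> \<infinity>"
        by (simp add: emeasure_density cong: nn_integral_cong)
    qed
    then have "finite_measure \<nu>"
      unfolding \<nu>_def by (rule finite_measure.finite_measure_distr) simp
    moreover have "sets \<nu> = sets (borel_orthant n)" by (simp add: \<nu>_def)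
    moreover have "f (\<lambda>i\<in>{..<n}. - real (q i) / 2 ^ p - \<delta>) =
       (\<integral>u. exp (dot n (\<lambda>i\<in>{..<n}. - real (q i) / 2 ^ p) u) \<partial>\<nu>)" if q: "\<forall>i<n. 1 \<le> q i" for p q
    proof -
      define s where "s = (\<lambda>i\<in>{..<n}. - real (q i) / 2 ^ p)"
      have [measurable]: "(\<lambda>u. dot n s u) \<in> borel_measurable (borel_orthant n)"
        by (intro borel_measurable_dot orthant_coord_measurable) simp
      have "(\<integral>u. exp (dot n s u) \<partial>\<nu>) = (\<integral>t. c * indicator A t * exp (dot n s (U t)) \<partial>M)"
        unfolding \<nu>_def using c by (subst integral_distr) (auto simp: integral_density)
      also have "\<dots> = (\<integral>t. c * (\<Prod>i<n. X i t powr (real (q i) / 2 ^ p)) \<partial>M)"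
      proof (rule Bochner_Integration.integral_cong[OF refl])
        fix t
        show "c * indicator A t * exp (dot n s (U t)) = c * (\<Prod>i<n. X i t powr (real (q i) / 2 ^ p))"
        proof (cases "t \<in> A")
          case True
          then have "exp (dot n s (U t)) = (\<Prod>i<n. X i t powr (real (q i) / 2 ^ p))"
            unfolding dot_def exp_sum[OF finite_lessThan]
            by (intro prod.cong) (auto simp: A_def U_def powr_def s_def)
          then show ?thesis using True by simp
        next
          case False
          then obtain i where "i < n" "\<not> 0 < X i t" by (auto simp: A_def)
          moreover from this have "X i t = 0" using rMX(4)[of i t] by linarith
          ultimately have "\<exists>i<n. X i t = 0" by blast
          then have "(\<Prod>i<n. X i t powr (real (q i) / 2 ^ p)) = 0" by (intro prod_zero) auto
          then show ?thesis using False by simp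
        qed
      qed
      also have "\<dots> = f (\<lambda>i\<in>{..<n}. - real (q i) / 2 ^ p - \<delta>)"
        using lim q by simp
      finally show ?thesis by (simp add: s_def)
    qed
    ultimately show ?thesis by blast
  qed
qed

lemma dot_translate:
  "dot n (\<lambda>i\<in>{..<n}. s i + c) u = dot n s u + c * (\<Sum>i<n. u i)"
  by (simp add: dot_def distrib_right sum.distrib sum_distrib_left)

lemma integrable_exp_dot:
  assumes \<nu>: "finite_measure \<nu>" "sets \<nu> = sets (borel_orthant n)" and s: "s \<in> neg_orthant n"
  shows "integrable \<nu> (\<lambda>u. exp (dot n s u))"
proof -
  interpret finite_measure \<nu> by fact
  have "dot n s u \<le> 0" if "u \<in> nonneg_orthant n" for u
    using s that unfolding dot_def neg_orthant_def nonneg_orthant_def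
    by (intro sum_nonpos mult_nonpos_nonneg) (auto simp: PiE_iff intro: less_imp_le)
  moreover have "(\<lambda>u. dot n s u) \<in> borel_measurable \<nu>"
    by (intro borel_measurable_dot orthant_coord_measurable[OF \<nu>(2)])
  ultimately show ?thesis
    by (intro integrable_const_bound[where B = 1] AE_I2) (auto simp: space_borel_orthant[OF \<nu>(2)])
qed

text \<open>A monotone function that agrees with a continuous one at all dyadic points agrees with it everywhere.\<close>

lemma laplace_representation_finite:
  assumes n: "1 \<le> n" and f: "diff_monotone n f" and \<delta>: "0 < \<delta>"
  shows "\<exists>\<nu>. finite_measure \<nu> \<and> sets \<nu> = sets (borel_orthant n) \<and>
    (\<forall>s\<in>neg_orthant n. f (\<lambda>i\<in>{..<n}. s i - \<delta>) = (\<integral>u. exp (dot n s u) \<partial>\<nu>))"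
proof -
  obtain \<nu> where \<nu>: "finite_measure \<nu>" "sets \<nu> = sets (borel_orthant n)"
    and dyadic: "\<And>p q. (\<forall>i<n. 1 \<le> q i) \<Longrightarrow> f (\<lambda>i\<in>{..<n}. - real (q i) / 2 ^ p - \<delta>) =
       (\<integral>u. exp (dot n (\<lambda>i\<in>{..<n}. - real (q i) / 2 ^ p) u) \<partial>\<nu>)"
    using laplace_representation_dyadic[OF n f \<delta>] by blast
  interpret L: laplace_integrand n \<nu> "\<lambda>_. 1" "\<lambda>_. 0"
    by unfold_locales
      (use integrable_exp_dot[OF \<nu>] orthant_coord_measurable[OF \<nu>(2)] in
        \<open>auto simp: space_borel_orthant[OF \<nu>(2)] nonneg_orthant_def PiE_iff\<close>)
  have G: "L.G s = (\<integral>u. exp (dot n s u) \<partial>\<nu>)" for s by (simp add: L.G_def)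
  have G_mono: "L.G s \<le> L.G s'" if "s \<in> neg_orthant n" "s' \<in> neg_orthant n" "\<And>i. i < n \<Longrightarrow> s i \<le> s' i" for s s'
    unfolding G using that
    by (intro integral_mono integrable_exp_dot[OF \<nu>])
       (auto simp: space_borel_orthant[OF \<nu>(2)] nonneg_orthant_def PiE_iff intro!: dot_mono)
  have shift_in: "(\<lambda>i\<in>{..<n}. s i - \<delta>) \<in> neg_orthant n" if "s \<in> neg_orthant n" for s
  proof -
    have "s i - \<delta> < 0" if "i < n" for i
      using neg_orthant_less[OF \<open>s \<in> neg_orthant n\<close> that] \<delta> by linarith
    then show ?thesis by (auto simp: neg_orthant_def)
  qed
  have f_mono: "f (\<lambda>i\<in>{..<n}. s i - \<delta>) \<le> f (\<lambda>i\<in>{..<n}. s' i - \<delta>)"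
    if "s \<in> neg_orthant n" "s' \<in> neg_orthant n" "\<And>i. i < n \<Longrightarrow> s i \<le> s' i" for s s'
    by (rule diff_monotone_mono[OF diff_monotone_imp_bernstein[OF f] shift_in shift_in]) (use that in auto)
  have "f (\<lambda>i\<in>{..<n}. s i - \<delta>) = L.G s" if s: "s \<in> neg_orthant n" for s
  proof -
    define \<phi> where "\<phi> e = (\<lambda>i. if i < n then s i + e else undefined)" for e
    have "\<phi> 0 = s" using s by (auto simp: \<phi>_def neg_orthant_def PiE_iff extensional_def fun_eq_iff)
    define e0 where "e0 = Min ((\<lambda>i. - s i) ` {..<n})"
    have e0: "0 < e0"
      using n s by (auto simp: e0_def neg_orthant_less lessThan_empty_iff)
    have s_e0: "s i + e0 \<le> 0" if "i < n" for i
    proof -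
      have "e0 \<le> - s i" unfolding e0_def using that by (intro Min_le) auto
      then show ?thesis by simp
    qed
    have \<phi>_in: "\<phi> e \<in> neg_orthant n" if "e < e0" for e
      using s_e0 that by (auto simp: \<phi>_def neg_orthant_def PiE_iff extensional_def) (meson add_strict_left_mono less_le_trans)
    have between: "L.G (\<phi> (- e)) \<le> f (\<lambda>i\<in>{..<n}. s i - \<delta>) \<and> f (\<lambda>i\<in>{..<n}. s i - \<delta>) \<le> L.G (\<phi> e)"
      if e: "0 < e" "e < e0" for e
    proof -
      obtain p where p: "(1 / 2) ^ p < e" using real_arch_pow_inv[OF e(1), of "1/2"] by auto
      \<comment> \<open>Rounding up gives a dyadic point below \<open>s\<close>, and \<open>q - 1\<close> one above it. Both are within \<open>e\<close>, and \<open>e < e0\<close> leaves room for \<open>q - 1\<close> to be positive.\<close>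
      define q where "q i = nat \<lceil>2 ^ p * - s i\<rceil>" for i
      have q: "2 ^ p * - s i \<le> real (q i)" "real (q i) < 2 ^ p * - s i + 1" if "i < n" for i
        using neg_orthant_less[OF s that] unfolding q_def
        by (auto simp: mult_le_0_iff ceiling_le_iff of_nat_nat le_of_int_ceiling) linarith+
      have low: "s i - e \<le> - real (q i) / 2 ^ p" "- real (q i) / 2 ^ p \<le> s i" if "i < n" for i
        using q[OF that] p by (auto simp: field_simps power_divide)
      have q2: "2 \<le> q i" if "i < n" for i
      proof -
        have "1 < 2 ^ p * e" using p by (simp add: field_simps power_divide)
        also have "\<dots> \<le> 2 ^ p * - s i" using e s_e0[OF that] by (intro mult_left_mono) auto
        finally show ?thesis using q[OF that] by linarith
      qed
      have up: "s i \<le> - real (q i - 1) / 2 ^ p" "- real (q i - 1) / 2 ^ p \<le> s i + e" if "i < n" for i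
        using q[OF that] p q2[OF that] by (auto simp: field_simps power_divide of_nat_diff)
      define a where "a = (\<lambda>i\<in>{..<n}. - real (q i) / 2 ^ p)"
      define b where "b = (\<lambda>i\<in>{..<n}. - real (q i - 1) / 2 ^ p)"
      have ab_eq: "a i = - real (q i) / 2 ^ p" "b i = - real (q i - 1) / 2 ^ p" if "i < n" for i
        using that by (auto simp: a_def b_def)
      have ab: "a \<in> neg_orthant n" "b \<in> neg_orthant n"
        using q2 unfolding a_def b_def by (fastforce simp: neg_orthant_def)+
      have fa: "f (\<lambda>i\<in>{..<n}. a i - \<delta>) = L.G a" "f (\<lambda>i\<in>{..<n}. b i - \<delta>) = L.G b"
        using dyadic[of q p] dyadic[of "\<lambda>i. q i - 1" p] q2
        by (force simp: G a_def b_def cong: restrict_cong)+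
      have "L.G (\<phi> (- e)) \<le> L.G a"
        by (rule G_mono) (use ab \<phi>_in[of "- e"] e e0 low ab_eq in \<open>auto simp: \<phi>_def\<close>)
      also have "\<dots> \<le> f (\<lambda>i\<in>{..<n}. s i - \<delta>)"
        unfolding fa[symmetric] by (rule f_mono) (use ab s low ab_eq in auto)
      finally have 1: "L.G (\<phi> (- e)) \<le> f (\<lambda>i\<in>{..<n}. s i - \<delta>)" .
      have "f (\<lambda>i\<in>{..<n}. s i - \<delta>) \<le> L.G b"
        unfolding fa[symmetric] by (rule f_mono) (use ab s up ab_eq in auto)
      also have "\<dots> \<le> L.G (\<phi> e)"
        by (rule G_mono) (use ab \<phi>_in[of "e"] e up ab_eq in \<open>auto simp: \<phi>_def\<close>)
      finally show ?thesis using 1 by blast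
    qed
    have "continuous_on {..<e0} \<phi>"
    proof (rule continuous_on_coordinatewise_then_product)
      show "continuous_on {..<e0} (\<lambda>e. \<phi> e i)" for i
        by (cases "i < n") (auto simp: \<phi>_def intro!: continuous_intros)
    qed
    then have "continuous_on {..<e0} (\<lambda>e. L.G (\<phi> e))"
      by (rule continuous_on_compose2[OF L.continuous_on_G]) (use \<phi>_in in auto)
    then have "isCont (\<lambda>e. L.G (\<phi> e)) 0"
      using e0 by (auto simp: continuous_on_eq_continuous_at)
    then have lim: "((\<lambda>e. L.G (\<phi> e)) \<longlongrightarrow> L.G s) (at 0)"
      using \<open>\<phi> 0 = s\<close> by (simp add: isCont_def)
    have ev: "\<forall>\<^sub>F e in at_right 0. 0 < e \<and> e < e0"
      using e0 eventually_at_right[OF e0] by blast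
    have "((\<lambda>e. L.G (\<phi> e)) \<longlongrightarrow> L.G s) (at_right 0)"
      using lim by (rule tendsto_within_subset) simp
    then have 1: "f (\<lambda>i\<in>{..<n}. s i - \<delta>) \<le> L.G s"
      by (rule tendsto_lowerbound) (use ev between in \<open>auto elim: eventually_mono\<close>)
    have "((\<lambda>e. L.G (\<phi> e)) \<longlongrightarrow> L.G s) (at_left 0)"
      using lim by (rule tendsto_within_subset) simp
    then have "((\<lambda>e. L.G (\<phi> (- e))) \<longlongrightarrow> L.G s) (at_right 0)"
      by (simp add: filterlim_at_left_to_right)
    then have "L.G s \<le> f (\<lambda>i\<in>{..<n}. s i - \<delta>)"
      by (rule tendsto_upperbound) (use ev between in \<open>auto elim: eventually_mono\<close>)
    with 1 show ?thesis by simp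
  qed
  then show ?thesis using \<nu> by (auto simp: G)
qed

text \<open>The representing measures for different shifts \<open>\<delta>\<close> differ by exponential densities, because Laplace
transforms are unique. Removing the density from the one for \<open>\<delta> = 1\<close> gives a measure that works
everywhere.\<close>

theorem diff_monotone_laplace:
  assumes n: "1 \<le> n" and f: "diff_monotone n f"
  shows "\<exists>\<nu>. sets \<nu> = sets (borel_orthant n) \<and>
    (\<forall>s\<in>neg_orthant n. integrable \<nu> (\<lambda>u. exp (dot n s u)) \<and> f s = (\<integral>u. exp (dot n s u) \<partial>\<nu>))"
proof -
  have "\<forall>\<delta>. \<exists>\<nu>. 0 < \<delta> \<longrightarrow> finite_measure \<nu> \<and> sets \<nu> = sets (borel_orthant n) \<and>
    (\<forall>s\<in>neg_orthant n. f (\<lambda>i\<in>{..<n}. s i - \<delta>) = (\<integral>u. exp (dot n s u) \<partial>\<nu>))"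
    using laplace_representation_finite[OF n f] by blast
  then obtain \<nu> where \<nu>: "\<And>\<delta>. 0 < \<delta> \<Longrightarrow> finite_measure (\<nu> \<delta>)"
    "\<And>\<delta>. 0 < \<delta> \<Longrightarrow> sets (\<nu> \<delta>) = sets (borel_orthant n)"
    "\<And>\<delta> s. 0 < \<delta> \<Longrightarrow> s \<in> neg_orthant n \<Longrightarrow> f (\<lambda>i\<in>{..<n}. s i - \<delta>) = (\<integral>u. exp (dot n s u) \<partial>\<nu> \<delta>)"
    by metis
  define S where "S u = (\<Sum>i<n. u i)" for u :: "nat \<Rightarrow> real"
  have Sm [measurable]: "S \<in> borel_measurable (borel_orthant n)"
    unfolding S_def[abs_def] by (intro borel_measurable_sum orthant_coord_measurable) simp
  have dm [measurable]: "(\<lambda>u. dot n s u) \<in> borel_measurable (borel_orthant n)" for s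
    by (intro borel_measurable_dot orthant_coord_measurable) simp
  define N where "N = density (\<nu> 1) (\<lambda>u. ennreal (exp (S u)))"
  have key: "\<nu> 1 = density (\<nu> \<delta>) (\<lambda>u. ennreal (exp ((\<delta> - 1) * S u)))" if \<delta>: "0 < \<delta>" "\<delta> < 1" for \<delta>
  proof (rule laplace_transform_unique[OF \<nu>(1,2)])
    note [measurable_cong] = \<nu>(2)[OF \<delta>(1)]
    interpret finite_measure "\<nu> \<delta>" by (rule \<nu>) fact
    show "finite_measure (density (\<nu> \<delta>) (\<lambda>u. ennreal (exp ((\<delta> - 1) * S u))))"
    proof (rule finite_measureI)
      have "S u \<ge> 0" if "u \<in> nonneg_orthant n" for u
        using that by (auto simp: S_def nonneg_orthant_def PiE_iff intro!: sum_nonneg)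
      then have "(\<integral>\<^sup>+ u. ennreal (exp ((\<delta> - 1) * S u)) \<partial>\<nu> \<delta>) \<le> (\<integral>\<^sup>+ u. ennreal 1 \<partial>\<nu> \<delta>)"
        using \<delta> by (intro nn_integral_mono ennreal_leI)
          (auto simp: space_borel_orthant[OF \<nu>(2)] mult_nonpos_nonneg)
      also have "\<dots> < \<infinity>" by (simp add: emeasure_finite less_top[symmetric])
      finally show "emeasure (density (\<nu> \<delta>) (\<lambda>u. ennreal (exp ((\<delta> - 1) * S u))))
          (space (density (\<nu> \<delta>) (\<lambda>u. ennreal (exp ((\<delta> - 1) * S u))))) \<noteq> \<infinity>"
        by (simp add: emeasure_density cong: nn_integral_cong)
    qed
    show "sets (density (\<nu> \<delta>) (\<lambda>u. ennreal (exp ((\<delta> - 1) * S u)))) = sets (borel_orthant n)"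
      using \<nu>(2)[OF \<delta>(1)] by simp
    fix s assume s: "s \<in> neg_orthant n"
    let ?s = "\<lambda>i\<in>{..<n}. s i + (\<delta> - 1)"
    have s': "?s \<in> neg_orthant n"
      using s \<delta> by (auto simp: neg_orthant_def PiE_iff intro: add_neg_neg)
    have "(\<integral>u. exp (dot n s u) \<partial>\<nu> 1) = f (\<lambda>i\<in>{..<n}. s i - 1)"
      using \<nu>(3)[OF _ s, of 1] by simp
    also have "(\<lambda>i\<in>{..<n}. s i - 1) = (\<lambda>i\<in>{..<n}. ?s i - \<delta>)" by (auto simp: fun_eq_iff)
    also have "f \<dots> = (\<integral>u. exp (dot n ?s u) \<partial>\<nu> \<delta>)" by (rule \<nu>(3)[OF \<delta>(1) s'])
    also have "\<dots> = (\<integral>u. exp (dot n s u) \<partial>density (\<nu> \<delta>) (\<lambda>u. ennreal (exp ((\<delta> - 1) * S u))))"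
      by (subst integral_density) (auto simp: dot_translate exp_add mult.commute simp flip: S_def)
    finally show "(\<integral>u. exp (dot n s u) \<partial>\<nu> 1) = (\<integral>u. exp (dot n s u) \<partial>density (\<nu> \<delta>) (\<lambda>u. ennreal (exp ((\<delta> - 1) * S u))))" .
  qed auto
  have "integrable N (\<lambda>u. exp (dot n s u)) \<and> f s = (\<integral>u. exp (dot n s u) \<partial>N)" if s: "s \<in> neg_orthant n" for s
  proof -
    define \<delta> where "\<delta> = min 1 (Min ((\<lambda>i. - s i) ` {..<n})) / 2"
    have \<delta>: "0 < \<delta>" "\<delta> < 1"
      using n s by (auto simp: \<delta>_def neg_orthant_less lessThan_empty_iff)
    have s\<delta>: "s i + \<delta> < 0" if "i < n" for i
    proof -
      have "Min ((\<lambda>i. - s i) ` {..<n}) \<le> - s i" using that by (intro Min_le) auto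
      moreover have "2 * \<delta> \<le> Min ((\<lambda>i. - s i) ` {..<n})" by (simp add: \<delta>_def)
      ultimately show ?thesis using \<delta> by linarith
    qed
    let ?s = "\<lambda>i\<in>{..<n}. s i + \<delta>"
    have s': "?s \<in> neg_orthant n" using s\<delta> by (auto simp: neg_orthant_def)
    note [measurable_cong] = \<nu>(2)[OF \<delta>(1)]
    have "(\<lambda>u. ennreal (exp ((\<delta> - 1) * S u)) * ennreal (exp (S u))) = (\<lambda>u. ennreal (exp (\<delta> * S u)))"
      by (auto simp: fun_eq_iff algebra_simps simp flip: ennreal_mult exp_add)
    then have N: "N = density (\<nu> \<delta>) (\<lambda>u. ennreal (exp (\<delta> * S u)))"
      unfolding N_def key[OF \<delta>] by (subst density_density_eq) auto
    have e: "exp (\<delta> * S u) * exp (dot n s u) = exp (dot n ?s u)" for u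
      by (simp add: dot_translate S_def exp_add)
    have sback: "(\<lambda>i\<in>{..<n}. ?s i - \<delta>) = s"
      using s by (auto simp: neg_orthant_def PiE_iff extensional_def fun_eq_iff)
    have "integrable N (\<lambda>u. exp (dot n s u))"
      unfolding N by (subst integrable_density) (auto simp: e integrable_exp_dot[OF \<nu>(1,2)[OF \<delta>(1)] s'])
    moreover have "(\<integral>u. exp (dot n s u) \<partial>N) = f s"
      unfolding N using \<nu>(3)[OF \<delta>(1) s', unfolded sback] by (subst integral_density) (auto simp: e)
    ultimately show ?thesis by simp
  qed
  moreover have "sets N = sets (borel_orthant n)" using \<nu>(2)[of 1] by (simp add: N_def)
  ultimately show ?thesis by blast
qed

theorem diff_monotone_iff_absolutely_monotone:
  assumes "1 \<le> n"
  shows "diff_monotone n f \<longleftrightarrow> absolutely_monotone n f"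
proof
  assume "diff_monotone n f"
  then obtain \<nu> where \<nu>: "sets \<nu> = sets (borel_orthant n)"
    "\<And>s. s \<in> neg_orthant n \<Longrightarrow> integrable \<nu> (\<lambda>u. exp (dot n s u))"
    "\<And>s. s \<in> neg_orthant n \<Longrightarrow> f s = (\<integral>u. exp (dot n s u) \<partial>\<nu>)"
    using diff_monotone_laplace[OF assms] by metis
  show "absolutely_monotone n f"
    by (rule laplace_transform_absolutely_monotone[OF orthant_coord_measurable[OF \<nu>(1)] _ \<nu>(2,3)])
       (auto simp: space_borel_orthant[OF \<nu>(1)] nonneg_orthant_def PiE_iff)
qed (rule absolutely_monotone_imp_diff_monotone)

section \<open>Locally finite measures on the punctured orthant\<close>

abbreviation (input) punctured_orthant :: "nat \<Rightarrow> (nat \<Rightarrow> real) set" where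
  "punctured_orthant n \<equiv> nonneg_orthant n - {origin n}"

abbreviation (input) borel_punctured :: "nat \<Rightarrow> (nat \<Rightarrow> real) measure" where
  "borel_punctured n \<equiv> restrict_space borel (punctured_orthant n)"

lemma space_borel_punctured: "sets \<mu> = sets (borel_punctured n) \<Longrightarrow> space \<mu> = punctured_orthant n"
  by (drule sets_eq_imp_space_eq) (simp add: space_restrict_space)

lemma punctured_orthant_borel [measurable]: "punctured_orthant n \<in> sets borel"
  by (intro sets.Diff nonneg_orthant_borel) auto

lemma origin_in_orthant: "origin n \<in> nonneg_orthant n"
  by (auto simp: origin_def nonneg_orthant_def)

lemma dot_origin [simp]: "dot n s (origin n) = 0"
  by (simp add: dot_def origin_def)

lemma punctured_orthant_pos:
  assumes "u \<in> punctured_orthant n"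
  obtains i where "i < n" "0 < u i"
proof -
  have "\<exists>i<n. u i \<noteq> 0"
  proof (rule ccontr)
    assume "\<not> ?thesis"
    then have "u = origin n"
      using assms by (auto simp: origin_def nonneg_orthant_def PiE_iff extensional_def fun_eq_iff)
    then show False using assms by simp
  qed
  then show ?thesis using that assms by (force simp: nonneg_orthant_def PiE_iff)
qed

text \<open>An exponential density makes the measures finite and shifts their transforms.\<close>

lemma laplace_transform_unique_locally_finite:
  assumes M: "sets M = sets (borel_orthant n)" and N: "sets N = sets (borel_orthant n)"
    and intM: "\<And>s. s \<in> neg_orthant n \<Longrightarrow> integrable M (\<lambda>u. exp (dot n s u))"
    and intN: "\<And>s. s \<in> neg_orthant n \<Longrightarrow> integrable N (\<lambda>u. exp (dot n s u))"
    and eq: "\<And>s. s \<in> neg_orthant n \<Longrightarrow> (\<integral>u. exp (dot n s u) \<partial>M) = (\<integral>u. exp (dot n s u) \<partial>N)"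
  shows "M = N"
proof -
  define b where "b = (\<lambda>i\<in>{..<n}. - 1 :: real)"
  have b: "b \<in> neg_orthant n" by (auto simp: b_def neg_orthant_def)
  have dm [measurable]: "(\<lambda>u. dot n s u) \<in> borel_measurable (borel_orthant n)" for s
    by (intro borel_measurable_dot orthant_coord_measurable) simp
  define D where "D L = density L (\<lambda>u. ennreal (exp (dot n b u)))" for L
  have fin: "finite_measure (D L)" if L: "sets L = sets (borel_orthant n)" and "integrable L (\<lambda>u. exp (dot n b u))" for L
  proof (rule finite_measureI)
    note [measurable_cong] = L
    have "(\<integral>\<^sup>+ u. ennreal (exp (dot n b u)) \<partial>L) < \<infinity>"
      using that(2) by (simp add: integrable_iff_bounded)
    then show "emeasure (D L) (space (D L)) \<noteq> \<infinity>"
      by (simp add: D_def emeasure_density cong: nn_integral_cong)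
  qed
  have lap: "(\<integral>u. exp (dot n s u) \<partial>D L) = (\<integral>u. exp (dot n (\<lambda>i\<in>{..<n}. s i - 1) u) \<partial>L)"
    if L: "sets L = sets (borel_orthant n)" for L s
  proof -
    note [measurable_cong] = L
    have "exp (dot n b u) * exp (dot n s u) = exp (dot n (\<lambda>i\<in>{..<n}. s i - 1) u)" for u
      by (simp add: b_def dot_def algebra_simps sum_subtractf sum_negf flip: exp_add)
    then show ?thesis
      unfolding D_def by (subst integral_density) auto
  qed
  have "D M = D N"
  proof (rule laplace_transform_unique)
    fix s assume s: "s \<in> neg_orthant n"
    have "(\<lambda>i\<in>{..<n}. s i - 1) \<in> neg_orthant n"
      using neg_orthant_less[OF s] by (fastforce simp: neg_orthant_def)
    then show "(\<integral>u. exp (dot n s u) \<partial>D M) = (\<integral>u. exp (dot n s u) \<partial>D N)"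
      by (simp add: lap M N eq)
  qed (use fin M N intM[OF b] intN[OF b] in \<open>auto simp: D_def\<close>)
  moreover have "L = density (D L) (\<lambda>u. ennreal (exp (- dot n b u)))" if L: "sets L = sets (borel_orthant n)" for L
  proof -
    note [measurable_cong] = L
    have "density (D L) (\<lambda>u. ennreal (exp (- dot n b u))) = density L (\<lambda>u. 1)"
      unfolding D_def by (subst density_density_eq) (auto simp flip: ennreal_mult exp_add)
    then show ?thesis by (simp add: density_1)
  qed
  ultimately show ?thesis using M N by metis
qed

text \<open>Nonnegativity makes \<open>\<kappa>\<close> monotone, which excludes the pathological solutions of Cauchy's equation.\<close>

lemma additive_nonneg_imp_linear:
  fixes \<kappa> :: "real \<Rightarrow> real"
  assumes nonneg: "\<And>x. 0 < x \<Longrightarrow> 0 \<le> \<kappa> x"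
    and add: "\<And>x y. 0 < x \<Longrightarrow> 0 < y \<Longrightarrow> \<kappa> (x + y) = \<kappa> x + \<kappa> y"
    and x: "0 < x"
  shows "\<kappa> x = x * \<kappa> 1"
proof -
  have mono: "\<kappa> y \<le> \<kappa> z" if "0 < y" "y \<le> z" for y z
    using that nonneg[of "z - y"] add[of y "z - y"] by (cases "y = z") auto
  have mult: "\<kappa> (real (Suc k) * y) = real (Suc k) * \<kappa> y" if "0 < y" for k y
  proof (induction k)
    case (Suc k)
    have "\<kappa> (real (Suc (Suc k)) * y) = \<kappa> (real (Suc k) * y + y)" by (simp add: algebra_simps)
    also have "\<dots> = \<kappa> (real (Suc k) * y) + \<kappa> y"
      using that by (intro add) auto
    also have "\<dots> = real (Suc k) * \<kappa> y + \<kappa> y" by (simp only: Suc.IH)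
    finally show ?case by (simp add: algebra_simps)
  qed simp
  have bound: "real (Suc k) * \<bar>\<kappa> x - x * \<kappa> 1\<bar> \<le> \<kappa> 1" for k
  proof -
    define y where "y = real (Suc k) * x"
    define m where "m = nat \<lfloor>y\<rfloor>"
    have y: "0 < y" using x by (simp add: y_def)
    have m: "real m \<le> y" "y \<le> real (Suc m)" using y unfolding m_def by (simp_all add: of_nat_nat) linarith
    have "\<kappa> y \<le> \<kappa> (real (Suc m) * 1)" using m y by (intro mono) auto
    then have u: "\<kappa> y \<le> real (Suc m) * \<kappa> 1" by (subst (asm) mult) auto
    have l: "real m * \<kappa> 1 \<le> \<kappa> y"
    proof (cases m)
      case 0
      then show ?thesis using nonneg[OF y] by simp
    next
      case (Suc k')
      then have "\<kappa> (real (Suc k') * 1) \<le> \<kappa> y" using m by (intro mono) auto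
      then show ?thesis unfolding Suc by (subst (asm) mult) auto
    qed
    have "real m * \<kappa> 1 \<le> y * \<kappa> 1" "y * \<kappa> 1 \<le> real (Suc m) * \<kappa> 1"
      using m nonneg[of 1] by (auto intro!: mult_right_mono)
    then have "\<bar>\<kappa> y - y * \<kappa> 1\<bar> \<le> \<kappa> 1" using u l by (simp add: algebra_simps abs_le_iff)
    moreover have "\<kappa> y - y * \<kappa> 1 = real (Suc k) * (\<kappa> x - x * \<kappa> 1)"
      unfolding y_def mult[OF x] by (simp add: algebra_simps)
    ultimately show ?thesis by (simp add: abs_mult)
  qed
  show ?thesis
  proof (rule ccontr)
    assume "\<not> ?thesis"
    then have "0 < \<bar>\<kappa> x - x * \<kappa> 1\<bar>" by simp
    then obtain k where "\<kappa> 1 < real k * \<bar>\<kappa> x - x * \<kappa> 1\<bar>" using reals_Archimedean3 by blast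
    also have "\<dots> \<le> real (Suc k) * \<bar>\<kappa> x - x * \<kappa> 1\<bar>" by (intro mult_right_mono) auto
    finally show False using bound[of k] by simp
  qed
qed

text \<open>The sets \<open>{h \<ge> m}\<close> with \<open>m > 0\<close> have finite measure and exhaust \<open>X\<close>. Every compact subset of \<open>X\<close> lies in
one of them. The restriction of \<open>M\<close> to each of them is a finite Borel measure on a Polish space and hence
inner regular.\<close>

lemma radon_measure_onI:
  fixes X :: "'a :: {second_countable_topology, complete_space} set" and h :: "'a \<Rightarrow> real"
  assumes X [measurable]: "X \<in> sets borel" and M: "sets M = sets (restrict_space borel X)"
    and h: "continuous_on UNIV h" "\<And>x. x \<in> X \<Longrightarrow> 0 < h x"
    and int: "(\<integral>\<^sup>+ x. ennreal (h x) \<partial>M) < \<infinity>"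
  shows "radon_measure_on X M"
proof -
  note [measurable_cong] = M
  have hm [measurable]: "h \<in> borel_measurable borel" using h(1) by (rule borel_measurable_continuous_onI)
  have [measurable]: "h \<in> borel_measurable M"
    by (subst measurable_cong_sets[OF M refl]) (rule measurable_restrict_space1[OF hm])
  have spM: "space M = X" using sets_eq_imp_space_eq[OF M] by (simp add: space_restrict_space)
  have setsM: "A \<in> sets M \<longleftrightarrow> A \<subseteq> X \<and> A \<in> sets borel" for A
    unfolding M by (subst sets_restrict_space_iff) auto
  define L where "L m = {x \<in> X. m \<le> h x}" for m
  have Lb [measurable]: "L m \<in> sets borel" for m
  proof -
    have "L m = X \<inter> {x \<in> space borel. m \<le> h x}" by (auto simp: L_def)
    also have "\<dots> \<in> sets borel" by measurable
    finally show ?thesis .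
  qed
  have Lm [measurable]: "L m \<in> sets M" for m using Lb by (auto simp: setsM L_def)
  have Lfin: "emeasure M (L m) < \<infinity>" if "0 < m" for m
  proof -
    have "emeasure M (L m) \<le> (\<integral>\<^sup>+ x. ennreal (1 / m) * ennreal (h x) \<partial>M)"
    proof -
      have "emeasure M (L m) = (\<integral>\<^sup>+ x. indicator (L m) x \<partial>M)" by simp
      also have "\<dots> \<le> (\<integral>\<^sup>+ x. ennreal (1 / m) * ennreal (h x) \<partial>M)"
      proof (rule nn_integral_mono)
        fix x assume "x \<in> space M"
        show "indicator (L m) x \<le> ennreal (1 / m) * ennreal (h x)"
        proof (cases "x \<in> L m")
          case True
          then have "1 \<le> (1 / m) * h x" using that by (simp add: L_def)
          then have "ennreal 1 \<le> ennreal ((1 / m) * h x)" by (rule ennreal_leI)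
          moreover have "ennreal ((1 / m) * h x) = ennreal (1 / m) * ennreal (h x)"
            using that by (intro ennreal_mult') simp
          moreover have "indicator (L m) x = ennreal 1" using True by simp
          ultimately show ?thesis by (simp only:)
        qed simp
      qed
      finally show ?thesis .
    qed
    also have "\<dots> = ennreal (1 / m) * (\<integral>\<^sup>+ x. ennreal (h x) \<partial>M)" by (rule nn_integral_cmult) simp
    also have "\<dots> < \<infinity>" using int by (simp add: ennreal_mult_less_top)
    finally show ?thesis .
  qed
  show ?thesis
    unfolding radon_measure_on_def
  proof (intro conjI allI impI ballI M)
    fix K assume K: "compact K \<and> K \<subseteq> X"
    show "emeasure M K < \<infinity>"
    proof (cases "K = {}")
      case False
      obtain x where x: "x \<in> K" "\<And>y. y \<in> K \<Longrightarrow> h x \<le> h y"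
        using continuous_attains_inf[of K h] K False continuous_on_subset[OF h(1)] by blast
      have "K \<subseteq> L (h x)" using x K by (auto simp: L_def)
      then have "emeasure M K \<le> emeasure M (L (h x))" by (rule emeasure_mono) simp
      also have "\<dots> < \<infinity>" using x K h(2) by (intro Lfin) auto
      finally show ?thesis .
    qed simp
  next
    fix A assume A: "A \<in> sets M"
    show "emeasure M A = (SUP K\<in>{K. compact K \<and> K \<subseteq> A}. emeasure M K)"
    proof (rule antisym)
      define B where "B k = A \<inter> L (1 / real (Suc k))" for k
      have Bm: "B k \<in> sets M" for k using A by (auto simp: B_def)
      have "incseq B"
      proof (rule incseq_SucI)
        fix k
        have "1 / real (Suc (Suc k)) \<le> 1 / real (Suc k)" by (simp add: field_simps)
        then show "B k \<subseteq> B (Suc k)" by (auto simp: B_def L_def intro: order_trans)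
      qed
      moreover have "(\<Union>k. B k) = A"
      proof -
        have "\<exists>k. x \<in> B k" if "x \<in> A" for x
        proof -
          have "x \<in> X" using A that by (auto simp: setsM)
          then obtain k where "1 / real (Suc k) < h x" using h(2) nat_approx_posE by blast
          then show ?thesis using that \<open>x \<in> X\<close> by (auto simp: B_def L_def intro!: exI[of _ k])
        qed
        then show ?thesis by (auto simp: B_def)
      qed
      moreover have "range B \<subseteq> sets M" using Bm by auto
      ultimately have "emeasure M A = (SUP k. emeasure M (B k))"
        using SUP_emeasure_incseq[of B M] by simp
      also have "\<dots> \<le> (SUP K\<in>{K. compact K \<and> K \<subseteq> A}. emeasure M K)"
      proof (rule SUP_least)
        fix k
        define P where "P = distr (density M (indicator (L (1 / real (Suc k))))) borel (\<lambda>x. x)"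
        have idm: "(\<lambda>x. x) \<in> measurable M borel"
          by (subst measurable_cong_sets[OF M refl]) (auto intro: measurable_restrict_space1)
        have P: "emeasure P C = emeasure M (C \<inter> L (1 / real (Suc k)))" if "C \<in> sets borel" for C
        proof -
          have C: "C \<inter> X \<in> sets M" using that by (auto simp: setsM)
          have "emeasure P C = emeasure (density M (indicator (L (1 / real (Suc k))))) (C \<inter> X)"
            unfolding P_def using idm that by (subst emeasure_distr) (auto simp: spM)
          also have "\<dots> = (\<integral>\<^sup>+ x. indicator (L (1 / real (Suc k))) x * indicator (C \<inter> X) x \<partial>M)"
            using C by (subst emeasure_density) auto
          also have "\<dots> = (\<integral>\<^sup>+ x. indicator (C \<inter> L (1 / real (Suc k))) x \<partial>M)"
            by (intro nn_integral_cong) (auto simp: indicator_def L_def)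
          also have "\<dots> = emeasure M (C \<inter> L (1 / real (Suc k)))"
            using that by (intro nn_integral_indicator) (auto simp: setsM L_def)
          finally show ?thesis .
        qed
        have "emeasure P (space P) \<noteq> \<infinity>"
          using P[of UNIV] Lfin[of "1 / real (Suc k)"] by (simp add: P_def)
        moreover have Bb: "B k \<in> sets borel" using Bm setsM by blast
        ultimately have "emeasure P (B k) = (SUP K\<in>{K. K \<subseteq> B k \<and> compact K}. emeasure P K)"
          by (intro inner_regular) (auto simp: P_def)
        also have "\<dots> \<le> (SUP K\<in>{K. compact K \<and> K \<subseteq> A}. emeasure M K)"
        proof (rule SUP_mono, clarify)
          fix K assume K: "K \<subseteq> B k" "compact K"
          have "emeasure P K = emeasure M K"
            using P[of K] K by (simp add: borel_compact B_def inf.absorb1)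
          moreover have "K \<subseteq> A" using K by (auto simp: B_def)
          ultimately show "\<exists>m\<in>{K. compact K \<and> K \<subseteq> A}. emeasure P K \<le> emeasure M m"
            using K by (intro bexI[of _ K]) auto
        qed
        also have "emeasure P (B k) = emeasure M (B k)"
          using P[OF Bb] by (simp add: B_def inf.assoc)
        finally show "emeasure M (B k) \<le> (SUP K\<in>{K. compact K \<and> K \<subseteq> A}. emeasure M K)" .
      qed
      finally show "emeasure M A \<le> (SUP K\<in>{K. compact K \<and> K \<subseteq> A}. emeasure M K)" .
      show "(SUP K\<in>{K. compact K \<and> K \<subseteq> A}. emeasure M K) \<le> emeasure M A"
        using A by (intro SUP_least emeasure_mono) auto
    qed
  qed
qed

section \<open>The Levy-Khintchine representation\<close>

text \<open>The factor by which the operation \<open>f \<mapsto> \<Sum>\<^sub>i (f(s) - f(s - e\<^sub>i))\<close> multiplies \<open>e\<^bsup>s\<cdot>u\<^esup>\<close>. It is positive off the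
origin, so that it can be divided by.\<close>

definition levy_weight :: "nat \<Rightarrow> (nat \<Rightarrow> real) \<Rightarrow> real" where
  "levy_weight n u = (\<Sum>i<n. 1 - exp (- u i))"

lemma levy_weight_pos:
  assumes u: "u \<in> punctured_orthant n"
  shows "0 < levy_weight n u"
proof -
  obtain i where "i < n" "0 < u i" by (rule punctured_orthant_pos[OF u])
  then show ?thesis
    using u
    unfolding levy_weight_def
    by (intro sum_pos2[of _ i]) (auto simp: nonneg_orthant_def PiE_iff)
qed

lemma levy_weight_nonneg: "u \<in> nonneg_orthant n \<Longrightarrow> 0 \<le> levy_weight n u"
  unfolding levy_weight_def by (intro sum_nonneg) (auto simp: nonneg_orthant_def PiE_iff)

lemma levy_weight_borel [measurable]:
  "sets M = sets (restrict_space borel X) \<Longrightarrow> levy_weight n \<in> borel_measurable M"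
  unfolding levy_weight_def[abs_def] using orthant_coord_measurable by measurable

lemma exp_dot_back_diff:
  assumes "i < n"
  shows "exp (dot n s u) - exp (dot n (s(i := s i - h)) u) = exp (dot n s u) * (1 - exp (- (h * u i)))"
  using assms by (simp add: dot_upd algebra_simps flip: exp_add)

text \<open>Differences of the integrals are Laplace transforms of the measures with density
\<^const>\<open>levy_weight\<close>, which determine the measures on the punctured orthant.\<close>

lemma levy_measure_unique:
  assumes M: "sets M = sets (borel_punctured n)"
    and N: "sets N = sets (borel_punctured n)"
    and intM: "\<And>s. s \<in> neg_orthant n \<Longrightarrow> integrable M (\<lambda>u. exp (dot n s u) - 1)"
    and intN: "\<And>s. s \<in> neg_orthant n \<Longrightarrow> integrable N (\<lambda>u. exp (dot n s u) - 1)"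
    and eq: "\<And>s. s \<in> neg_orthant n \<Longrightarrow> (\<integral>u. (exp (dot n s u) - 1) \<partial>M) = (\<integral>u. (exp (dot n s u) - 1) \<partial>N)"
  shows "M = N"
proof -
  let ?X = "punctured_orthant n"
  define D where "D L = distr (density L (\<lambda>u. ennreal (levy_weight n u))) (borel_orthant n) (\<lambda>u. u)" for L
  have dm [measurable]: "(\<lambda>u. dot n s u) \<in> borel_measurable (borel_orthant n)" for s
    by (intro borel_measurable_dot orthant_coord_measurable) simp
  have props: "sets (D L) = sets (borel_orthant n)"
    "\<And>s. s \<in> neg_orthant n \<Longrightarrow> integrable (D L) (\<lambda>u. exp (dot n s u))"
    "\<And>s. s \<in> neg_orthant n \<Longrightarrow> (\<integral>u. exp (dot n s u) \<partial>D L) =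
       (\<Sum>i<n. (\<integral>u. (exp (dot n s u) - 1) \<partial>L) - (\<integral>u. (exp (dot n (s(i := s i - 1)) u) - 1) \<partial>L))"
    "\<And>A. A \<in> sets L \<Longrightarrow> emeasure L A = (\<integral>\<^sup>+ u. indicator A u * ennreal (1 / levy_weight n u) \<partial>D L)"
    if L: "sets L = sets (borel_punctured n)"
      and int: "\<And>s. s \<in> neg_orthant n \<Longrightarrow> integrable L (\<lambda>u. exp (dot n s u) - 1)" for L
  proof -
    note [measurable_cong] = L
    have spL: "space L = ?X" by (rule space_borel_punctured[OF L])
    have lw [measurable]: "levy_weight n \<in> borel_measurable L" by (rule levy_weight_borel[OF L])
    have idm [measurable]: "(\<lambda>u. u) \<in> measurable L (borel_orthant n)"
      by (rule measurable_restrict_space2)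
         (auto simp: spL measurable_cong_sets[OF L refl] intro: measurable_restrict_space1)
    have dL [measurable]: "(\<lambda>u. dot n s u) \<in> borel_measurable L" for s
      by (intro borel_measurable_dot orthant_coord_measurable[OF L])
    have w0: "AE u in L. 0 \<le> levy_weight n u" using levy_weight_nonneg by (auto simp: spL)
    show "sets (D L) = sets (borel_orthant n)" by (simp add: D_def)
    fix s assume s: "s \<in> neg_orthant n"
    have down: "s(i := s i - 1) \<in> neg_orthant n" if "i < n" for i
      by (rule neg_orthant_down[OF s that]) simp
    have i1: "integrable L (\<lambda>u. (exp (dot n s u) - 1) - (exp (dot n (s(i := s i - 1)) u) - 1))" if "i < n" for i
      by (intro Bochner_Integration.integrable_diff int s down that)
    have i1': "integrable L (\<lambda>u. exp (dot n s u) - exp (dot n (s(i := s i - 1)) u))" if "i < n" for i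
      using i1[OF that] by simp
    have w: "levy_weight n u * exp (dot n s u) = (\<Sum>i<n. (exp (dot n s u) - 1) - (exp (dot n (s(i := s i - 1)) u) - 1))" for u
      unfolding levy_weight_def sum_distrib_right
      by (intro sum.cong refl) (use exp_dot_back_diff[where h = 1] in \<open>simp add: mult.commute\<close>)
    show "integrable (D L) (\<lambda>u. exp (dot n s u))"
      unfolding D_def by (subst integrable_distr_eq) (auto simp: integrable_density w0 w intro!: i1')
    have "(\<integral>u. exp (dot n s u) \<partial>D L) = (\<integral>u. levy_weight n u * exp (dot n s u) \<partial>L)"
      unfolding D_def by (subst integral_distr) (auto simp: integral_density w0)
    also have "\<dots> = (\<Sum>i<n. (\<integral>u. (exp (dot n s u) - 1) - (exp (dot n (s(i := s i - 1)) u) - 1) \<partial>L))"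
      unfolding w by (rule Bochner_Integration.integral_sum) (rule i1, simp)
    also have "\<dots> = (\<Sum>i<n. (\<integral>u. (exp (dot n s u) - 1) \<partial>L) - (\<integral>u. (exp (dot n (s(i := s i - 1)) u) - 1) \<partial>L))"
      by (intro sum.cong refl Bochner_Integration.integral_diff int s down) simp
    finally show "(\<integral>u. exp (dot n s u) \<partial>D L) =
       (\<Sum>i<n. (\<integral>u. (exp (dot n s u) - 1) \<partial>L) - (\<integral>u. (exp (dot n (s(i := s i - 1)) u) - 1) \<partial>L))" .
  next
    note [measurable_cong] = L
    have spL: "space L = ?X" by (rule space_borel_punctured[OF L])
    have lw [measurable]: "levy_weight n \<in> borel_measurable L" by (rule levy_weight_borel[OF L])
    have lw' [measurable]: "levy_weight n \<in> borel_measurable (borel_orthant n)" by (rule levy_weight_borel) simp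
    have idm [measurable]: "(\<lambda>u. u) \<in> measurable L (borel_orthant n)"
      by (rule measurable_restrict_space2)
         (auto simp: spL measurable_cong_sets[OF L refl] intro: measurable_restrict_space1)
    fix A assume A [measurable]: "A \<in> sets L"
    have "A \<subseteq> ?X \<and> A \<in> sets borel" using A unfolding L by (subst (asm) sets_restrict_space_iff) auto
    then have [measurable]: "A \<in> sets (borel_orthant n)" by (subst sets_restrict_space_iff) auto
    have "(\<integral>\<^sup>+ u. indicator A u * ennreal (1 / levy_weight n u) \<partial>D L) =
      (\<integral>\<^sup>+ u. ennreal (levy_weight n u) * (indicator A u * ennreal (1 / levy_weight n u)) \<partial>L)"
      unfolding D_def by (simp add: nn_integral_distr nn_integral_density)
    also have "\<dots> = (\<integral>\<^sup>+ u. indicator A u \<partial>L)"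
    proof (rule nn_integral_cong)
      fix u assume "u \<in> space L"
      then have "0 < levy_weight n u" by (intro levy_weight_pos) (simp add: spL)
      then show "ennreal (levy_weight n u) * (indicator A u * ennreal (1 / levy_weight n u)) = indicator A u"
        by (auto simp: indicator_def simp flip: ennreal_mult)
    qed
    finally show "emeasure L A = (\<integral>\<^sup>+ u. indicator A u * ennreal (1 / levy_weight n u) \<partial>D L)" by simp
  qed
  have "D M = D N"
  proof (rule laplace_transform_unique_locally_finite)
    fix s assume s: "s \<in> neg_orthant n"
    have "(\<integral>u. exp (dot n s u) \<partial>D M) =
        (\<Sum>i<n. (\<integral>u. (exp (dot n s u) - 1) \<partial>M) - (\<integral>u. (exp (dot n (s(i := s i - 1)) u) - 1) \<partial>M))"
      by (rule props(3)) (use M intM s in auto)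
    also have "\<dots> = (\<Sum>i<n. (\<integral>u. (exp (dot n s u) - 1) \<partial>N) - (\<integral>u. (exp (dot n (s(i := s i - 1)) u) - 1) \<partial>N))"
      by (intro sum.cong refl arg_cong2[where f = "(-)"] eq s neg_orthant_down) auto
    also have "\<dots> = (\<integral>u. exp (dot n s u) \<partial>D N)"
      by (rule props(3)[symmetric]) (use N intN s in auto)
    finally show "(\<integral>u. exp (dot n s u) \<partial>D M) = (\<integral>u. exp (dot n s u) \<partial>D N)" .
  qed (use props(1,2)[OF M intM] props(1,2)[OF N intN] in auto)
  then show ?thesis
    using props(4)[OF M intM] props(4)[OF N intN] M N by (intro measure_eqI) auto
qed

text \<open>The measure \<open>\<rho>\<close> of one difference \<open>\<Delta>\<^bsub>j,h\<^esub>\<psi>\<close> and the measure \<open>\<nu>\<close> of \<open>G = \<Sum>\<^sub>i \<Delta>\<^bsub>i,1\<^esub>\<psi>\<close> are linked by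
\<open>\<Sum>\<^sub>i \<Delta>\<^bsub>i,1\<^esub>\<Delta>\<^bsub>j,h\<^esub>\<psi> = \<Delta>\<^bsub>j,h\<^esub>G\<close>: with the weight \<open>w\<close> of \<^const>\<open>levy_weight\<close>, uniqueness gives
\<open>w \<rho> = (1 - e\<^bsup>-h u\<^sub>j\<^esup>) \<nu>\<close>. Off the origin \<open>\<rho>\<close> therefore has density \<open>1 - e\<^bsup>-h u\<^sub>j\<^esup>\<close> with respect to
\<open>\<mu> = \<nu> / w\<close>, and \<open>\<kappa> j h\<close> is its atom at the origin.\<close>

lemma levy_measure_of_differences:
  assumes n: "1 \<le> n" and \<psi>: "diff_bernstein n \<psi>"
  shows "\<exists>\<mu> \<kappa>. sets \<mu> = sets (borel_punctured n) \<and>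
    (\<forall>j<n. \<forall>h>0. 0 \<le> \<kappa> j h \<and> (\<forall>s\<in>neg_orthant n.
       integrable \<mu> (\<lambda>u. exp (dot n s u) - exp (dot n (s(j := s j - h)) u)) \<and>
       back_diff j h \<psi> s = \<kappa> j h + (\<integral>u. (exp (dot n s u) - exp (dot n (s(j := s j - h)) u)) \<partial>\<mu>)))"
proof -
  let ?X = "punctured_orthant n"
  define G where "G s = (\<Sum>i<n. back_diff i 1 \<psi> s)" for s
  have dG: "diff_monotone n G"
    unfolding G_def[abs_def] using \<psi> by (intro diff_monotone_sum) (auto simp: diff_bernstein_def)
  obtain \<nu> where \<nu>: "sets \<nu> = sets (borel_orthant n)"
      "\<And>s. s \<in> neg_orthant n \<Longrightarrow> integrable \<nu> (\<lambda>u. exp (dot n s u))"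
      "\<And>s. s \<in> neg_orthant n \<Longrightarrow> G s = (\<integral>u. exp (dot n s u) \<partial>\<nu>)"
    using diff_monotone_laplace[OF n dG] by metis
  note [measurable_cong] = \<nu>(1)
  have Xm [measurable]: "?X \<in> sets \<nu>"
    unfolding \<nu>(1) by (subst sets_restrict_space_iff) auto
  have [measurable]: "levy_weight n \<in> borel_measurable (borel_orthant n)"
    by (rule levy_weight_borel) simp
  have dm [measurable]: "(\<lambda>u. dot n s u) \<in> borel_measurable (borel_orthant n)" for s
    by (intro borel_measurable_dot orthant_coord_measurable) simp
  have [measurable]: "(\<lambda>u. u i) \<in> borel_measurable (borel_orthant n)" for i
    by (rule orthant_coord_measurable) simp
  define \<mu> where "\<mu> = restrict_space (density \<nu> (\<lambda>u. ennreal (1 / levy_weight n u))) ?X"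
  have sets_\<mu>: "sets \<mu> = sets (borel_punctured n)"
  proof -
    have "sets \<mu> = sets (restrict_space (borel_orthant n) ?X)"
      unfolding \<mu>_def by (rule sets_restrict_space_cong) (simp add: \<nu>(1))
    also have "\<dots> = sets (restrict_space borel (nonneg_orthant n \<inter> ?X))"
      by (rule sets_restrict_restrict_space)
    also have "nonneg_orthant n \<inter> ?X = ?X" by auto
    finally show ?thesis .
  qed
  have sp\<mu>: "space \<mu> = ?X" by (rule space_borel_punctured[OF sets_\<mu>])
  have nn_\<mu>: "(\<integral>\<^sup>+ u. g u \<partial>\<mu>) = (\<integral>\<^sup>+ u. ennreal (1 / levy_weight n u) * (g u * indicator ?X u) \<partial>\<nu>)"
    if [measurable]: "g \<in> borel_measurable (borel_orthant n)" for g
  proof -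
    have "(\<integral>\<^sup>+ u. g u \<partial>\<mu>) = (\<integral>\<^sup>+ u. g u * indicator ?X u \<partial>density \<nu> (\<lambda>u. ennreal (1 / levy_weight n u)))"
      unfolding \<mu>_def by (rule nn_integral_restrict_space) (simp add: \<nu>(1) sets_restrict_space_iff)
    then show ?thesis by (subst (asm) nn_integral_density) auto
  qed
  have exists_\<kappa>: "\<exists>\<kappa>. 0 \<le> \<kappa> \<and> (\<forall>s\<in>neg_orthant n.
       integrable \<mu> (\<lambda>u. exp (dot n s u) - exp (dot n (s(j := s j - h)) u)) \<and>
       back_diff j h \<psi> s = \<kappa> + (\<integral>u. (exp (dot n s u) - exp (dot n (s(j := s j - h)) u)) \<partial>\<mu>))"
    if j: "j < n" and h: "0 < h" for j h
  proof -
    let ?f = "back_diff j h \<psi>"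
    have df: "diff_monotone n ?f" using \<psi> j h by (auto simp: diff_bernstein_def)
    obtain \<rho> where \<rho>: "sets \<rho> = sets (borel_orthant n)"
      "\<And>s. s \<in> neg_orthant n \<Longrightarrow> integrable \<rho> (\<lambda>u. exp (dot n s u))"
      "\<And>s. s \<in> neg_orthant n \<Longrightarrow> ?f s = (\<integral>u. exp (dot n s u) \<partial>\<rho>)"
      using diff_monotone_laplace[OF n df] by metis
    note [measurable_cong] = \<rho>(1)
    have Xm\<rho> [measurable]: "?X \<in> sets \<rho>" using Xm \<nu>(1) \<rho>(1) by simp
    have om [measurable]: "{origin n} \<in> sets \<rho>"
      unfolding \<rho>(1) by (subst sets_restrict_space_iff) (auto simp: origin_in_orthant)
    have sp\<rho>: "space \<rho> = nonneg_orthant n" and sp\<nu>: "space \<nu> = nonneg_orthant n"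
      using space_borel_orthant \<rho>(1) \<nu>(1) by auto
    have uj: "0 \<le> 1 - exp (- (h * u j))" if "u \<in> nonneg_orthant n" for u
      using that j h by (auto simp: nonneg_orthant_def PiE_iff)
    have down: "s(i := s i - k) \<in> neg_orthant n" if "s \<in> neg_orthant n" "i < n" "0 < k" for s i k
      using that by (intro neg_orthant_down) auto
    have density_eq: "density \<rho> (\<lambda>u. ennreal (levy_weight n u)) = density \<nu> (\<lambda>u. ennreal (1 - exp (- (h * u j))))"
    proof (rule laplace_transform_unique_locally_finite)
      have w: "levy_weight n u * exp (dot n s u) = (\<Sum>i<n. exp (dot n s u) - exp (dot n (s(i := s i - 1)) u))" for s u
        unfolding levy_weight_def sum_distrib_right
        by (intro sum.cong refl) (use exp_dot_back_diff[where h = 1] in \<open>simp add: mult.commute\<close>)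
      have w0: "AE u in \<rho>. 0 \<le> levy_weight n u" using levy_weight_nonneg by (auto simp: sp\<rho>)
      have u0: "AE u in \<nu>. 0 \<le> 1 - exp (- (h * u j))" using uj by (auto simp: sp\<nu>)
      have j1: "(1 - exp (- (h * u j))) * exp (dot n s u) = exp (dot n s u) - exp (dot n (s(j := s j - h)) u)" for s u
        using exp_dot_back_diff[OF j] by (simp add: mult.commute)
      fix s assume s: "s \<in> neg_orthant n"
      have i1: "integrable \<rho> (\<lambda>u. exp (dot n s u) - exp (dot n (s(i := s i - 1)) u))" if "i < n" for i
        using s that by (intro Bochner_Integration.integrable_diff \<rho>(2) down) auto
      have i2: "integrable \<nu> (\<lambda>u. exp (dot n s u) - exp (dot n (s(j := s j - h)) u))"
        using s j h by (intro Bochner_Integration.integrable_diff \<nu>(2) down) auto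
      show "integrable (density \<rho> (\<lambda>u. ennreal (levy_weight n u))) (\<lambda>u. exp (dot n s u))"
        by (subst integrable_density) (auto simp: w0 w intro!: i1)
      show "integrable (density \<nu> (\<lambda>u. ennreal (1 - exp (- (h * u j))))) (\<lambda>u. exp (dot n s u))"
        by (subst integrable_density) (use u0 i2 in \<open>auto simp: j1\<close>)
      have "(\<integral>u. exp (dot n s u) \<partial>density \<rho> (\<lambda>u. ennreal (levy_weight n u))) = (\<integral>u. levy_weight n u * exp (dot n s u) \<partial>\<rho>)"
        by (subst integral_density) (auto simp: w0)
      also have "\<dots> = (\<Sum>i<n. (\<integral>u. exp (dot n s u) - exp (dot n (s(i := s i - 1)) u) \<partial>\<rho>))"
        unfolding w by (rule Bochner_Integration.integral_sum) (rule i1, simp)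
      also have "\<dots> = (\<Sum>i<n. ?f s - ?f (s(i := s i - 1)))"
        using s by (intro sum.cong refl) (simp add: \<rho>(2,3) down)
      also have "\<dots> = back_diff j h G s"
      proof -
        have "?f s - ?f (s(i := s i - 1)) = back_diff i 1 \<psi> s - back_diff i 1 \<psi> (s(j := s j - h))" for i
          by (cases "i = j") (auto simp: back_diff_def fun_upd_twist algebra_simps)
        then show ?thesis by (simp add: back_diff_def[of _ _ G] G_def sum_subtractf)
      qed
      also have "\<dots> = (\<integral>u. exp (dot n s u) - exp (dot n (s(j := s j - h)) u) \<partial>\<nu>)"
        unfolding back_diff_def using s j h by (simp add: \<nu>(2,3) down)
      also have "\<dots> = (\<integral>u. exp (dot n s u) \<partial>density \<nu> (\<lambda>u. ennreal (1 - exp (- (h * u j)))))"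
        by (subst integral_density) (use u0 in \<open>auto simp: j1\<close>)
      finally show "(\<integral>u. exp (dot n s u) \<partial>density \<rho> (\<lambda>u. ennreal (levy_weight n u))) =
         (\<integral>u. exp (dot n s u) \<partial>density \<nu> (\<lambda>u. ennreal (1 - exp (- (h * u j)))))" .
    qed (use \<rho>(1) \<nu>(1) in auto)
    have off_origin: "(\<integral>\<^sup>+ u. g u * indicator ?X u \<partial>\<rho>) = (\<integral>\<^sup>+ u. ennreal (1 - exp (- (h * u j))) * g u \<partial>\<mu>)"
      if [measurable]: "g \<in> borel_measurable (borel_orthant n)" for g
    proof -
      have "(\<integral>\<^sup>+ u. g u * indicator ?X u \<partial>\<rho>)
         = (\<integral>\<^sup>+ u. ennreal (levy_weight n u) * (ennreal (1 / levy_weight n u) * (g u * indicator ?X u)) \<partial>\<rho>)"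
      proof (rule nn_integral_cong)
        fix u
        show "g u * indicator ?X u = ennreal (levy_weight n u) * (ennreal (1 / levy_weight n u) * (g u * indicator ?X u))"
        proof (cases "u \<in> ?X")
          case True
          then have "0 < levy_weight n u" by (rule levy_weight_pos)
          then have "ennreal (levy_weight n u) * ennreal (1 / levy_weight n u) = 1"
            by (simp flip: ennreal_mult)
          then show ?thesis by (simp flip: mult.assoc)
        qed simp
      qed
      also have "\<dots> = (\<integral>\<^sup>+ u. ennreal (1 / levy_weight n u) * (g u * indicator ?X u) \<partial>density \<rho> (\<lambda>u. ennreal (levy_weight n u)))"
        by (subst nn_integral_density) auto
      also have "\<dots> = (\<integral>\<^sup>+ u. ennreal (1 - exp (- (h * u j))) * (ennreal (1 / levy_weight n u) * (g u * indicator ?X u)) \<partial>\<nu>)"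
        unfolding density_eq by (subst nn_integral_density) auto
      also have "\<dots> = (\<integral>\<^sup>+ u. ennreal (1 - exp (- (h * u j))) * g u \<partial>\<mu>)"
        by (subst nn_\<mu>) (auto simp: mult_ac)
      finally show ?thesis .
    qed
    define \<kappa> where "\<kappa> = measure \<rho> {origin n}"
    have main: "integrable \<mu> (\<lambda>u. exp (dot n s u) - exp (dot n (s(j := s j - h)) u)) \<and>
       ?f s = \<kappa> + (\<integral>u. (exp (dot n s u) - exp (dot n (s(j := s j - h)) u)) \<partial>\<mu>)" if s: "s \<in> neg_orthant n" for s
    proof -
      let ?g = "\<lambda>u. exp (dot n s u) - exp (dot n (s(j := s j - h)) u)"
      have g: "?g u = (1 - exp (- (h * u j))) * exp (dot n s u)" for u
        using exp_dot_back_diff[OF j] by (simp add: mult.commute)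
      have g0: "0 \<le> ?g u" if "u \<in> nonneg_orthant n" for u
        unfolding g using uj[OF that] by simp
      have gm: "?g \<in> borel_measurable \<mu>"
        by (intro borel_measurable_diff borel_measurable_exp[THEN measurable_compose[rotated]] borel_measurable_dot
            orthant_coord_measurable[OF sets_\<mu>])
      have "ennreal (?f s) = (\<integral>\<^sup>+ u. ennreal (exp (dot n s u)) \<partial>\<rho>)"
        unfolding \<rho>(3)[OF s] by (rule nn_integral_eq_integral[symmetric]) (use \<rho>(2)[OF s] in auto)
      also have "\<dots> = (\<integral>\<^sup>+ u. indicator {origin n} u + ennreal (exp (dot n s u)) * indicator ?X u \<partial>\<rho>)"
        by (rule nn_integral_cong) (auto simp: sp\<rho> indicator_def)
      also have "\<dots> = emeasure \<rho> {origin n} + (\<integral>\<^sup>+ u. ennreal (exp (dot n s u)) * indicator ?X u \<partial>\<rho>)"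
        by (subst nn_integral_add) auto
      also have "(\<integral>\<^sup>+ u. ennreal (exp (dot n s u)) * indicator ?X u \<partial>\<rho>) = (\<integral>\<^sup>+ u. ennreal (?g u) \<partial>\<mu>)"
      proof (subst off_origin)
        show "(\<integral>\<^sup>+ u. ennreal (1 - exp (- (h * u j))) * ennreal (exp (dot n s u)) \<partial>\<mu>) = (\<integral>\<^sup>+ u. ennreal (?g u) \<partial>\<mu>)"
          unfolding g using uj by (intro nn_integral_cong) (auto simp: sp\<mu> ennreal_mult)
      qed simp
      finally have sum: "ennreal (?f s) = emeasure \<rho> {origin n} + (\<integral>\<^sup>+ u. ennreal (?g u) \<partial>\<mu>)" .
      then have fin: "emeasure \<rho> {origin n} < \<infinity>" "(\<integral>\<^sup>+ u. ennreal (?g u) \<partial>\<mu>) < \<infinity>"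
        by (metis ennreal_add_eq_top ennreal_less_top ennreal_neq_top infinity_ennreal_def less_top)+
      have int: "integrable \<mu> ?g"
        by (rule integrableI_nonneg[OF gm _ fin(2)], rule AE_I2, rule g0) (simp add: sp\<mu>)
      have "(\<integral>\<^sup>+ u. ennreal (?g u) \<partial>\<mu>) = ennreal (\<integral>u. ?g u \<partial>\<mu>)"
        by (rule nn_integral_eq_integral[OF int]) (use g0 in \<open>auto simp: sp\<mu>\<close>)
      moreover have "emeasure \<rho> {origin n} = ennreal \<kappa>"
        unfolding \<kappa>_def using fin(1) by (intro emeasure_eq_ennreal_measure) auto
      moreover have i0: "0 \<le> (\<integral>u. ?g u \<partial>\<mu>)" using g0 by (intro integral_nonneg_AE AE_I2) (auto simp: sp\<mu>)
      ultimately have "ennreal (?f s) = ennreal (\<kappa> + (\<integral>u. ?g u \<partial>\<mu>))"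
        using sum by (simp add: \<kappa>_def)
      then have "?f s = \<kappa> + (\<integral>u. ?g u \<partial>\<mu>)"
        using diff_monotone_nonneg[OF df s] i0 by (subst (asm) ennreal_inj) (auto simp: \<kappa>_def)
      with int show ?thesis by blast
    qed
    have "0 \<le> \<kappa>" by (simp add: \<kappa>_def)
    with main show ?thesis by blast
  qed
  define Q where "Q j h k \<longleftrightarrow> (j < n \<and> 0 < h \<longrightarrow> 0 \<le> k \<and> (\<forall>s\<in>neg_orthant n.
       integrable \<mu> (\<lambda>u. exp (dot n s u) - exp (dot n (s(j := s j - h)) u)) \<and>
       back_diff j h \<psi> s = k + (\<integral>u. (exp (dot n s u) - exp (dot n (s(j := s j - h)) u)) \<partial>\<mu>)))" for j h k
  have "\<forall>j h. \<exists>k. Q j h k" unfolding Q_def using exists_\<kappa> by blast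
  then obtain \<kappa> where \<kappa>: "\<And>j h. Q j h (\<kappa> j h)" by metis
  show ?thesis
    by (rule exI[of _ \<mu>], rule exI[of _ \<kappa>]) (use \<kappa> sets_\<mu> in \<open>simp add: Q_def\<close>)
qed

text \<open>The masses \<open>\<kappa> j h\<close> are additive in \<open>h\<close> since consecutive steps in one direction telescope. They are
therefore linear in \<open>h\<close>, and one-coordinate steps add up to arbitrary increments.\<close>

lemma levy_khintchine_increments:
  assumes n: "1 \<le> n" and \<psi>: "diff_bernstein n \<psi>"
  shows "\<exists>\<mu> c. sets \<mu> = sets (borel_punctured n) \<and> (\<forall>i<n. 0 \<le> c i) \<and>
    (\<forall>b\<in>neg_orthant n. \<forall>s\<in>neg_orthant n.
       integrable \<mu> (\<lambda>u. exp (dot n s u) - exp (dot n b u)) \<and>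
       \<psi> s - \<psi> b = dot n c s - dot n c b + (\<integral>u. (exp (dot n s u) - exp (dot n b u)) \<partial>\<mu>))"
proof -
  obtain \<mu> \<kappa> where sets_\<mu>: "sets \<mu> = sets (borel_punctured n)"
    and \<kappa>: "\<And>j h. j < n \<Longrightarrow> 0 < h \<Longrightarrow> 0 \<le> \<kappa> j h"
    and int: "\<And>j h s. j < n \<Longrightarrow> 0 < h \<Longrightarrow> s \<in> neg_orthant n \<Longrightarrow>
       integrable \<mu> (\<lambda>u. exp (dot n s u) - exp (dot n (s(j := s j - h)) u))"
    and diff: "\<And>j h s. j < n \<Longrightarrow> 0 < h \<Longrightarrow> s \<in> neg_orthant n \<Longrightarrow>
       back_diff j h \<psi> s = \<kappa> j h + (\<integral>u. (exp (dot n s u) - exp (dot n (s(j := s j - h)) u)) \<partial>\<mu>)"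
    using levy_measure_of_differences[OF n \<psi>] by (elim exE conjE) (rule that, auto)
  have down: "s(i := s i - k) \<in> neg_orthant n" if "s \<in> neg_orthant n" "i < n" "0 < k" for s i k
    using that by (intro neg_orthant_down) auto
  have lin: "\<kappa> j h = h * \<kappa> j 1" if j: "j < n" and h: "0 < h" for j h
  proof (rule additive_nonneg_imp_linear[of "\<kappa> j"])
    fix x y :: real assume xy: "0 < x" "0 < y"
    define s where "s = (\<lambda>i\<in>{..<n}. - 1 :: real)"
    have s: "s \<in> neg_orthant n" by (auto simp: s_def neg_orthant_def)
    let ?s = "s(j := s j - x)"
    have s': "?s \<in> neg_orthant n" by (rule down[OF s j xy(1)])
    have e: "?s(j := ?s j - y) = s(j := s j - (x + y))" by (simp add: diff_diff_eq)
    have "back_diff j (x + y) \<psi> s = back_diff j x \<psi> s + back_diff j y \<psi> ?s"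
      unfolding back_diff_def e by simp
    moreover have "(\<integral>u. (exp (dot n s u) - exp (dot n (s(j := s j - (x + y))) u)) \<partial>\<mu>) =
       (\<integral>u. (exp (dot n s u) - exp (dot n ?s u)) + (exp (dot n ?s u) - exp (dot n (?s(j := ?s j - y)) u)) \<partial>\<mu>)"
      unfolding e by simp
    moreover have "\<dots> = (\<integral>u. (exp (dot n s u) - exp (dot n ?s u)) \<partial>\<mu>) +
        (\<integral>u. (exp (dot n ?s u) - exp (dot n (?s(j := ?s j - y)) u)) \<partial>\<mu>)"
      by (rule Bochner_Integration.integral_add[OF int[OF j xy(1) s] int[OF j xy(2) s']])
    ultimately show "\<kappa> j (x + y) = \<kappa> j x + \<kappa> j y"
      using diff[OF j _ s, of "x + y"] diff[OF j xy(1) s] diff[OF j xy(2) s'] xy by simp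
  qed (use \<kappa>[OF j] h in auto)
  define c where "c i = \<kappa> i 1" for i
  have step: "integrable \<mu> (\<lambda>u. exp (dot n (s(i := t)) u) - exp (dot n s u)) \<and>
     \<psi> (s(i := t)) - \<psi> s = c i * (t - s i) + (\<integral>u. (exp (dot n (s(i := t)) u) - exp (dot n s u)) \<partial>\<mu>)"
    if s: "s \<in> neg_orthant n" and i: "i < n" and t: "t < 0" for s i t
  proof -
    consider "t = s i" | "t < s i" | "s i < t" by linarith
    then show ?thesis
    proof cases
      case 2
      define h where "h = s i - t"
      have h: "0 < h" "s i - h = t" using 2 by (auto simp: h_def)
      have I: "integrable \<mu> (\<lambda>u. exp (dot n s u) - exp (dot n (s(i := t)) u))"
        using int[OF i h(1) s] h by simp
      have "integrable \<mu> (\<lambda>u. - (exp (dot n s u) - exp (dot n (s(i := t)) u)))"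
        using I by (rule Bochner_Integration.integrable_minus)
      moreover have "(\<integral>u. - (exp (dot n s u) - exp (dot n (s(i := t)) u)) \<partial>\<mu>)
          = - (\<integral>u. exp (dot n s u) - exp (dot n (s(i := t)) u) \<partial>\<mu>)"
        by (rule Bochner_Integration.integral_minus)
      moreover have "\<psi> s - \<psi> (s(i := t)) = h * c i + (\<integral>u. exp (dot n s u) - exp (dot n (s(i := t)) u) \<partial>\<mu>)"
        using diff[OF i h(1) s] h lin[OF i h(1)] by (simp add: back_diff_def c_def)
      ultimately show ?thesis by (simp add: h_def algebra_simps)
    next
      case 3
      define h where "h = t - s i"
      have h: "0 < h" "t - h = s i" using 3 by (auto simp: h_def)
      have s': "s(i := t) \<in> neg_orthant n" by (rule neg_orthant_upd[OF s i t])
      show ?thesis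
        using int[OF i h(1) s'] diff[OF i h(1) s'] h lin[OF i h(1)]
        by (simp add: back_diff_def c_def h_def mult.commute)
    qed simp
  qed
  have "integrable \<mu> (\<lambda>u. exp (dot n s u) - exp (dot n b u)) \<and>
       \<psi> s - \<psi> b = dot n c s - dot n c b + (\<integral>u. (exp (dot n s u) - exp (dot n b u)) \<partial>\<mu>)"
    if b: "b \<in> neg_orthant n" and s: "s \<in> neg_orthant n" for b s
    using s b
  proof (rule neg_orthant_path_induct)
    fix z i
    assume z: "z \<in> neg_orthant n" and i: "i < n"
      and IH: "integrable \<mu> (\<lambda>u. exp (dot n z u) - exp (dot n b u)) \<and>
       \<psi> z - \<psi> b = dot n c z - dot n c b + (\<integral>u. (exp (dot n z u) - exp (dot n b u)) \<partial>\<mu>)"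
    let ?z = "z(i := s i)"
    note st = step[OF z i neg_orthant_less[OF s i]]
    have "integrable \<mu> (\<lambda>u. (exp (dot n ?z u) - exp (dot n z u)) + (exp (dot n z u) - exp (dot n b u)))"
      using st IH by (intro Bochner_Integration.integrable_add) auto
    moreover have "(\<integral>u. (exp (dot n ?z u) - exp (dot n z u)) + (exp (dot n z u) - exp (dot n b u)) \<partial>\<mu>)
       = (\<integral>u. exp (dot n ?z u) - exp (dot n z u) \<partial>\<mu>) + (\<integral>u. exp (dot n z u) - exp (dot n b u) \<partial>\<mu>)"
      using st IH by (intro Bochner_Integration.integral_add) auto
    moreover have "dot n c ?z = dot n c z + c i * (s i - z i)"
      using dot_upd[OF i, of z "s i" c] by (simp add: dot_def mult.commute)
    ultimately show "integrable \<mu> (\<lambda>u. exp (dot n ?z u) - exp (dot n b u)) \<and>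
       \<psi> ?z - \<psi> b = dot n c ?z - dot n c b + (\<integral>u. (exp (dot n ?z u) - exp (dot n b u)) \<partial>\<mu>)"
      using st IH by simp
  qed simp
  moreover have "\<forall>i<n. 0 \<le> c i" using \<kappa> by (simp add: c_def)
  ultimately show ?thesis using sets_\<mu> by blast
qed

definition diag :: "nat \<Rightarrow> real \<Rightarrow> nat \<Rightarrow> real" where
  "diag n t = (\<lambda>i\<in>{..<n}. t)"

lemma diag_in: "t < 0 \<Longrightarrow> diag n t \<in> neg_orthant n"
  by (auto simp: diag_def neg_orthant_def)

lemma diag_apply [simp]: "i < n \<Longrightarrow> diag n t i = t"
  by (simp add: diag_def)

lemma dot_diag: "dot n (diag n t) u = t * (\<Sum>i<n. u i)"
  by (simp add: dot_def sum_distrib_left)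

locale levy_khintchine =
  fixes n :: nat and c0 :: real and c :: "nat \<Rightarrow> real" and \<mu> :: "(nat \<Rightarrow> real) measure"
    and \<psi> :: "(nat \<Rightarrow> real) \<Rightarrow> real"
  assumes n: "1 \<le> n" and drift: "c \<in> nonneg_orthant n"
    and sets: "sets \<mu> = sets (borel_punctured n)"
    and integrable: "s \<in> neg_orthant n \<Longrightarrow> integrable \<mu> (\<lambda>u. exp (dot n s u) - 1)"
    and representation:
      "s \<in> neg_orthant n \<Longrightarrow> \<psi> s = c0 + dot n c s + (\<integral>u. (exp (dot n s u) - 1) \<partial>\<mu>)"

text \<open>As \<open>s \<rightarrow> -0\<close> along the diagonal, \<open>\<psi>(s)\<close> increases and is bounded by \<open>0\<close>. Monotone convergence in the
formula for increments then shows that \<open>1 - e\<^bsup>b\<cdot>u\<^esup>\<close> is integrable and identifies the constant.\<close>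

theorem diff_bernstein_levy_khintchine:
  assumes n: "1 \<le> n" and \<psi>: "diff_bernstein n \<psi>" and neg: "\<And>s. s \<in> neg_orthant n \<Longrightarrow> \<psi> s \<le> 0"
  shows "\<exists>c0 c \<mu>. levy_khintchine n c0 c \<mu> \<psi>"
proof -
  obtain \<mu> c where sets_\<mu>: "sets \<mu> = sets (borel_punctured n)"
    and c: "\<And>i. i < n \<Longrightarrow> 0 \<le> c i"
    and int: "\<And>b s. b \<in> neg_orthant n \<Longrightarrow> s \<in> neg_orthant n \<Longrightarrow>
       integrable \<mu> (\<lambda>u. exp (dot n s u) - exp (dot n b u))"
    and incr: "\<And>b s. b \<in> neg_orthant n \<Longrightarrow> s \<in> neg_orthant n \<Longrightarrow>
       \<psi> s - \<psi> b = dot n c s - dot n c b + (\<integral>u. (exp (dot n s u) - exp (dot n b u)) \<partial>\<mu>)"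
    using levy_khintchine_increments[OF n \<psi>] by (elim exE conjE) (rule that, auto)
  have sp\<mu>: "space \<mu> = punctured_orthant n"
    by (rule space_borel_punctured[OF sets_\<mu>])
  have dm [measurable]: "(\<lambda>u. dot n s u) \<in> borel_measurable \<mu>" for s
    by (intro borel_measurable_dot orthant_coord_measurable[OF sets_\<mu>])
  define z where "z k = diag n (- 1 / real (Suc k))" for k
  have z: "z k \<in> neg_orthant n" for k unfolding z_def by (rule diag_in) simp
  have le: "- 1 / real (Suc k) \<le> - 1 / real (Suc k')" if "k \<le> k'" for k k'
    using that by (simp add: field_simps)
  have "incseq (\<lambda>k. \<psi> (z k))"
  proof (rule incseq_SucI)
    show "\<psi> (z k) \<le> \<psi> (z (Suc k))" for k
      using le[of k "Suc k"] by (intro diff_monotone_mono[OF \<psi> z z]) (auto simp: z_def)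
  qed
  then obtain c0 where c0: "(\<lambda>k. \<psi> (z k)) \<longlonglongrightarrow> c0"
    by (rule incseq_convergent[where B = 0]) (use neg[OF z] in blast)
  have t0: "(\<lambda>k. - 1 / real (Suc k)) \<longlonglongrightarrow> 0"
    using tendsto_minus[OF LIMSEQ_inverse_real_of_nat] by (simp add: divide_inverse)
  have dz: "(\<lambda>k. dot n (z k) u) \<longlonglongrightarrow> 0" for u
    unfolding z_def dot_diag using tendsto_mult_right[OF t0] by (auto intro: tendsto_mult_left_zero[OF t0])
  have dcz: "(\<lambda>k. dot n c (z k)) \<longlonglongrightarrow> 0"
    using dz[of c] by (simp add: dot_def mult.commute)
  define b where "b = z 0"
  have b: "b \<in> neg_orthant n" unfolding b_def by (rule z)
  have lim: "(\<lambda>k. \<integral>u. (exp (dot n (z k) u) - exp (dot n b u)) \<partial>\<mu>) \<longlonglongrightarrow> c0 - \<psi> b - 0 + dot n c b"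
  proof -
    have "(\<integral>u. (exp (dot n (z k) u) - exp (dot n b u)) \<partial>\<mu>) = \<psi> (z k) - \<psi> b - dot n c (z k) + dot n c b" for k
      using incr[OF b z[of k]] by simp
    then show ?thesis by (simp only:) (intro tendsto_intros c0 dcz)
  qed
  have dmono: "dot n (z k) u \<le> dot n (z k') u" if "u \<in> space \<mu>" "k \<le> k'" for k k' u
    using that le[OF that(2)] by (intro dot_mono) (auto simp: z_def sp\<mu> nonneg_orthant_def PiE_iff)
  have mct: "integrable \<mu> (\<lambda>u. 1 - exp (dot n b u))" "(\<integral>u. 1 - exp (dot n b u) \<partial>\<mu>) = c0 - \<psi> b - 0 + dot n c b"
  proof -
    have 1: "AE u in \<mu>. mono (\<lambda>k. exp (dot n (z k) u) - exp (dot n b u))"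
      by (rule AE_I2) (auto simp: mono_def intro!: dmono)
    have 2: "AE u in \<mu>. 0 \<le> exp (dot n (z k) u) - exp (dot n b u)" for k
      by (rule AE_I2) (auto simp: b_def intro!: dmono)
    have 3: "AE u in \<mu>. (\<lambda>k. exp (dot n (z k) u) - exp (dot n b u)) \<longlonglongrightarrow> 1 - exp (dot n b u)"
      using tendsto_diff[OF tendsto_exp[OF dz] tendsto_const] by (intro AE_I2) simp
    show "integrable \<mu> (\<lambda>u. 1 - exp (dot n b u))" "(\<integral>u. 1 - exp (dot n b u) \<partial>\<mu>) = c0 - \<psi> b - 0 + dot n c b"
      by (rule integral_monotone_convergence_nonneg[OF int[OF b z] 1 2 3 lim]; measurable)+
  qed
  have rep: "integrable \<mu> (\<lambda>u. exp (dot n s u) - 1)"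
     "\<psi> s = c0 + dot n c s + (\<integral>u. (exp (dot n s u) - 1) \<partial>\<mu>)" if s: "s \<in> neg_orthant n" for s
  proof -
    have "integrable \<mu> (\<lambda>u. (exp (dot n s u) - exp (dot n b u)) - (1 - exp (dot n b u)))"
      by (rule Bochner_Integration.integrable_diff[OF int[OF b s] mct(1)])
    moreover have "(\<integral>u. (exp (dot n s u) - exp (dot n b u)) - (1 - exp (dot n b u)) \<partial>\<mu>)
       = (\<integral>u. (exp (dot n s u) - exp (dot n b u)) \<partial>\<mu>) - (\<integral>u. 1 - exp (dot n b u) \<partial>\<mu>)"
      by (rule Bochner_Integration.integral_diff[OF int[OF b s] mct(1)])
    ultimately show "integrable \<mu> (\<lambda>u. exp (dot n s u) - 1)"
      "\<psi> s = c0 + dot n c s + (\<integral>u. (exp (dot n s u) - 1) \<partial>\<mu>)"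
      using incr[OF b s] mct(2) by simp_all
  qed
  have dc: "dot n (restrict c {..<n}) s = dot n c s" for s by (simp add: dot_def)
  have "levy_khintchine n c0 (restrict c {..<n}) \<mu> \<psi>"
    by unfold_locales (use n c sets_\<mu> rep in \<open>auto simp: nonneg_orthant_def dc\<close>)
  then show ?thesis by blast
qed

lemma half_open_cube_iff:
  "u \<in> half_open_cube n \<delta> \<longleftrightarrow> u \<in> nonneg_orthant n \<and> (\<forall>i<n. u i < \<delta>)"
proof -
  have "u \<in> half_open_cube n \<delta> \<longleftrightarrow> (\<forall>i\<in>{..<n}. 0 \<le> u i \<and> u i < \<delta>) \<and> u \<in> extensional {..<n}"
    by (simp only: half_open_cube_def PiE_iff atLeastLessThan_iff)
  moreover have "u \<in> nonneg_orthant n \<longleftrightarrow> (\<forall>i\<in>{..<n}. 0 \<le> u i) \<and> u \<in> extensional {..<n}"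
    by (simp only: nonneg_orthant_def PiE_iff atLeast_iff)
  ultimately show ?thesis by (simp only: lessThan_iff Ball_def) blast
qed

lemma half_open_cube_borel [measurable]: "half_open_cube n \<delta> \<in> sets borel"
proof -
  have "half_open_cube n \<delta> = nonneg_orthant n \<inter> {u \<in> space borel. \<forall>i\<in>{..<n}. u i < \<delta>}"
    by (simp add: set_eq_iff half_open_cube_iff Ball_def)
  also have "\<dots> \<in> sets borel" by measurable
  finally show ?thesis .
qed

lemma levy_measure_properties:
  assumes n: "1 \<le> n" and M: "sets \<mu> = sets (borel_punctured n)"
    and int: "\<And>s. s \<in> neg_orthant n \<Longrightarrow> integrable \<mu> (\<lambda>u. exp (dot n s u) - 1)"
  shows "radon_measure_on (punctured_orthant n) \<mu>"
    and "0 < \<delta> \<Longrightarrow> j < n \<Longrightarrow> set_integrable \<mu> (half_open_cube n \<delta> - {origin n}) (\<lambda>u. u j)"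
    and "0 < \<delta> \<Longrightarrow> emeasure \<mu> (nonneg_orthant n - half_open_cube n \<delta>) < \<infinity>"
proof -
  note [measurable_cong] = M
  let ?X = "punctured_orthant n"
  have spX: "space \<mu> = ?X" by (rule space_borel_punctured[OF M])
  have setsM: "A \<in> sets \<mu> \<longleftrightarrow> A \<subseteq> ?X \<and> A \<in> sets borel" for A
    unfolding M by (subst sets_restrict_space_iff) auto
  define b where "b = diag n (- 1)"
  have b: "b \<in> neg_orthant n" by (simp add: b_def diag_in)
  define h where "h u = 1 - exp (dot n b u)" for u
  have h_le: "1 - exp (- u j) \<le> h u" if "u \<in> nonneg_orthant n" "j < n" for u j
  proof -
    have "u j \<le> (\<Sum>i<n. u i)"
      using that by (intro member_le_sum) (auto simp: nonneg_orthant_def PiE_iff)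
    then show ?thesis by (simp add: h_def b_def dot_diag)
  qed
  have h0: "0 \<le> h u" if "u \<in> nonneg_orthant n" for u
    using that by (auto simp: h_def b_def dot_diag nonneg_orthant_def PiE_iff intro!: sum_nonneg)
  have hX: "0 < h u" if uX: "u \<in> ?X" for u
  proof -
    obtain i where "i < n" "0 < u i" by (rule punctured_orthant_pos[OF uX])
    then have "0 < 1 - exp (- u i)" by simp
    also have "\<dots> \<le> h u" using uX \<open>i < n\<close> by (intro h_le) auto
    finally show ?thesis .
  qed
  have hint: "integrable \<mu> h"
  proof -
    have "integrable \<mu> (\<lambda>u. - (exp (dot n b u) - 1))"
      by (rule Bochner_Integration.integrable_minus[OF int[OF b]])
    then show ?thesis by (simp add: h_def[abs_def])
  qed
  have nn: "(\<integral>\<^sup>+ u. ennreal (h u) \<partial>\<mu>) < \<infinity>"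
  proof -
    have "(\<integral>\<^sup>+ u. ennreal (h u) \<partial>\<mu>) = ennreal (\<integral>u. h u \<partial>\<mu>)"
      by (rule nn_integral_eq_integral[OF hint]) (auto simp: spX intro!: h0)
    then show ?thesis by simp
  qed
  have hcont: "continuous_on UNIV h"
    unfolding h_def[abs_def] dot_def by (intro continuous_intros continuous_on_coordinate)
  show "radon_measure_on ?X \<mu>"
    by (rule radon_measure_onI[OF punctured_orthant_borel M hcont hX nn])
  show "set_integrable \<mu> (half_open_cube n \<delta> - {origin n}) (\<lambda>u. u j)" if \<delta>: "0 < \<delta>" and j: "j < n"
    unfolding set_integrable_def
  proof (rule Bochner_Integration.integrable_bound)
    show "integrable \<mu> (\<lambda>u. (exp \<delta> * 2) * h u)"
      by (intro Bochner_Integration.integrable_mult_right hint)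
    have "half_open_cube n \<delta> - {origin n} \<in> sets \<mu>"
      unfolding setsM by (simp add: half_open_cube_iff subset_iff)
    then show "(\<lambda>u. indicat_real (half_open_cube n \<delta> - {origin n}) u *\<^sub>R u j) \<in> borel_measurable \<mu>"
      using orthant_coord_measurable[OF M, of j] by measurable
    show "AE u in \<mu>. norm (indicat_real (half_open_cube n \<delta> - {origin n}) u *\<^sub>R u j) \<le> norm ((exp \<delta> * 2) * h u)"
    proof (rule AE_I2)
      fix u assume "u \<in> space \<mu>"
      then have u: "u \<in> nonneg_orthant n" by (simp add: spX)
      then have uj: "0 \<le> u j" using j by (auto simp: nonneg_orthant_def PiE_iff)
      show "norm (indicat_real (half_open_cube n \<delta> - {origin n}) u *\<^sub>R u j) \<le> norm ((exp \<delta> * 2) * h u)"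
      proof (cases "u \<in> half_open_cube n \<delta> - {origin n}")
        case True
        then have lt: "u j \<le> \<delta>" using j by (simp add: half_open_cube_iff less_imp_le)
        have "u j = exp (u j) * (u j * exp (- (1 * u j)))" by (simp add: exp_minus)
        also have "\<dots> \<le> exp \<delta> * ((1 + 1 / 1) * (1 - exp (- u j)))"
          using uj lt by (intro mult_mono mult_exp_neg_le) auto
        also have "\<dots> \<le> exp \<delta> * 2 * h u"
          using h_le[OF u j] by simp
        finally show ?thesis using True uj h0[OF u] by simp
      qed (simp)
    qed
  qed
  show "emeasure \<mu> (nonneg_orthant n - half_open_cube n \<delta>) < \<infinity>" if \<delta>: "0 < \<delta>"
  proof -
    let ?A = "nonneg_orthant n - half_open_cube n \<delta>"
    have o: "origin n \<in> half_open_cube n \<delta>" using \<delta> origin_in_orthant[of n] by (simp add: half_open_cube_iff) (simp add: origin_def)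
    have A: "?A \<in> sets \<mu>" unfolding setsM using o by auto
    define C where "C = 1 / (1 - exp (- \<delta>))"
    have C: "0 < C" using \<delta> by (simp add: C_def)
    have "emeasure \<mu> ?A = (\<integral>\<^sup>+ u. indicator ?A u \<partial>\<mu>)" using A by simp
    also have "\<dots> \<le> (\<integral>\<^sup>+ u. ennreal C * ennreal (h u) \<partial>\<mu>)"
    proof (rule nn_integral_mono)
      fix u assume "u \<in> space \<mu>"
      show "indicator ?A u \<le> ennreal C * ennreal (h u)"
      proof (cases "u \<in> ?A")
        case True
        then obtain i where i: "i < n" "\<delta> \<le> u i"
          by (auto simp: half_open_cube_iff not_less)
        have "1 - exp (- \<delta>) \<le> 1 - exp (- u i)" using i by simp
        also have "\<dots> \<le> h u" using True i by (intro h_le) auto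
        finally have "1 \<le> C * h u" using \<delta> by (simp add: C_def field_simps)
        then have "ennreal 1 \<le> ennreal (C * h u)" by (rule ennreal_leI)
        moreover have "ennreal (C * h u) = ennreal C * ennreal (h u)" using C by (intro ennreal_mult') simp
        moreover have "indicator ?A u = ennreal 1" using True by simp
        ultimately show ?thesis by (simp only:)
      qed simp
    qed
    also have "\<dots> = ennreal C * (\<integral>\<^sup>+ u. ennreal (h u) \<partial>\<mu>)"
      by (rule nn_integral_cmult) (use hint in simp)
    also have "\<dots> < \<infinity>" using nn by (simp add: ennreal_mult_less_top)
    finally show ?thesis .
  qed
qed

context levy_khintchine
begin

lemmas space_eq = space_borel_punctured[OF sets]

lemma measurable [measurable]:
  "(\<lambda>u. u i) \<in> borel_measurable \<mu>" "(\<lambda>u. dot n s u) \<in> borel_measurable \<mu>"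
  by (intro orthant_coord_measurable[OF sets] borel_measurable_dot)+

sublocale L: laplace_integrand n \<mu> "\<lambda>_. 1" "\<lambda>_. 1"
  by unfold_locales (use integrable in \<open>auto simp: space_eq nonneg_orthant_def PiE_iff\<close>)

lemma representation_G: "s \<in> neg_orthant n \<Longrightarrow> \<psi> s = c0 + dot n c s + L.G s"
  by (simp add: representation L.G_def)

lemma integrable_coord: "s \<in> neg_orthant n \<Longrightarrow> j < n \<Longrightarrow> integrable \<mu> (\<lambda>u. u j * exp (dot n s u))"
  using L.integrable_moment by simp

lemma has_derivative:
  assumes s: "s \<in> neg_orthant n" and j: "j < n"
  shows "((\<lambda>t. \<psi> (s(j := t))) has_field_derivative c j + (\<integral>u. u j * exp (dot n s u) \<partial>\<mu>)) (at (s j))"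
proof -
  have "((\<lambda>t. dot n c (s(j := t))) has_field_derivative c j) (at (s j))"
  proof -
    have "dot n c (s(j := t)) = dot n c s + (t - s j) * c j" for t
      using dot_upd[OF j, of s t c] by (simp add: dot_def mult.commute)
    then show ?thesis by (auto intro!: derivative_eq_intros)
  qed
  then have "((\<lambda>t. c0 + dot n c (s(j := t)) + L.G (s(j := t))) has_field_derivative
      0 + c j + (\<integral>u. 1 * u j * exp (dot n s u) \<partial>\<mu>)) (at (s j))"
    by (intro DERIV_add DERIV_const L.G_has_derivative[OF s j])
  then have D: "((\<lambda>t. c0 + dot n c (s(j := t)) + L.G (s(j := t))) has_field_derivative
      c j + (\<integral>u. u j * exp (dot n s u) \<partial>\<mu>)) (at (s j))"
    by simp
  from iffD2[OF has_field_derivative_orthant_cong[OF s j, where f = \<psi> and g = "\<lambda>s. c0 + dot n c s + L.G s",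
      OF representation_G] D]
  show ?thesis .
qed

lemma partial_deriv_eq:
  "s \<in> neg_orthant n \<Longrightarrow> j < n \<Longrightarrow> partial_deriv j \<psi> s = c j + (\<integral>u. u j * exp (dot n s u) \<partial>\<mu>)"
  unfolding partial_deriv_def by (rule DERIV_imp_deriv) (rule has_derivative)

lemma negative_bernstein:
  assumes neg: "\<And>s. s \<in> neg_orthant n \<Longrightarrow> \<psi> s \<le> 0"
  shows "\<psi> \<in> negative_bernstein n"
proof -
  have am: "absolutely_monotone n (partial_deriv j \<psi>)" if j: "j < n" for j
  proof -
    have "diff_monotone n (\<lambda>s. c j + (\<integral>u. u j * exp (dot n s u) \<partial>\<mu>))"
    proof (intro diff_monotone_add diff_monotone_const diff_monotone_integral integrable_coord j)
      show "0 \<le> c j" using drift j by (auto simp: nonneg_orthant_def PiE_iff)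
      show "diff_monotone n (\<lambda>s. u j * exp (dot n s u))" if "u \<in> space \<mu>" for u
        using L.coord_nonneg[OF that] j
        by (intro diff_monotone_mult diff_monotone_const diff_monotone_exp_dot) auto
    qed
    then have "diff_monotone n (partial_deriv j \<psi>)"
      by (rule diff_monotone_cong) (simp add: partial_deriv_eq j)
    then show ?thesis using diff_monotone_iff_absolutely_monotone[OF n] by blast
  qed
  have "smooth_on_neg_orthant n \<psi>"
    unfolding smooth_on_neg_orthant_def
  proof (intro ballI)
    fix js assume js: "js \<in> lists {..<n}"
    show "continuous_on (neg_orthant n) (partial_derivs js \<psi>) \<and>
      (\<forall>s\<in>neg_orthant n. \<forall>i<n. (\<lambda>t. partial_derivs js \<psi> (s(i := t))) differentiable at (s i))"
    proof (cases js rule: rev_cases)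
      case Nil
      have "continuous_on (neg_orthant n) (\<lambda>s. c0 + dot n c s + L.G s)"
        by (intro continuous_on_add continuous_on_const L.continuous_on_G)
          (auto simp: dot_def intro!: continuous_intros continuous_on_coordinate)
      then have "continuous_on (neg_orthant n) \<psi>"
        using representation_G by (simp cong: continuous_on_cong)
      moreover have "(\<lambda>t. \<psi> (s(i := t))) differentiable at (s i)" if "s \<in> neg_orthant n" "i < n" for s i
        using has_derivative[OF that] real_differentiable_def by blast
      ultimately show ?thesis using Nil by simp
    next
      case (snoc xs j)
      then have "xs \<in> lists {..<n}" "j < n" using js by auto
      then show ?thesis
        using am[of j] snoc unfolding absolutely_monotone_def smooth_on_neg_orthant_def
        by (simp add: partial_derivs_append)
    qed
  qed
  then show ?thesis using neg am by (simp add: negative_bernstein_def)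
qed

end

lemma negative_bernstein_imp_diff_bernstein:
  assumes "\<psi> \<in> negative_bernstein n"
  shows "diff_bernstein n \<psi>"
  unfolding diff_bernstein_def
proof (intro allI impI)
  fix i h assume i: "i < n" and h: "(0::real) < h"
  have "absolutely_monotone n (back_diff i h \<psi>)"
  proof (rule absolutely_monotone_back_diff_of_smooth[OF _ _ i h])
    show "smooth_on_neg_orthant n \<psi>" using assms by (simp add: negative_bernstein_def)
    fix i js s assume *: "i < n" "js \<in> lists {..<n}" "s \<in> neg_orthant n"
    obtain xs j where xs: "i # js = xs @ [j]" by (metis list.distinct(1) rev_exhaust)
    have "set (i # js) \<subseteq> {..<n}" using * by auto
    then have "xs \<in> lists {..<n}" "j < n" unfolding xs by auto
    then show "0 \<le> partial_derivs (i # js) \<psi> s"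
      unfolding xs using assms * by (simp add: negative_bernstein_def absolutely_monotone_def partial_derivs_append)
  qed
  then show "diff_monotone n (back_diff i h \<psi>)" by (rule absolutely_monotone_imp_diff_monotone)
qed

lemma eventually_coordwise:
  assumes "\<forall>\<^sub>F x in F. Q x"
  shows "\<forall>\<^sub>F s in coordwise n F. s \<in> neg_orthant n \<and> (\<forall>i<n. Q (s i))"
proof (rule eventually_conj)
  have "coordwise n F \<le> principal (neg_orthant n)" by (simp add: coordwise_def)
  then show "\<forall>\<^sub>F s in coordwise n F. s \<in> neg_orthant n"
    by (rule filter_leD) (simp add: eventually_principal)
  have "\<forall>\<^sub>F s in coordwise n F. Q (s i)" if "i < n" for i
  proof -
    have "coordwise n F \<le> filtercomap (\<lambda>s. s i) F"
      unfolding coordwise_def by (rule le_infI1) (rule INF_lower, use that in simp)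
    moreover have "\<forall>\<^sub>F s in filtercomap (\<lambda>s. s i) F. Q (s i)"
      using assms by (auto simp: eventually_filtercomap)
    ultimately show ?thesis by (rule filter_leD)
  qed
  then have "\<forall>\<^sub>F s in coordwise n F. \<forall>i\<in>{..<n}. Q (s i)"
    by (intro eventually_ball_finite) auto
  then show "\<forall>\<^sub>F s in coordwise n F. \<forall>i<n. Q (s i)" by (rule eventually_mono) auto
qed

context levy_khintchine
begin

text \<open>Monotonicity reduces the limit to the diagonal sequence \<open>-1/k\<close>, where dominated convergence applies.\<close>

lemma limit_at_zero: "(\<psi> \<longlongrightarrow> c0) (coordwise n (at_left 0))"
proof -
  have nonpos: "dot n s u \<le> 0" if "s \<in> neg_orthant n" "u \<in> nonneg_orthant n" for s u
    using that unfolding dot_def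
    by (intro sum_nonpos mult_nonpos_nonneg) (auto simp: neg_orthant_def nonneg_orthant_def PiE_iff intro: less_imp_le)
  have mono: "\<psi> s \<le> \<psi> s'" if s: "s \<in> neg_orthant n" "s' \<in> neg_orthant n" "\<And>i. i < n \<Longrightarrow> s i \<le> s' i" for s s'
  proof -
    have "dot n s c \<le> dot n s' c"
      using drift by (intro dot_mono s(3)) (auto simp: nonneg_orthant_def PiE_iff)
    then have "dot n c s \<le> dot n c s'" by (simp add: dot_def mult.commute)
    moreover have "(\<integral>u. (exp (dot n s u) - 1) \<partial>\<mu>) \<le> (\<integral>u. (exp (dot n s' u) - 1) \<partial>\<mu>)"
      by (intro integral_mono integrable s) (auto simp: space_eq nonneg_orthant_def PiE_iff intro!: dot_mono s(3))
    ultimately show ?thesis using representation[OF s(1)] representation[OF s(2)] by linarith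
  qed
  have upper: "\<psi> s \<le> c0" if "s \<in> neg_orthant n" for s
  proof -
    have "dot n c s \<le> 0" using nonpos[OF that drift] by (simp add: dot_def mult.commute)
    moreover have "(\<integral>u. (exp (dot n s u) - 1) \<partial>\<mu>) \<le> (\<integral>u. 0 \<partial>\<mu>)"
      by (intro integral_mono integrable that Bochner_Integration.integrable_zero) (auto simp: space_eq intro!: nonpos that)
    ultimately show ?thesis using representation[OF that] by simp
  qed
  define z where "z k = diag n (- 1 / real (Suc k))" for k
  have z: "z k \<in> neg_orthant n" for k unfolding z_def by (rule diag_in) simp
  have t0: "(\<lambda>k. - 1 / real (Suc k)) \<longlonglongrightarrow> 0"
    using tendsto_minus[OF LIMSEQ_inverse_real_of_nat] by (simp add: divide_inverse)
  have dz: "(\<lambda>k. dot n (z k) u) \<longlonglongrightarrow> 0" for u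
    unfolding z_def dot_diag by (rule tendsto_mult_left_zero[OF t0])
  have "(\<lambda>k. \<integral>u. (exp (dot n (z k) u) - 1) \<partial>\<mu>) \<longlonglongrightarrow> (\<integral>u. exp 0 - 1 \<partial>\<mu>)"
  proof (rule integral_dominated_convergence[where w = "\<lambda>u. - (exp (dot n (z 0) u) - 1)"])
    show "integrable \<mu> (\<lambda>u. - (exp (dot n (z 0) u) - 1))"
      by (rule Bochner_Integration.integrable_minus[OF integrable[OF z]])
    show "AE u in \<mu>. (\<lambda>k. exp (dot n (z k) u) - 1) \<longlonglongrightarrow> exp 0 - 1"
      by (intro AE_I2 tendsto_intros dz)
    show "AE u in \<mu>. norm (exp (dot n (z k) u) - 1) \<le> - (exp (dot n (z 0) u) - 1)" for k
    proof (rule AE_I2)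
      fix u assume "u \<in> space \<mu>"
      then have u: "u \<in> nonneg_orthant n" by (simp add: space_eq)
      have "dot n (z 0) u \<le> dot n (z k) u"
        using u by (intro dot_mono) (auto simp: z_def nonneg_orthant_def PiE_iff divide_le_eq)
      then show "norm (exp (dot n (z k) u) - 1) \<le> - (exp (dot n (z 0) u) - 1)"
        using nonpos[OF z u, of k] by simp
    qed
  qed measurable
  moreover have "(\<lambda>k. dot n c (z k)) \<longlonglongrightarrow> 0"
    using dz[of c] by (simp add: dot_def mult.commute)
  ultimately have "(\<lambda>k. c0 + dot n c (z k) + (\<integral>u. (exp (dot n (z k) u) - 1) \<partial>\<mu>)) \<longlonglongrightarrow> c0 + 0 + 0"
    by (intro tendsto_intros) simp_all
  then have lim: "(\<lambda>k. \<psi> (z k)) \<longlonglongrightarrow> c0" by (simp add: representation[OF z])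
  show ?thesis
  proof (rule order_tendstoI)
    fix a assume "a < c0"
    then have "\<forall>\<^sub>F k in sequentially. a < \<psi> (z k)" by (rule order_tendstoD(1)[OF lim])
    then obtain k where k: "a < \<psi> (z k)" by (auto simp: eventually_sequentially)
    have "\<forall>\<^sub>F x in at_left 0. - 1 / real (Suc k) < x"
      by (rule order_tendstoD(1)[OF tendsto_ident_at]) simp
    from eventually_coordwise[OF this, of n]
    show "\<forall>\<^sub>F s in coordwise n (at_left 0). a < \<psi> s"
    proof eventually_elim
      case (elim s)
      have "\<psi> (z k) \<le> \<psi> s" using elim by (intro mono z) (auto simp: z_def less_imp_le)
      then show ?case using k by simp
    qed
  next
    fix a assume a: "c0 < a"
    from eventually_coordwise[of "\<lambda>_. True" "at_left 0" n]
    have "\<forall>\<^sub>F s in coordwise n (at_left 0). s \<in> neg_orthant n" by simp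
    then show "\<forall>\<^sub>F s in coordwise n (at_left 0). \<psi> s < a"
      by eventually_elim (use upper a in force)
  qed
qed

text \<open>Again the diagonal sequence suffices; there \<open>e\<^bsup>s\<cdot>u\<^esup> \<rightarrow> 0\<close> for every \<open>u\<close> in the punctured orthant.\<close>

lemma limit_of_gradient:
  assumes j: "j < n"
  shows "(partial_deriv j \<psi> \<longlongrightarrow> c j) (coordwise n at_bot)"
proof -
  define z where "z k = diag n (- real (Suc k))" for k
  have z: "z k \<in> neg_orthant n" for k unfolding z_def by (rule diag_in) simp
  have uj: "0 \<le> u j" if "u \<in> space \<mu>" for u using that j by (auto simp: space_eq nonneg_orthant_def PiE_iff)
  have lim: "(\<lambda>k. \<integral>u. u j * exp (dot n (z k) u) \<partial>\<mu>) \<longlonglongrightarrow> (\<integral>u. 0 \<partial>\<mu>)"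
  proof (rule integral_dominated_convergence[where w = "\<lambda>u. u j * exp (dot n (z 0) u)"])
    show "integrable \<mu> (\<lambda>u. u j * exp (dot n (z 0) u))" by (rule integrable_coord[OF z j])
    show "AE u in \<mu>. (\<lambda>k. u j * exp (dot n (z k) u)) \<longlonglongrightarrow> 0"
    proof (rule AE_I2)
      fix u assume "u \<in> space \<mu>"
      then have u: "u \<in> punctured_orthant n" by (simp add: space_eq)
      obtain i where i: "i < n" "0 < u i" by (rule punctured_orthant_pos[OF u])
      have "u i \<le> (\<Sum>i<n. u i)"
        using u i by (intro member_le_sum) (auto simp: nonneg_orthant_def PiE_iff)
      then have S: "0 < (\<Sum>i<n. u i)" using i by linarith
      have "(\<lambda>k. exp (- (\<Sum>i<n. u i)) ^ Suc k) \<longlonglongrightarrow> 0"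
        by (rule LIMSEQ_Suc[OF LIMSEQ_realpow_zero]) (use S in auto)
      moreover have "exp (- (\<Sum>i<n. u i)) ^ Suc k = exp (dot n (z k) u)" for k
        by (simp only: exp_of_nat_mult[symmetric] z_def dot_diag) (simp add: algebra_simps)
      ultimately have "(\<lambda>k. exp (dot n (z k) u)) \<longlonglongrightarrow> 0" by (simp only:)
      then show "(\<lambda>k. u j * exp (dot n (z k) u)) \<longlonglongrightarrow> 0" by (rule tendsto_mult_right_zero)
    qed
    show "AE u in \<mu>. norm (u j * exp (dot n (z k) u)) \<le> u j * exp (dot n (z 0) u)" for k
    proof (rule AE_I2)
      fix u assume u: "u \<in> space \<mu>"
      have "dot n (z k) u \<le> dot n (z 0) u"
        using u by (intro dot_mono) (auto simp: space_eq z_def nonneg_orthant_def PiE_iff)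
      then show "norm (u j * exp (dot n (z k) u)) \<le> u j * exp (dot n (z 0) u)"
        using uj[OF u] by (auto intro!: mult_left_mono simp: abs_mult)
    qed
  qed measurable
  show ?thesis
  proof (rule order_tendstoI)
    fix a assume a: "a < c j"
    from eventually_coordwise[of "\<lambda>_. True" at_bot n]
    have "\<forall>\<^sub>F s in coordwise n at_bot. s \<in> neg_orthant n" by simp
    then show "\<forall>\<^sub>F s in coordwise n at_bot. a < partial_deriv j \<psi> s"
    proof eventually_elim
      case (elim s)
      have "0 \<le> (\<integral>u. u j * exp (dot n s u) \<partial>\<mu>)" using uj by (intro integral_nonneg_AE AE_I2) simp
      then show ?case using partial_deriv_eq[OF elim j] a by simp
    qed
  next
    fix a assume "c j < a"
    then have "\<forall>\<^sub>F k in sequentially. (\<integral>u. u j * exp (dot n (z k) u) \<partial>\<mu>) < a - c j"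
      using order_tendstoD(2)[OF lim, of "a - c j"] by simp
    then obtain k where k: "(\<integral>u. u j * exp (dot n (z k) u) \<partial>\<mu>) < a - c j"
      by (auto simp: eventually_sequentially)
    from eventually_coordwise[OF eventually_le_at_bot[of "- real (Suc k)"], of n]
    show "\<forall>\<^sub>F s in coordwise n at_bot. partial_deriv j \<psi> s < a"
    proof eventually_elim
      case (elim s)
      then have s: "s \<in> neg_orthant n" by simp
      have "(\<integral>u. u j * exp (dot n s u) \<partial>\<mu>) \<le> (\<integral>u. u j * exp (dot n (z k) u) \<partial>\<mu>)"
      proof (rule integral_mono[OF integrable_coord[OF s j] integrable_coord[OF z j]])
        fix u assume u: "u \<in> space \<mu>"
        have "dot n s u \<le> dot n (z k) u"
          using u elim by (intro dot_mono) (auto simp: space_eq z_def nonneg_orthant_def PiE_iff)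
        then show "u j * exp (dot n s u) \<le> u j * exp (dot n (z k) u)"
          using uj[OF u] by (intro mult_left_mono) auto
      qed
      then show ?case using partial_deriv_eq[OF s j] k by simp
    qed
  qed
qed

end

section \<open>Composition with absolutely monotone functions\<close>

lemma back_diff_restrict:
  assumes "i < n"
  shows "back_diff i h (\<lambda>v. g (restrict v {..<n})) = (\<lambda>v. back_diff i h g (restrict v {..<n}))"
proof
  fix v :: "nat \<Rightarrow> real"
  have "restrict (v(i := v i - h)) {..<n} = (restrict v {..<n})(i := restrict v {..<n} i - h)"
    using assms by (auto simp: fun_eq_iff)
  then show "back_diff i h (\<lambda>v. g (restrict v {..<n})) v = back_diff i h g (restrict v {..<n})"
    by (simp only: back_diff_def)
qed

lemma back_diff_restrict_beyond:
  assumes "n \<le> i"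
  shows "back_diff i h (\<lambda>v. g (restrict v {..<n})) = (\<lambda>v. 0)"
proof
  fix v :: "nat \<Rightarrow> real"
  have "restrict (v(i := v i - h)) {..<n} = restrict v {..<n}"
    using assms by (auto simp: fun_eq_iff)
  then show "back_diff i h (\<lambda>v. g (restrict v {..<n})) v = 0"
    by (simp only: back_diff_def diff_self)
qed

lemma restrict_neg_orthant: "v \<in> neg_orthant N \<Longrightarrow> n \<le> N \<Longrightarrow> restrict v {..<n} \<in> neg_orthant n"
  by (auto simp: neg_orthant_def PiE_iff)

lemma diff_monotone_restrict:
  assumes g: "diff_monotone n g" and N: "n \<le> N"
  shows "diff_monotone N (\<lambda>v. g (restrict v {..<n}))"
proof (rule diff_monotone_coinduct[where Q = "\<lambda>F. \<exists>g. diff_monotone n g \<and> F = (\<lambda>v. g (restrict v {..<n}))"])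
  fix F i h
  assume "\<exists>g. diff_monotone n g \<and> F = (\<lambda>v. g (restrict v {..<n}))" and h: "(0::real) < h"
  then obtain g where g: "diff_monotone n g" "F = (\<lambda>v. g (restrict v {..<n}))" by blast
  have "\<exists>g'. diff_monotone n g' \<and> back_diff i h F = (\<lambda>v. g' (restrict v {..<n}))"
  proof (cases "i < n")
    case True
    then show ?thesis
      using g h by (intro exI[of _ "back_diff i h g"]) (simp add: back_diff_restrict diff_monotone_back_diff)
  next
    case False
    then show ?thesis
      using g by (intro exI[of _ "\<lambda>_. 0"]) (simp add: back_diff_restrict_beyond diff_monotone_const)
  qed
  then show "\<exists>G. (\<exists>g. diff_monotone n g \<and> G = (\<lambda>v. g (restrict v {..<n}))) \<and> (\<forall>s\<in>neg_orthant N. back_diff i h F s = G s)"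
    by blast
qed (use g diff_monotone_nonneg restrict_neg_orthant[OF _ N] in blast)+

lemma diff_bernstein_restrict:
  assumes \<psi>: "diff_bernstein n \<psi>" and N: "n \<le> N" and a: "0 \<le> a"
  shows "diff_bernstein N (\<lambda>v. a * (\<psi> (restrict v {..<n}) - e))"
  unfolding diff_bernstein_def
proof (intro allI impI)
  fix i h assume h: "(0::real) < h"
  have eq: "back_diff i h (\<lambda>v. a * (\<psi> (restrict v {..<n}) - e)) = (\<lambda>v. a * back_diff i h (\<lambda>v. \<psi> (restrict v {..<n})) v)"
    by (auto simp: back_diff_def algebra_simps)
  show "diff_monotone N (back_diff i h (\<lambda>v. a * (\<psi> (restrict v {..<n}) - e)))"
  proof (cases "i < n")
    case True
    then show ?thesis
      unfolding eq back_diff_restrict[OF True] using \<psi> h a N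
      by (intro diff_monotone_mult diff_monotone_const diff_monotone_restrict) (auto simp: diff_bernstein_def)
  next
    case False
    then show ?thesis unfolding eq by (simp add: back_diff_restrict_beyond diff_monotone_const)
  qed
qed

lemma vec_cons_neg_orthant:
  assumes "1 \<le> m" "x < 0" "r \<in> neg_orthant (m - 1)"
  shows "vec_cons m x r \<in> neg_orthant m"
  unfolding neg_orthant_def
proof (rule PiE_I)
  fix i assume i: "i \<in> {..<m}"
  show "vec_cons m x r i \<in> {..<0}"
    using i assms(2) neg_orthant_less[OF assms(3), of "i - 1"]
    by (cases i) (auto simp: vec_cons_def)
qed (simp add: vec_cons_def)

lemma dot_vec_cons:
  assumes "1 \<le> m"
  shows "dot m (vec_cons m x r) u = x * u 0 + (\<Sum>j<m - 1. r j * u (Suc j))"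
proof -
  obtain m' where m': "m = Suc m'" using assms by (cases m) auto
  show ?thesis unfolding m' dot_def by (subst sum.lessThan_Suc_shift) (simp add: vec_cons_def)
qed

text \<open>Replacing \<open>\<psi>\<close> by \<open>\<psi> - \<epsilon>\<close> moves the argument into the open orthant, where \<open>f\<close> is a Laplace transform. For
\<open>\<epsilon> \<rightarrow> 0\<close> these composites converge to the composite with \<open>\<psi>\<close>, including the points with \<open>\<psi> = 0\<close>,
where the value of the composite is by definition such a limit.\<close>

lemma composite_absolutely_monotone:
  assumes m: "1 \<le> m" and n: "1 \<le> n" and neg: "\<And>s. s \<in> neg_orthant n \<Longrightarrow> \<psi> s \<le> 0"
    and \<psi>: "diff_bernstein n \<psi>" and f: "absolutely_monotone m f" and comp: "composable m n f \<psi>"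
  shows "absolutely_monotone (m + n - 1) (composite m n f \<psi>)"
proof -
  define N where "N = m + n - 1"
  have N: "1 \<le> N" "n \<le> N" using m n by (auto simp: N_def)
  obtain \<nu> where \<nu>: "sets \<nu> = sets (borel_orthant m)"
    "\<And>s. s \<in> neg_orthant m \<Longrightarrow> integrable \<nu> (\<lambda>u. exp (dot m s u))"
    "\<And>s. s \<in> neg_orthant m \<Longrightarrow> f s = (\<integral>u. exp (dot m s u) \<partial>\<nu>)"
    using diff_monotone_laplace[OF m absolutely_monotone_imp_diff_monotone[OF f]] by metis
  define R where "R v = (\<lambda>j\<in>{..<m - 1}. v (n + j))" for v :: "nat \<Rightarrow> real"
  define P where "P v = restrict v {..<n}" for v :: "nat \<Rightarrow> real"
  have R: "R v \<in> neg_orthant (m - 1)" if "v \<in> neg_orthant N" for v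
    using neg_orthant_less[OF that] by (auto simp: R_def neg_orthant_def N_def)
  have P: "P v \<in> neg_orthant n" if "v \<in> neg_orthant N" for v
    unfolding P_def using that N(2) by (rule restrict_neg_orthant)
  define e where "e k = inverse (real (Suc k))" for k
  have e: "0 < e k" for k by (simp add: e_def)
  have e0: "e \<longlonglongrightarrow> 0" unfolding e_def[abs_def] by (rule LIMSEQ_inverse_real_of_nat)
  define F where "F k v = f (vec_cons m (\<psi> (P v) - e k) (R v))" for k v
  have arg: "vec_cons m (\<psi> (P v) - e k) (R v) \<in> neg_orthant m" if "v \<in> neg_orthant N" for v k
    using neg[OF P[OF that]] e[of k] by (intro vec_cons_neg_orthant m R that) linarith
  have "diff_monotone N (composite m n f \<psi>)"
  proof (rule diff_monotone_LIMSEQ)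
    fix k
    define H where "H u v = exp (u 0 * (\<psi> (P v) - e k)) * exp (dot N v (\<lambda>i. if i < n then 0 else u (Suc (i - n))))" for u v
    have H: "H u v = exp (dot m (vec_cons m (\<psi> (P v) - e k) (R v)) u)" for u v
    proof -
      have "dot N v (\<lambda>i. if i < n then 0 else u (Suc (i - n))) = (\<Sum>i\<in>{n..<N}. v i * u (Suc (i - n)))"
        unfolding dot_def by (rule sum.mono_neutral_cong_right) auto
      also have "\<dots> = (\<Sum>j<m - 1. R v j * u (Suc j))"
        by (rule sum.reindex_bij_witness[of _ "\<lambda>j. n + j" "\<lambda>i. i - n"]) (auto simp: R_def N_def)
      finally show ?thesis by (simp add: H_def dot_vec_cons[OF m] exp_add mult.commute)
    qed
    have "diff_monotone N (\<lambda>v. \<integral>u. H u v \<partial>\<nu>)"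
    proof (rule diff_monotone_integral)
      fix u assume "u \<in> space \<nu>"
      then have u: "u \<in> nonneg_orthant m" by (simp add: space_borel_orthant[OF \<nu>(1)])
      then have "0 \<le> u i" if "i < m" for i using that by (auto simp: nonneg_orthant_def PiE_iff)
      then show "diff_monotone N (H u)"
        unfolding H_def P_def using m
        by (intro diff_monotone_exp_mult diff_bernstein_restrict \<psi> N diff_monotone_exp_dot) (auto simp: N_def)
    next
      fix v assume "v \<in> neg_orthant N"
      then show "integrable \<nu> (\<lambda>u. H u v)" unfolding H by (intro \<nu>(2) arg)
    qed
    then show "diff_monotone N (F k)"
      by (rule diff_monotone_cong) (simp add: H F_def \<nu>(3)[OF arg])
  next
    fix v assume v: "v \<in> neg_orthant N"
    show "(\<lambda>k. F k v) \<longlonglongrightarrow> composite m n f \<psi> v"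
    proof (cases "\<psi> (P v) < 0")
      case True
      let ?w = "vec_cons m (\<psi> (P v)) (R v)"
      have w: "?w \<in> neg_orthant m" by (rule vec_cons_neg_orthant[OF m True R[OF v]])
      have upd: "vec_cons m x (R v) = ?w(0 := x)" for x
        using m by (auto simp: vec_cons_def fun_eq_iff split: nat.split)
      have w0: "?w 0 = \<psi> (P v)" using m by (simp add: vec_cons_def)
      have "(\<lambda>t. partial_derivs [] f (?w(0 := t))) differentiable at (?w 0)"
        using f w m unfolding absolutely_monotone_def smooth_on_neg_orthant_def
        by (metis less_eq_Suc_le One_nat_def lists.Nil)
      then have "isCont (\<lambda>t. f (?w(0 := t))) (\<psi> (P v))"
        unfolding w0 by (simp add: differentiable_imp_continuous_within)
      moreover have "(\<lambda>k. \<psi> (P v) - e k) \<longlonglongrightarrow> \<psi> (P v)"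
        using tendsto_diff[OF tendsto_const e0, of "\<psi> (P v)"] by simp
      ultimately have "(\<lambda>k. f (?w(0 := \<psi> (P v) - e k))) \<longlonglongrightarrow> f (?w(0 := \<psi> (P v)))"
        by (rule isCont_tendsto_compose)
      then have "(\<lambda>k. F k v) \<longlonglongrightarrow> f ?w" unfolding F_def upd[symmetric] .
      moreover have "composite m n f \<psi> v = f ?w"
        using True by (simp add: composite_def Let_def P_def R_def)
      ultimately show ?thesis by simp
    next
      case False
      then have 0: "\<psi> (P v) = 0" using neg[OF P[OF v]] by simp
      obtain l where l: "((\<lambda>t. f (vec_cons m t (R v))) \<longlongrightarrow> l) (at_left 0)"
        using comp P[OF v] R[OF v] 0 unfolding composable_def by blast
      have "filterlim (\<lambda>k. - e k) (at_left 0) sequentially"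
        using tendsto_minus[OF e0] e less_imp_neq[OF e]
        by (auto simp: filterlim_at intro!: always_eventually)
      from filterlim_compose[OF l this] have "(\<lambda>k. F k v) \<longlonglongrightarrow> l"
        by (simp add: F_def 0)
      moreover have "composite m n f \<psi> v = l"
        using 0 tendsto_Lim[OF _ l] by (simp add: composite_def Let_def P_def R_def)
      ultimately show ?thesis by simp
    qed
  qed
  then show ?thesis using diff_monotone_iff_absolutely_monotone[OF N(1)] by (simp add: N_def)
qed

text \<open>The value \<open>-1\<close> at which the remaining variables are frozen is arbitrary.\<close>

lemma diff_monotone_extend:
  assumes G: "diff_monotone N G" and N: "n \<le> N"
  shows "diff_monotone n (\<lambda>s. G (\<lambda>i. if i < n then s i else if i < N then - 1 else undefined))"
    (is "diff_monotone n (\<lambda>s. G (?ext s))")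
proof (rule diff_monotone_coinduct[where Q = "\<lambda>F. \<exists>G. diff_monotone N G \<and> F = (\<lambda>s. G (?ext s))"])
  show "\<exists>G'. diff_monotone N G' \<and> (\<lambda>s. G (?ext s)) = (\<lambda>s. G' (?ext s))" using G by blast
next
  fix F s assume "\<exists>G. diff_monotone N G \<and> F = (\<lambda>s. G (?ext s))" and s: "s \<in> neg_orthant n"
  moreover have "?ext s \<in> neg_orthant N"
    unfolding neg_orthant_def by (rule PiE_I) (use N neg_orthant_less[OF s] in auto)
  ultimately show "0 \<le> F s" using diff_monotone_nonneg by blast
next
  fix F i h assume "\<exists>G. diff_monotone N G \<and> F = (\<lambda>s. G (?ext s))" and i: "i < n" and h: "(0::real) < h"
  then obtain G where G: "diff_monotone N G" "F = (\<lambda>s. G (?ext s))" by blast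
  have "?ext (s(i := s i - h)) = (?ext s)(i := ?ext s i - h)" for s
    using i by (auto simp: fun_eq_iff)
  then have "back_diff i h F = (\<lambda>s. back_diff i h G (?ext s))"
    unfolding G(2) back_diff_def by (simp only:)
  moreover have "diff_monotone N (back_diff i h G)"
    using i N h by (intro diff_monotone_back_diff G) auto
  ultimately show "\<exists>g. (\<exists>G. diff_monotone N G \<and> g = (\<lambda>s. G (?ext s))) \<and> (\<forall>s\<in>neg_orthant n. back_diff i h F s = g s)"
    by blast
qed

text \<open>The test functions \<open>f(x,r) = e\<^bsup>ax\<^esup>\<close> have the limit \<open>1\<close> at \<open>x = -0\<close>, so they are composable with every
nonpositive \<open>\<psi>\<close>. The condition for small \<open>a\<close> gives back \<open>\<psi>\<close> through \<open>(e\<^bsup>a\<psi>\<^esup> - 1) / a \<rightarrow> \<psi>\<close>.\<close>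

lemma composites_imp_diff_bernstein:
  assumes m: "1 \<le> m" and n: "1 \<le> n" and neg: "\<And>s. s \<in> neg_orthant n \<Longrightarrow> \<psi> s \<le> 0"
    and comp: "\<And>f. absolutely_monotone m f \<Longrightarrow> composable m n f \<psi> \<Longrightarrow>
      absolutely_monotone (m + n - 1) (composite m n f \<psi>)"
  shows "diff_bernstein n \<psi>"
proof -
  define N where "N = m + n - 1"
  have N: "1 \<le> N" "n \<le> N" using m n by (auto simp: N_def)
  have expo: "diff_monotone n (\<lambda>s. exp (a * \<psi> s))" if a: "0 < a" for a
  proof -
    define f where "f v = exp (a * v 0)" for v :: "nat \<Rightarrow> real"
    have "f v = exp (dot m v (\<lambda>i. if i = 0 then a else 0))" for v
    proof -
      have "dot m v (\<lambda>i. if i = 0 then a else 0) = (\<Sum>i<m. if i = 0 then a * v 0 else 0)"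
        unfolding dot_def by (rule sum.cong) auto
      also have "\<dots> = a * v 0" using m by simp
      finally show ?thesis by (simp add: f_def)
    qed
    then have "f = (\<lambda>v. exp (dot m v (\<lambda>i. if i = 0 then a else 0)))" by (rule ext)
    then have "diff_monotone m f"
      using a by (simp only:) (rule diff_monotone_exp_dot, simp)
    then have f: "absolutely_monotone m f" using diff_monotone_iff_absolutely_monotone[OF m] by blast
    have fv: "f (vec_cons m t r) = exp (a * t)" for t r
      using m by (simp add: f_def vec_cons_def)
    have lim: "((\<lambda>t. exp (a * t)) \<longlongrightarrow> 1) (at_left 0)"
    proof -
      have "((\<lambda>t. exp (a * t)) \<longlongrightarrow> exp (a * 0)) (at_left 0)" by (intro tendsto_intros)
      then show ?thesis by simp
    qed
    have "composable m n f \<psi>" unfolding composable_def fv using lim by blast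
    then have "diff_monotone N (composite m n f \<psi>)"
      using comp[OF f] by (simp add: N_def absolutely_monotone_imp_diff_monotone)
    from diff_monotone_extend[OF this N(2)] show ?thesis
    proof (rule diff_monotone_cong)
      fix s assume s: "s \<in> neg_orthant n"
      let ?v = "\<lambda>i. if i < n then s i else if i < N then - 1 else undefined"
      have "restrict ?v {..<n} = s"
        using s by (auto simp: neg_orthant_def PiE_iff extensional_def fun_eq_iff)
      then show "composite m n f \<psi> ?v = exp (a * \<psi> s)"
        using neg[OF s] tendsto_Lim[OF _ lim] by (auto simp: composite_def Let_def fv)
    qed
  qed
  define a where "a k = inverse (real (Suc k))" for k
  have a: "0 < a k" for k by (simp add: a_def)
  have a0: "a \<longlonglongrightarrow> 0" unfolding a_def[abs_def] by (rule LIMSEQ_inverse_real_of_nat)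
  have lim: "(\<lambda>k. (1 / a k) * (exp (a k * x) - 1)) \<longlonglongrightarrow> x" for x
  proof -
    have "((\<lambda>t. exp (t * x)) has_field_derivative x) (at 0)"
      by (auto intro!: derivative_eq_intros)
    then have "(\<lambda>k. (exp (a k * x) - exp (0 * x)) / (a k - 0)) \<longlonglongrightarrow> x"
      unfolding has_field_derivative_iff tendsto_at_iff_sequentially comp_def
      using a0 a less_imp_neq by (metis (no_types, lifting) DiffI UNIV_I singletonD)
    then show ?thesis by simp
  qed
  show ?thesis
    unfolding diff_bernstein_def
  proof (intro allI impI)
    fix i h assume i: "i < n" and h: "(0::real) < h"
    show "diff_monotone n (back_diff i h \<psi>)"
    proof (rule diff_monotone_LIMSEQ)
      fix k
      show "diff_monotone n (\<lambda>s. (1 / a k) * back_diff i h (\<lambda>s. exp (a k * \<psi> s)) s)"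
        using a[of k] by (intro diff_monotone_mult diff_monotone_const diff_monotone_back_diff i h expo) auto
    next
      fix s
      have "(\<lambda>k. (1 / a k) * (exp (a k * \<psi> s) - 1) - (1 / a k) * (exp (a k * \<psi> (s(i := s i - h))) - 1))
        \<longlonglongrightarrow> \<psi> s - \<psi> (s(i := s i - h))"
        by (intro tendsto_diff lim)
      then show "(\<lambda>k. (1 / a k) * back_diff i h (\<lambda>s. exp (a k * \<psi> s)) s) \<longlonglongrightarrow> back_diff i h \<psi> s"
        by (simp add: back_diff_def algebra_simps)
    qed
  qed
qed

theorem mainTheorem1:
  fixes m n :: nat and \<psi> :: "(nat \<Rightarrow> real) \<Rightarrow> real"
  assumes "1 \<le> m" and "1 \<le> n"
    and "\<And>s. s \<in> neg_orthant n \<Longrightarrow> \<psi> s \<le> 0"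
  shows
    "(\<psi> \<in> negative_bernstein n \<longleftrightarrow>
       (\<exists>(c0::real) (c1::nat \<Rightarrow> real).
          (\<psi> \<longlongrightarrow> c0) (coordwise n (at_left 0)) \<and>
          (\<forall>j<n. (partial_deriv j \<psi> \<longlongrightarrow> c1 j) (coordwise n at_bot)) \<and>
          c1 \<in> nonneg_orthant n \<and>
          (\<exists>!\<mu>::(nat \<Rightarrow> real) measure.
             radon_measure_on (nonneg_orthant n - {origin n}) \<mu> \<and>
             (\<forall>\<^sub>F \<delta> in at_right 0.
                (\<forall>j<n. set_integrable \<mu> (half_open_cube n \<delta> - {origin n}) (\<lambda>u. u j)) \<and>
                emeasure \<mu> (nonneg_orthant n - half_open_cube n \<delta>) < \<infinity>) \<and>
             (\<forall>s\<in>neg_orthant n.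
                integrable \<mu> (\<lambda>u. exp (dot n s u) - 1) \<and>
                \<psi> s = c0 + dot n c1 s + (\<integral>u. (exp (dot n s u) - 1) \<partial>\<mu>)))))
     \<and>
     (\<psi> \<in> negative_bernstein n \<longleftrightarrow>
       (\<forall>f. absolutely_monotone m f \<and> composable m n f \<psi> \<longrightarrow>
          absolutely_monotone (m + n - 1) (composite m n f \<psi>)))"
  (is "(_ \<longleftrightarrow> ?two) \<and> (_ \<longleftrightarrow> ?three)")
proof (intro conjI iffI)
  note m = assms(1) and n = assms(2) and neg = assms(3)
  assume \<psi>: "\<psi> \<in> negative_bernstein n"
  then have db: "diff_bernstein n \<psi>" by (rule negative_bernstein_imp_diff_bernstein)
  show ?three
    using composite_absolutely_monotone[OF m n neg db] by blast
  obtain c0 c \<mu> where "levy_khintchine n c0 c \<mu> \<psi>"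
    using diff_bernstein_levy_khintchine[OF n db neg] by blast
  then interpret levy_khintchine n c0 c \<mu> \<psi> .
  show ?two
  proof (rule exI[of _ c0], rule exI[of _ c], intro conjI allI impI)
    show "(\<psi> \<longlongrightarrow> c0) (coordwise n (at_left 0))"
      by (rule limit_at_zero)
    show "(partial_deriv j \<psi> \<longlongrightarrow> c j) (coordwise n at_bot)" if "j < n" for j
      by (rule limit_of_gradient[OF that])
    show "c \<in> nonneg_orthant n" by (rule drift)
    show "\<exists>!\<mu>. radon_measure_on (nonneg_orthant n - {origin n}) \<mu> \<and>
             (\<forall>\<^sub>F \<delta> in at_right 0.
                (\<forall>j<n. set_integrable \<mu> (half_open_cube n \<delta> - {origin n}) (\<lambda>u. u j)) \<and>
                emeasure \<mu> (nonneg_orthant n - half_open_cube n \<delta>) < \<infinity>) \<and>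
             (\<forall>s\<in>neg_orthant n.
                integrable \<mu> (\<lambda>u. exp (dot n s u) - 1) \<and>
                \<psi> s = c0 + dot n c s + (\<integral>u. (exp (dot n s u) - 1) \<partial>\<mu>))"
    proof (rule ex1I[of _ \<mu>], intro conjI)
      note props = levy_measure_properties[OF n sets integrable]
      show "radon_measure_on (nonneg_orthant n - {origin n}) \<mu>" by (rule props(1))
      have "\<forall>\<^sub>F \<delta> in at_right 0. (0::real) < \<delta>" by (rule eventually_at_right_less)
      then show "\<forall>\<^sub>F \<delta> in at_right 0.
                (\<forall>j<n. set_integrable \<mu> (half_open_cube n \<delta> - {origin n}) (\<lambda>u. u j)) \<and>
                emeasure \<mu> (nonneg_orthant n - half_open_cube n \<delta>) < \<infinity>"
        by eventually_elim (intro conjI allI impI props; assumption)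
      show "\<forall>s\<in>neg_orthant n. integrable \<mu> (\<lambda>u. exp (dot n s u) - 1) \<and>
                \<psi> s = c0 + dot n c s + (\<integral>u. (exp (dot n s u) - 1) \<partial>\<mu>)" using integrable representation by blast
    next
      fix \<mu>'
      assume \<mu>': "radon_measure_on (nonneg_orthant n - {origin n}) \<mu>' \<and>
             (\<forall>\<^sub>F \<delta> in at_right 0.
                (\<forall>j<n. set_integrable \<mu>' (half_open_cube n \<delta> - {origin n}) (\<lambda>u. u j)) \<and>
                emeasure \<mu>' (nonneg_orthant n - half_open_cube n \<delta>) < \<infinity>) \<and>
             (\<forall>s\<in>neg_orthant n.
                integrable \<mu>' (\<lambda>u. exp (dot n s u) - 1) \<and>
                \<psi> s = c0 + dot n c s + (\<integral>u. (exp (dot n s u) - 1) \<partial>\<mu>'))"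
      show "\<mu>' = \<mu>"
      proof (rule levy_measure_unique)
        show "sets \<mu>' = sets (borel_punctured n)"
          using \<mu>' by (simp add: radon_measure_on_def)
        fix s assume s: "s \<in> neg_orthant n"
        show "integrable \<mu>' (\<lambda>u. exp (dot n s u) - 1)" using \<mu>' s by blast
        have "\<psi> s = c0 + dot n c s + (\<integral>u. (exp (dot n s u) - 1) \<partial>\<mu>')" using \<mu>' s by blast
        then show "(\<integral>u. (exp (dot n s u) - 1) \<partial>\<mu>') = (\<integral>u. (exp (dot n s u) - 1) \<partial>\<mu>)"
          using representation[OF s] by linarith
      qed (use sets integrable in auto)
    qed
  qed
next
  assume ?two
  then obtain c0 c \<mu> where c: "c \<in> nonneg_orthant n"
    and \<mu>: "radon_measure_on (nonneg_orthant n - {origin n}) \<mu>"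
    and int_rep: "\<forall>s\<in>neg_orthant n. integrable \<mu> (\<lambda>u. exp (dot n s u) - 1) \<and>
       \<psi> s = c0 + dot n c s + (\<integral>u. (exp (dot n s u) - 1) \<partial>\<mu>)"
    by (elim exE conjE ex1E) (rule that)
  have "levy_khintchine n c0 c \<mu> \<psi>"
    by unfold_locales (use assms(2) c \<mu> int_rep in \<open>auto simp: radon_measure_on_def\<close>)
  then show "\<psi> \<in> negative_bernstein n"
    by (rule levy_khintchine.negative_bernstein) (rule assms(3))
next
  assume three: ?three
  have db: "diff_bernstein n \<psi>"
    by (rule composites_imp_diff_bernstein[OF assms]) (use three in blast)+
  obtain c0 c \<mu> where "levy_khintchine n c0 c \<mu> \<psi>"
    using diff_bernstein_levy_khintchine[OF assms(2) db assms(3)] by blast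
  then show "\<psi> \<in> negative_bernstein n"
    by (rule levy_khintchine.negative_bernstein) (rule assms(3))
qed

end
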